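(* Let $X$ be a path-connected, locally path-connected and locally categorical space with a residually finite fundamental group. Let $p\colon E\to X$ be a regular, $\pi_1$-profinite lifting projection with compact metrizable fibres and with dense leaves, and let $F=p^{-1}(x_0)$ for a base point $x_0\in X$. Then the map $$\overline\Phi\colon F\times_{\pi_1(X)}L\to E,\qquad [u,\widehat x]\mapsto u\alpha,$$ where $\alpha$ is any path in $X$ starting at $x_0$ with $\widehat x_0\alpha=\widehat x$, is a homeomorphism. Here $L$ is the leaf through the base point $\widehat x_0$ of the inverse limit $\widehat X$ of all regular finite-sheeted coverings of $X$, and $F\times_{\pi_1(X)}L$ is the associated Borel construction.
   Context: Definitions. A lifting projection is a Hurewicz fibration with the unique path-lifting property. For a lifting projection $p\colon E\to X$, a point $\tilde x\in E$ and a path $\alpha\colon I\to X$ with $\alpha(0)=p(\tilde x)$, write $\tilde x\alpha\in p^{-1}(\alpha(1))$ for the endpoint of the unique lift of $\alpha$ starting at $\tilde x$; it depends only on the homotopy class of $\alpha$ rel endpoints. In particular $\pi_1(X,x_0)$ acts on the right on $F=p^{-1}(x_0)$, where $F$ has the subspace topology from $E$. - $A(p)$ is the group of deck transformations (homeomorphisms $\varphi\colon E\to E$ with $p\varphi=p$); $p$ is regular if $A(p)$ acts transitively on the fibres. A leaf is a path-component; $p$ has dense leaves if every leaf of $E$ is dense in $E$. - $p$ (with compact fibres) is $\pi_1$-profinite if, for a base point $\tilde x_0\in F$, the map $\theta\colon\pi_1(X,x_0)\to F$, $\alpha\mapsto\tilde x_0\alpha$, is continuous, where $\pi_1(X,x_0)$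 carries the profinite topology (the group topology in which the normal subgroups of finite index form a neighbourhood base at the identity). - An open set $U\subseteq X$ is categorical if the inclusion $U\hookrightarrow X$ is homotopic to a constant map; $X$ is locally categorical if it is covered by categorical open sets. The space $L$. Let $\widehat p\colon\widehat X\to X$ be the inverse limit of all (path-connected, pointed) regular finite-sheeted coverings of $X$; it is a lifting projection. Fix $\widehat x_0\in\widehat p^{-1}(x_0)$ and let $L$ be the leaf of $\widehat X$ containing $\widehat x_0$, with the subspace topology from $\widehat X$. Since $\pi_1(X)$ is residually finite, $L$ is simply connected, and $\alpha\mapsto\widehat x_0\alpha$ identifies $\pi_1(X,x_0)$ with $\widehat p^{-1}(x_0)\cap L$. The group $\pi_1(X,x_0)$ acts on $L$ from the left by deck transformations: for $\gamma\in\pi_1(X,x_0)$ and $\widehat y=\widehat x_0\beta\in L$ (with $\beta$ a path in $X$ starting at $x_0$), $\gamma\widehat y:=(\widehat x_0\gamma)\beta=\widehat x_0(\gamma\cdot\beta)$. The Borel construction $F\times_{\pi_1(X)}L$ is the quotient space of $F\times L$ by the equivalence relation $(u\gamma,\widehat y)\sim(u,\gamma\widehat y)$, $\gamma\in\pi_1(X,x_0)$, with the quotient topology. Given $(u,\widehat x)\in F\times L$, choose a path $\alpha$ in $X$ starting at $x_0$ with $\widehat x_0\alpha=\widehat x$; then $\Phi(u,\widehat x):=u\alpha\in E$ is independent of the choice of $\alpha$, and $\Phi\colon F\times L\to E$ induces the well-defined map $\overline\Phi$. *)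

theory Defs
  imports "HOL-Analysis.Analysis" "HOL-Algebra.Coset"
begin

section \<open>Quotient topology\<close>

definition quotient_topology :: "'a topology \<Rightarrow> ('a \<Rightarrow> 'b) \<Rightarrow> 'b topology" where
  "quotient_topology X f =
     topology (\<lambda>V. V \<subseteq> f ` topspace X \<and> openin X {x \<in> topspace X. f x \<in> V})"

lemma openin_quotient_topology:
  "openin (quotient_topology X f) V \<longleftrightarrow>
     V \<subseteq> f ` topspace X \<and> openin X {x \<in> topspace X. f x \<in> V}"
proof -
  let ?L = "\<lambda>V. V \<subseteq> f ` topspace X \<and> openin X {x \<in> topspace X. f x \<in> V}"
  have "?L (S \<inter> T)" if "?L S" "?L T" for S T
  proof -
    have "{x \<in> topspace X. f x \<in> S \<inter> T} =
          {x \<in> topspace X. f x \<in> S} \<inter> {x \<in> topspace X. f x \<in> T}" by auto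
    then show ?thesis using that by auto
  qed
  moreover have "?L (\<Union>K)" if "\<forall>S\<in>K. ?L S" for K
  proof -
    have "{x \<in> topspace X. f x \<in> \<Union>K} = (\<Union>S\<in>K. {x \<in> topspace X. f x \<in> S})" by auto
    moreover have "openin X (\<Union>S\<in>K. {x \<in> topspace X. f x \<in> S})"
      using that by (intro openin_Union) auto
    ultimately show ?thesis using that by auto
  qed
  ultimately have "istopology ?L"
    unfolding istopology_def by blast
  then show ?thesis
    unfolding quotient_topology_def by simp
qed

lemma topspace_quotient_topology [simp]:
  "topspace (quotient_topology X f) = f ` topspace X"
proof
  show "topspace (quotient_topology X f) \<subseteq> f ` topspace X"
    using openin_quotient_topology[of X f "topspace (quotient_topology X f)"] by simp
  have "{x \<in> topspace X. f x \<in> f ` topspace X} = topspace X" by auto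
  then have "openin (quotient_topology X f) (f ` topspace X)"
    by (simp add: openin_quotient_topology)
  then show "f ` topspace X \<subseteq> topspace (quotient_topology X f)"
    by (rule openin_subset)
qed

lemma quotient_map_quotient_topology: "quotient_map X (quotient_topology X f) f"
  by (simp add: quotient_map_def openin_quotient_topology)

section \<open>Paths and the fundamental group\<close>

definition path_between :: "'a topology \<Rightarrow> 'a \<Rightarrow> 'a \<Rightarrow> (real \<Rightarrow> 'a) \<Rightarrow> bool" where
  "path_between X a b \<alpha> \<longleftrightarrow> pathin X \<alpha> \<and> \<alpha> 0 = a \<and> \<alpha> 1 = b"

text \<open>The library's concatenation of paths is restricted to types of class
  \<^class>\<open>topological_space\<close>.\<close>

definition path_concat :: "(real \<Rightarrow> 'a) \<Rightarrow> (real \<Rightarrow> 'a) \<Rightarrow> real \<Rightarrow> 'a" where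
  "path_concat \<alpha> \<beta> = (\<lambda>t. if t \<le> 1/2 then \<alpha> (2 * t) else \<beta> (2 * t - 1))"

definition path_homotopic :: "'a topology \<Rightarrow> (real \<Rightarrow> 'a) \<Rightarrow> (real \<Rightarrow> 'a) \<Rightarrow> bool" where
  "path_homotopic X \<alpha> \<beta> \<longleftrightarrow>
     homotopic_with (\<lambda>\<gamma>. \<gamma> 0 = \<alpha> 0 \<and> \<gamma> 1 = \<alpha> 1) (top_of_set {0..1}) X \<alpha> \<beta>"

definition path_class :: "'a topology \<Rightarrow> (real \<Rightarrow> 'a) \<Rightarrow> (real \<Rightarrow> 'a) set" where
  "path_class X \<alpha> = {\<beta>. path_homotopic X \<alpha> \<beta>}"

text \<open>The union in the product ranges over representatives which all give the same class.\<close>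

definition pi1 :: "'a topology \<Rightarrow> 'a \<Rightarrow> (real \<Rightarrow> 'a) set monoid" where
  "pi1 X x0 =
     \<lparr>carrier = path_class X ` Collect (path_between X x0 x0),
      mult = (\<lambda>A B. \<Union>\<alpha>\<in>A. \<Union>\<beta>\<in>B. path_class X (path_concat \<alpha> \<beta>)),
      one = path_class X (\<lambda>_. x0)\<rparr>"

section \<open>Profinite topology and residual finiteness\<close>

definition finite_index_normal :: "('g, 'm) monoid_scheme \<Rightarrow> 'g set \<Rightarrow> bool" where
  "finite_index_normal G N \<longleftrightarrow> N \<lhd> G \<and> finite (rcosets\<^bsub>G\<^esub> N)"

definition residually_finite :: "('g, 'm) monoid_scheme \<Rightarrow> bool" where
  "residually_finite G \<longleftrightarrow>
     (\<forall>g \<in> carrier G. g \<noteq> \<one>\<^bsub>G\<^esub> \<longrightarrow> (\<exists>N. finite_index_normal G N \<and> g \<notin> N))"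

definition profinite_topology :: "('g, 'm) monoid_scheme \<Rightarrow> 'g topology" where
  "profinite_topology G =
     topology (\<lambda>U. U \<subseteq> carrier G \<and>
                   (\<forall>g\<in>U. \<exists>N. finite_index_normal G N \<and> g <#\<^bsub>G\<^esub> N \<subseteq> U))"

lemma finite_index_normal_Int:
  assumes "finite_index_normal G M" "finite_index_normal G N"
  shows "finite_index_normal G (M \<inter> N)"
proof -
  interpret M: normal M G using assms by (simp add: finite_index_normal_def)
  interpret N: normal N G using assms by (simp add: finite_index_normal_def)
  have sub: "subgroup (M \<inter> N) G"
    by (intro M.subgroups_Inter_pair M.subgroup_axioms N.subgroup_axioms)
  have "(M \<inter> N) \<lhd> G"
    using sub M.inv_op_closed2 N.inv_op_closed2 by (auto simp: M.normal_inv_iff)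
  moreover have "rcosets\<^bsub>G\<^esub> (M \<inter> N) \<subseteq> (\<lambda>(A, B). A \<inter> B) ` ((rcosets\<^bsub>G\<^esub> M) \<times> (rcosets\<^bsub>G\<^esub> N))"
  proof
    fix C assume "C \<in> rcosets\<^bsub>G\<^esub> (M \<inter> N)"
    then obtain g where g: "g \<in> carrier G" "C = (M \<inter> N) #>\<^bsub>G\<^esub> g"
      by (auto simp: RCOSETS_def)
    have "(M \<inter> N) #>\<^bsub>G\<^esub> g = (M #>\<^bsub>G\<^esub> g) \<inter> (N #>\<^bsub>G\<^esub> g)"
      using g(1) M.subset N.subset by (fastforce simp: r_coset_def)
    with g show "C \<in> (\<lambda>(A, B). A \<inter> B) ` ((rcosets\<^bsub>G\<^esub> M) \<times> (rcosets\<^bsub>G\<^esub> N))"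
      by (auto simp: RCOSETS_def)
  qed
  ultimately show ?thesis
    using assms by (auto simp: finite_index_normal_def intro: finite_subset)
qed

lemma openin_profinite_topology:
  "openin (profinite_topology G) U \<longleftrightarrow>
     U \<subseteq> carrier G \<and> (\<forall>g\<in>U. \<exists>N. finite_index_normal G N \<and> g <#\<^bsub>G\<^esub> N \<subseteq> U)"
proof -
  let ?L = "\<lambda>U. U \<subseteq> carrier G \<and> (\<forall>g\<in>U. \<exists>N. finite_index_normal G N \<and> g <#\<^bsub>G\<^esub> N \<subseteq> U)"
  have "?L (S \<inter> T)" if ST: "?L S" "?L T" for S T
  proof (intro conjI ballI)
    fix g assume "g \<in> S \<inter> T"
    then obtain M N where "finite_index_normal G M" "g <#\<^bsub>G\<^esub> M \<subseteq> S"
        "finite_index_normal G N" "g <#\<^bsub>G\<^esub> N \<subseteq> T"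
      using ST by blast
    then show "\<exists>N. finite_index_normal G N \<and> g <#\<^bsub>G\<^esub> N \<subseteq> S \<inter> T"
      using finite_index_normal_Int[of G M N]
      by (intro exI[of _ "M \<inter> N"]) (auto simp: l_coset_def)
  qed (use ST in blast)
  moreover have "?L (\<Union>K)" if "\<forall>S\<in>K. ?L S" for K
    using that by (meson Union_iff Union_least Union_upper subset_trans)
  ultimately have "istopology ?L"
    unfolding istopology_def by blast
  then show ?thesis
    unfolding profinite_topology_def by simp
qed

section \<open>Lifting projections\<close>

definition has_homotopy_lifting ::
    "'c topology \<Rightarrow> 'b topology \<Rightarrow> 'a topology \<Rightarrow> ('b \<Rightarrow> 'a) \<Rightarrow> bool" where
  "has_homotopy_lifting Y E X p \<longleftrightarrow>
     (\<forall>f H. continuous_map Y E f \<and>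
            continuous_map (prod_topology (top_of_set {0..1::real}) Y) X H \<and>
            (\<forall>y\<in>topspace Y. H (0, y) = p (f y)) \<longrightarrow>
        (\<exists>K. continuous_map (prod_topology (top_of_set {0..1::real}) Y) E K \<and>
             (\<forall>y\<in>topspace Y. K (0, y) = f y) \<and>
             (\<forall>t\<in>{0..1}. \<forall>y\<in>topspace Y. p (K (t, y)) = H (t, y))))"

text \<open>A definition cannot quantify over all types, so the test spaces are the topologies on one
  fixed type, which is large enough: the lemma \<open>hurewicz_fibration_all_spaces\<close> gives homotopy
  lifting for test spaces of every type.\<close>

definition hurewicz_fibration :: "'b topology \<Rightarrow> 'a topology \<Rightarrow> ('b \<Rightarrow> 'a) \<Rightarrow> bool" where
  "hurewicz_fibration E X p \<longleftrightarrow>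
     continuous_map E X p \<and>
     (\<forall>Y :: ('b \<times> (real \<Rightarrow> 'a)) topology. has_homotopy_lifting Y E X p)"

lemma hurewicz_fibration_all_spaces:
  fixes Y :: "'c topology"
  assumes "hurewicz_fibration E X p"
  shows "has_homotopy_lifting Y E X p"
  unfolding has_homotopy_lifting_def
proof (intro allI impI, elim conjE)
  let ?I = "top_of_set {0..1::real}"
  fix f H
  assume f: "continuous_map Y E f" and H: "continuous_map (prod_topology ?I Y) X H"
    and fH: "\<forall>y\<in>topspace Y. H (0, y) = p (f y)"
  define g where "g = (\<lambda>y. (f y, \<lambda>t. H (t, y)))"
  define Z where "Z = quotient_topology Y g"
  have q: "quotient_map Y Z g"
    unfolding Z_def by (rule quotient_map_quotient_topology)
  have "compact_space ?I" "Hausdorff_space ?I"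
    by (auto simp: compact_space_subtopology Hausdorff_space_subtopology)
  then have "locally_compact_space ?I"
    by (simp add: compact_imp_locally_compact_space)
  then have qI: "quotient_map (prod_topology ?I Y) (prod_topology ?I Z) (\<lambda>(t, y). (t, g y))"
    using \<open>Hausdorff_space ?I\<close> q by (intro quotient_map_prod_right) auto
  have "continuous_map Y E (fst \<circ> g)"
    using f by (simp add: g_def o_def)
  then have fst: "continuous_map Z E fst"
    using continuous_compose_quotient_map_eq[OF q, of E fst] by blast
  have "(\<lambda>(t, z). snd z t) \<circ> (\<lambda>(t, y). (t, g y)) = H"
    by (auto simp: g_def)
  then have ev: "continuous_map (prod_topology ?I Z) X (\<lambda>(t, z). snd z t)"
    using H continuous_compose_quotient_map_eq[OF qI, of X "\<lambda>(t, z). snd z t"] by metis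
  have "\<forall>z\<in>topspace Z. (\<lambda>(t, z). snd z t) (0, z) = p (fst z)"
    using fH by (auto simp: Z_def g_def)
  with fst ev obtain K where K: "continuous_map (prod_topology ?I Z) E K"
      "\<forall>z\<in>topspace Z. K (0, z) = fst z"
      "\<forall>t\<in>{0..1}. \<forall>z\<in>topspace Z. p (K (t, z)) = (\<lambda>(t, z). snd z t) (t, z)"
    using assms unfolding hurewicz_fibration_def has_homotopy_lifting_def by blast
  have "continuous_map (prod_topology ?I Y) E (K \<circ> (\<lambda>(t, y). (t, g y)))"
    using K(1) quotient_imp_continuous_map[OF qI] continuous_map_compose by blast
  moreover have "\<forall>y\<in>topspace Y. (K \<circ> (\<lambda>(t, y). (t, g y))) (0, y) = f y"
    using K(2) by (simp add: Z_def) (simp add: g_def)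
  moreover have "\<forall>t\<in>{0..1}. \<forall>y\<in>topspace Y. p ((K \<circ> (\<lambda>(t, y). (t, g y))) (t, y)) = H (t, y)"
    using K(3) by (simp add: Z_def) (simp add: g_def)
  ultimately show "\<exists>K. continuous_map (prod_topology ?I Y) E K \<and>
      (\<forall>y\<in>topspace Y. K (0, y) = f y) \<and>
      (\<forall>t\<in>{0..1}. \<forall>y\<in>topspace Y. p (K (t, y)) = H (t, y))"
    by blast
qed

definition unique_path_lifting :: "'b topology \<Rightarrow> ('b \<Rightarrow> 'a) \<Rightarrow> bool" where
  "unique_path_lifting E p \<longleftrightarrow>
     (\<forall>\<omega> \<omega>'. pathin E \<omega> \<and> pathin E \<omega>' \<and> \<omega> 0 = \<omega>' 0 \<and> (\<forall>t\<in>{0..1}. p (\<omega> t) = p (\<omega>' t)) \<longrightarrow>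
        (\<forall>t\<in>{0..1}. \<omega> t = \<omega>' t))"

definition lifting_projection :: "'b topology \<Rightarrow> 'a topology \<Rightarrow> ('b \<Rightarrow> 'a) \<Rightarrow> bool" where
  "lifting_projection E X p \<longleftrightarrow> hurewicz_fibration E X p \<and> unique_path_lifting E p"

definition fibre :: "'b topology \<Rightarrow> ('b \<Rightarrow> 'a) \<Rightarrow> 'a \<Rightarrow> 'b topology" where
  "fibre E p x = subtopology E {e. p e = x}"

definition lift_end :: "'b topology \<Rightarrow> ('b \<Rightarrow> 'a) \<Rightarrow> 'b \<Rightarrow> (real \<Rightarrow> 'a) \<Rightarrow> 'b" where
  "lift_end E p e \<alpha> =
     (THE y. \<exists>\<omega>. path_between E e y \<omega> \<and> (\<forall>t\<in>{0..1}. p (\<omega> t) = \<alpha> t))"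

definition lift_end_class :: "'b topology \<Rightarrow> ('b \<Rightarrow> 'a) \<Rightarrow> 'b \<Rightarrow> (real \<Rightarrow> 'a) set \<Rightarrow> 'b" where
  "lift_end_class E p e c = (THE y. \<exists>\<alpha>\<in>c. y = lift_end E p e \<alpha>)"

definition deck_transformations :: "'b topology \<Rightarrow> ('b \<Rightarrow> 'a) \<Rightarrow> ('b \<Rightarrow> 'b) set" where
  "deck_transformations E p =
     {\<phi>. homeomorphic_map E E \<phi> \<and> (\<forall>e\<in>topspace E. p (\<phi> e) = p e)}"

definition regular_projection :: "'b topology \<Rightarrow> ('b \<Rightarrow> 'a) \<Rightarrow> bool" where
  "regular_projection E p \<longleftrightarrow>
     (\<forall>e\<in>topspace E. \<forall>e'\<in>topspace E. p e = p e' \<longrightarrow>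
        (\<exists>\<phi>\<in>deck_transformations E p. \<phi> e = e'))"

definition dense_leaves :: "'b topology \<Rightarrow> bool" where
  "dense_leaves E \<longleftrightarrow>
     (\<forall>e\<in>topspace E. E closure_of (path_component_of_set E e) = topspace E)"

definition pi1_profinite :: "'b topology \<Rightarrow> 'a topology \<Rightarrow> ('b \<Rightarrow> 'a) \<Rightarrow> 'a \<Rightarrow> bool" where
  "pi1_profinite E X p x0 \<longleftrightarrow>
     (\<exists>e0 \<in> topspace (fibre E p x0).
        continuous_map (profinite_topology (pi1 X x0)) (fibre E p x0)
          (lift_end_class E p e0))"

definition categorical :: "'a topology \<Rightarrow> 'a set \<Rightarrow> bool" where
  "categorical X U \<longleftrightarrow>
     (\<exists>c. homotopic_with (\<lambda>_. True) (subtopology X U) X (\<lambda>x. x) (\<lambda>_. c))"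

definition locally_categorical :: "'a topology \<Rightarrow> bool" where
  "locally_categorical X \<longleftrightarrow>
     (\<forall>x\<in>topspace X. \<exists>U. openin X U \<and> x \<in> U \<and> categorical X U)"

section \<open>The inverse limit of the regular finite-sheeted coverings\<close>

definition covering_map :: "'b topology \<Rightarrow> 'a topology \<Rightarrow> ('b \<Rightarrow> 'a) \<Rightarrow> bool" where
  "covering_map C X q \<longleftrightarrow>
     continuous_map C X q \<and> q ` topspace C = topspace X \<and>
     (\<forall>x\<in>topspace X. \<exists>U. openin X U \<and> x \<in> U \<and>
        (\<exists>\<V>. \<Union>\<V> = {c \<in> topspace C. q c \<in> U} \<and>
             (\<forall>V\<in>\<V>. openin C V) \<and> pairwise disjnt \<V> \<and>
             (\<forall>V\<in>\<V>. homeomorphic_map (subtopology C V) (subtopology X U) q)))"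

text \<open>A pointed covering \<open>(C, q, c)\<close> consists of its total space, its projection and its base
  point. Every finite-sheeted covering of \<open>X\<close> is isomorphic to one whose total space is carried by
  a subset of \<open>'a \<times> nat\<close> (number the points of each fibre), so that this type
  accommodates all of them up to isomorphism. Isomorphic copies occurring several times do not
  affect the limit, since the isomorphisms are among the bonding maps.\<close>

type_synonym 'a pointed_cover =
  "('a \<times> nat) topology \<times> ('a \<times> nat \<Rightarrow> 'a) \<times> ('a \<times> nat)"

definition finite_regular_covers :: "'a topology \<Rightarrow> 'a \<Rightarrow> 'a pointed_cover set" where
  "finite_regular_covers X x0 =
     {(C, q, c). covering_map C X q \<and> path_connected_space C \<and> regular_projection C q \<and>
        (\<forall>x\<in>topspace X. finite {y \<in> topspace C. q y = x}) \<and>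
        c \<in> topspace C \<and> q c = x0}"

fun cover_morphism :: "'a pointed_cover \<Rightarrow> 'a pointed_cover \<Rightarrow> ('a \<times> nat \<Rightarrow> 'a \<times> nat) \<Rightarrow> bool" where
  "cover_morphism (C, q, c) (C', q', c') f \<longleftrightarrow>
     continuous_map C C' f \<and> (\<forall>y\<in>topspace C. q' (f y) = q y) \<and> f c = c'"

definition Xhat :: "'a topology \<Rightarrow> 'a \<Rightarrow> ('a pointed_cover \<Rightarrow> 'a \<times> nat) topology" where
  "Xhat X x0 =
     subtopology (product_topology fst (finite_regular_covers X x0))
       {y. \<forall>i\<in>finite_regular_covers X x0. \<forall>j\<in>finite_regular_covers X x0.
             \<forall>f. cover_morphism i j f \<longrightarrow> f (y i) = y j}"

text \<open>All coordinates of a point of the limit lie over the same point of \<open>X\<close>, as the coverings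
  map to the one-sheeted covering.\<close>

definition phat :: "'a topology \<Rightarrow> 'a \<Rightarrow> ('a pointed_cover \<Rightarrow> 'a \<times> nat) \<Rightarrow> 'a" where
  "phat X x0 y = (THE x. \<forall>(C, q, c)\<in>finite_regular_covers X x0. q (y (C, q, c)) = x)"

definition leafL ::
    "'a topology \<Rightarrow> 'a \<Rightarrow> ('a pointed_cover \<Rightarrow> 'a \<times> nat) \<Rightarrow>
     ('a pointed_cover \<Rightarrow> 'a \<times> nat) topology" where
  "leafL X x0 xhat0 = subtopology (Xhat X x0) (path_component_of_set (Xhat X x0) xhat0)"

section \<open>The Borel construction\<close>

definition pi1_act_L ::
    "'a topology \<Rightarrow> 'a \<Rightarrow> ('a pointed_cover \<Rightarrow> 'a \<times> nat) \<Rightarrow> (real \<Rightarrow> 'a) set \<Rightarrow>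
     ('a pointed_cover \<Rightarrow> 'a \<times> nat) \<Rightarrow> ('a pointed_cover \<Rightarrow> 'a \<times> nat)" where
  "pi1_act_L X x0 xhat0 c y =
     (THE z. \<exists>\<gamma>\<in>c. \<exists>\<beta>. pathin X \<beta> \<and> \<beta> 0 = x0 \<and>
        lift_end (Xhat X x0) (phat X x0) xhat0 \<beta> = y \<and>
        z = lift_end (Xhat X x0) (phat X x0) xhat0 (path_concat \<gamma> \<beta>))"

definition borel_rel ::
    "'b topology \<Rightarrow> 'a topology \<Rightarrow> ('b \<Rightarrow> 'a) \<Rightarrow> 'a \<Rightarrow> ('a pointed_cover \<Rightarrow> 'a \<times> nat) \<Rightarrow>
     (('b \<times> ('a pointed_cover \<Rightarrow> 'a \<times> nat)) \<times> ('b \<times> ('a pointed_cover \<Rightarrow> 'a \<times> nat))) set" where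
  "borel_rel E X p x0 xhat0 =
     {((lift_end_class E p u c, y), (u, pi1_act_L X x0 xhat0 c y)) | u c y.
        u \<in> topspace (fibre E p x0) \<and> c \<in> carrier (pi1 X x0) \<and>
        y \<in> topspace (leafL X x0 xhat0)}"

definition borel_space ::
    "'b topology \<Rightarrow> 'a topology \<Rightarrow> ('b \<Rightarrow> 'a) \<Rightarrow> 'a \<Rightarrow> ('a pointed_cover \<Rightarrow> 'a \<times> nat) \<Rightarrow>
     ('b \<times> ('a pointed_cover \<Rightarrow> 'a \<times> nat)) set topology" where
  "borel_space E X p x0 xhat0 =
     quotient_topology (prod_topology (fibre E p x0) (leafL X x0 xhat0))
       (\<lambda>z. borel_rel E X p x0 xhat0 `` {z})"

definition Phi ::
    "'b topology \<Rightarrow> 'a topology \<Rightarrow> ('b \<Rightarrow> 'a) \<Rightarrow> 'a \<Rightarrow> ('a pointed_cover \<Rightarrow> 'a \<times> nat) \<Rightarrow>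
     'b \<times> ('a pointed_cover \<Rightarrow> 'a \<times> nat) \<Rightarrow> 'b" where
  "Phi E X p x0 xhat0 = (\<lambda>(u, y).
     THE e. \<exists>\<alpha>. pathin X \<alpha> \<and> \<alpha> 0 = x0 \<and>
       lift_end (Xhat X x0) (phat X x0) xhat0 \<alpha> = y \<and> e = lift_end E p u \<alpha>)"

definition Phibar ::
    "'b topology \<Rightarrow> 'a topology \<Rightarrow> ('b \<Rightarrow> 'a) \<Rightarrow> 'a \<Rightarrow> ('a pointed_cover \<Rightarrow> 'a \<times> nat) \<Rightarrow>
     ('b \<times> ('a pointed_cover \<Rightarrow> 'a \<times> nat)) set \<Rightarrow> 'b" where
  "Phibar E X p x0 xhat0 c = (THE e. \<exists>z\<in>c. e = Phi E X p x0 xhat0 z)"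

end

theory Submission
  imports Defs
begin

text \<open>A contraction of a categorical open set \<open>U\<close> in \<open>X\<close>, lifted to \<open>E\<close>, trivialises \<open>E\<close> over \<open>U\<close>; so
  transport along short paths is continuous, and the transports of an open subset of a fibre along
  the paths in \<open>U\<close> form an open subset of \<open>E\<close>. Every normal subgroup \<open>N\<close> of finite index of \<open>\<pi>\<^sub>1(X)\<close>
  is realised by a regular finite covering, in which a loop at the base point lifts to a loop only if
  its class lies in \<open>N\<close>. By residual finiteness a point of \<open>L\<close> therefore determines the path leading
  to it up to homotopy, and the relation of the Borel construction is equality of the values of \<open>\<Phi>\<close>.
  The map \<open>\<Phi>\<close> is onto, and it is open since \<open>E\<close> is locally trivial and the coverings have small
  sheets. It is continuous because \<open>\<pi>\<^sub>1(X)\<close>, with its profinite topology, acts jointly continuously on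
  \<open>F\<close>; by regularity this only needs that the closures of the \<open>N\<close>-orbits in \<open>F\<close> have interior points,
  which follows from the density of the leaves.\<close>

section \<open>Paths and the fundamental group\<close>

text \<open>The crux is the continuity of \<open>\<Phi>\<close>. In general the topology of
  \<open>L\<close> is coarser than the one given by short paths: a point \<open>y'\<close> near
  \<open>y\<close> may be reached only along a path that differs from a path to \<open>y\<close> by
  a loop, and all that is controlled of this loop is that its class lies in a chosen
  \<open>N\<close>. So the point \<open>u'\<close> and the loop vary together, whereas
  \<open>pi1_profinite\<close> speaks of the orbit map of a single point. Deck transformations carry
  that statement to every point. It becomes uniform because the closure of \<open>orb u N\<close> is
  a neighbourhood of \<open>u\<close> that \<open>N\<close> maps into itself: the orbits under the
  finitely many cosets of \<open>N\<close> have a dense union, and one of finitely many closed sets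
  covering a nonempty space has interior points. Lifting is needed for \<open>E\<close>, for the
  finite coverings and, coordinate by coordinate, for \<open>Xhat\<close>; the locale
  \<open>path_lifting\<close> collects what the three share. The coverings belonging to the groups
  \<open>N\<close> are built from cosets directly on the type \<open>'a \<times> nat\<close>, so
  that they are themselves indices of the inverse limit and not merely isomorphic to such.\<close>

lemma prod_top_of_set: "prod_topology (top_of_set A) (top_of_set B) = top_of_set (A \<times> B)"
  by (simp add: prod_topology_subtopology subtopology_subtopology Times_Int_Times euclidean_product_topology)

lemma continuous_map_compose_on:
  assumes "continuous_map (top_of_set S) X h" "continuous_on T f" "f \<in> T \<rightarrow> S"
  shows "continuous_map (top_of_set T) X (\<lambda>t. h (f t))"
  using continuous_map_compose[of "top_of_set T" "top_of_set S" f X h] assms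
  by (auto simp: o_def)

lemma continuous_map_glue:
  fixes T :: "'c::topological_space set"
  assumes "continuous_on T p"
    and "continuous_map (top_of_set {x\<in>T. p x \<le> c}) X f"
    and "continuous_map (top_of_set {x\<in>T. c \<le> p x}) X g"
    and "\<And>x. x \<in> T \<Longrightarrow> p x = (c::real) \<Longrightarrow> f x = g x"
  shows "continuous_map (top_of_set T) X (\<lambda>x. if p x \<le> c then f x else g x)"
proof (rule continuous_map_cases_le)
  have *: "T \<inter> {x. x \<in> T \<and> p x \<le> c} = {x \<in> T. p x \<le> c}"
          "T \<inter> {x. x \<in> T \<and> c \<le> p x} = {x \<in> T. c \<le> p x}" by auto
  show "continuous_map (subtopology (top_of_set T) {x \<in> topspace (top_of_set T). p x \<le> c}) X f"
    "continuous_map (subtopology (top_of_set T) {x \<in> topspace (top_of_set T). c \<le> p x}) X g"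
    using assms by (simp_all add: subtopology_subtopology *)
qed (use assms in auto)

abbreviation path_within :: "'a topology \<Rightarrow> 'a set \<Rightarrow> (real \<Rightarrow> 'a) \<Rightarrow> bool" where
  "path_within X U \<equiv> pathin (subtopology X U)"

lemma pathin_in: "pathin X \<alpha> \<Longrightarrow> t \<in> {0..1} \<Longrightarrow> \<alpha> t \<in> topspace X"
  using path_image_subset_topspace by fastforce

definition path_rev :: "(real \<Rightarrow> 'a) \<Rightarrow> real \<Rightarrow> 'a" where
  "path_rev \<alpha> = (\<lambda>t. \<alpha> (1 - t))"

lemma path_rev_ends [simp]: "path_rev \<alpha> 0 = \<alpha> 1" "path_rev \<alpha> 1 = \<alpha> 0"
  and path_concat_ends [simp]: "path_concat \<alpha> \<beta> 0 = \<alpha> 0" "path_concat \<alpha> \<beta> 1 = \<beta> 1"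
  and path_rev_rev [simp]: "path_rev (path_rev \<alpha>) = \<alpha>"
  by (simp_all add: path_rev_def path_concat_def)

lemma pathin_rev [intro]: "pathin X \<alpha> \<Longrightarrow> pathin X (path_rev \<alpha>)"
  unfolding pathin_def path_rev_def
  by (erule continuous_map_compose_on) (auto intro!: continuous_intros)

lemma pathin_concat [intro]:
  assumes "pathin X \<alpha>" "pathin X \<beta>" "\<alpha> 1 = \<beta> 0"
  shows "pathin X (path_concat \<alpha> \<beta>)"
  unfolding pathin_def path_concat_def
proof (rule continuous_map_glue)
  show "continuous_map (top_of_set {t \<in> {0..1}. t \<le> 1/2}) X (\<lambda>t. \<alpha> (2 * t))"
    by (rule continuous_map_compose_on[OF assms(1)[unfolded pathin_def]]) (auto intro!: continuous_intros)
  show "continuous_map (top_of_set {t \<in> {0..1}. 1/2 \<le> t}) X (\<lambda>t. \<beta> (2 * t - 1))"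
    by (rule continuous_map_compose_on[OF assms(2)[unfolded pathin_def]]) (auto intro!: continuous_intros)
next
  fix t :: real assume t: "t = 1/2"
  show "\<alpha> (2 * t) = \<beta> (2 * t - 1)" unfolding t using assms(3) by simp
qed simp

section \<open>Homotopies of paths with fixed ends\<close>

lemma path_homotopicI:
  fixes h :: "real \<times> real \<Rightarrow> 'a"
  assumes "continuous_map (top_of_set ({0..1} \<times> {0..1})) X h"
    and "\<And>t. t \<in> {0..1} \<Longrightarrow> h (0, t) = \<alpha> t" "\<And>t. t \<in> {0..1} \<Longrightarrow> h (1, t) = \<beta> t"
    and "\<And>s. s \<in> {0..1} \<Longrightarrow> h (s, 0) = \<alpha> 0" "\<And>s. s \<in> {0..1} \<Longrightarrow> h (s, 1) = \<alpha> 1"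
  shows "path_homotopic X \<alpha> \<beta>"
  unfolding path_homotopic_def
proof (subst homotopic_with)
  show "\<exists>h :: real \<times> real \<Rightarrow> 'a. continuous_map (prod_topology (top_of_set {0..1}) (top_of_set {0..1})) X h \<and>
      (\<forall>t\<in>topspace (top_of_set {0..1}). h (0, t) = \<alpha> t) \<and>
      (\<forall>t\<in>topspace (top_of_set {0..1}). h (1, t) = \<beta> t) \<and>
      (\<forall>s\<in>{0..1}. h (s, 0) = \<alpha> 0 \<and> h (s, 1) = \<alpha> 1)"
    by (rule exI[of _ h]) (simp add: prod_top_of_set assms)
qed auto

lemma path_homotopicE:
  assumes "path_homotopic X \<alpha> \<beta>"
  obtains h :: "real \<times> real \<Rightarrow> 'a" where "continuous_map (top_of_set ({0..1} \<times> {0..1})) X h"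
    "\<And>t. h (0, t) = \<alpha> t" "\<And>t. h (1, t) = \<beta> t"
    "\<And>s. s \<in> {0..1} \<Longrightarrow> h (s, 0) = \<alpha> 0" "\<And>s. s \<in> {0..1} \<Longrightarrow> h (s, 1) = \<alpha> 1"
  using assms that unfolding path_homotopic_def homotopic_with_def prod_top_of_set by auto

lemma path_homotopic_imp:
  assumes "path_homotopic X \<alpha> \<beta>"
  shows "pathin X \<alpha>" "pathin X \<beta>" "\<beta> 0 = \<alpha> 0" "\<beta> 1 = \<alpha> 1"
  using homotopic_with_imp_continuous_maps[OF assms[unfolded path_homotopic_def]]
    homotopic_with_imp_property[OF assms[unfolded path_homotopic_def]]
  by (auto simp: pathin_def)

lemma path_homotopic_refl [simp]: "path_homotopic X \<alpha> \<alpha> \<longleftrightarrow> pathin X \<alpha>"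
  by (simp add: path_homotopic_def pathin_def)

lemma path_homotopic_sym: "path_homotopic X \<alpha> \<beta> \<Longrightarrow> path_homotopic X \<beta> \<alpha>"
  using path_homotopic_imp(3,4)[of X \<alpha> \<beta>] homotopic_with_symD[of _ _ X \<alpha> \<beta>]
  by (simp add: path_homotopic_def)

lemma path_homotopic_trans [trans]:
  "path_homotopic X \<alpha> \<beta> \<Longrightarrow> path_homotopic X \<beta> \<gamma> \<Longrightarrow> path_homotopic X \<alpha> \<gamma>"
  using path_homotopic_imp(3,4)[of X \<alpha> \<beta>] homotopic_with_trans[of _ _ X \<alpha> \<beta> \<gamma>]
  by (simp add: path_homotopic_def)

text \<open>The straight-line homotopy between \<open>f\<close> and \<open>g\<close> stays in the
  convex set \<open>S\<close> and is pushed forward by \<open>h\<close>. All groupoid laws below are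
  instances: with \<open>S\<close> the unit interval they compare two reparametrisations of one
  path, with \<open>S\<close> a square two ways round it.\<close>

lemma path_homotopic_convex:
  fixes S :: "'v::real_normed_vector set"
  assumes "convex S" "continuous_map (top_of_set S) X h"
    and "continuous_on {0..1} f" "f \<in> {0..1} \<rightarrow> S" "continuous_on {0..1} g" "g \<in> {0..1} \<rightarrow> S"
    and "f 0 = g 0" "f 1 = g 1"
    and "\<And>t. t \<in> {0..1} \<Longrightarrow> \<alpha> t = h (f t)" "\<And>t. t \<in> {0..1} \<Longrightarrow> \<beta> t = h (g t)"
  shows "path_homotopic X \<alpha> \<beta>"
proof (rule path_homotopicI)
  let ?l = "\<lambda>(s, t). (1 - s) *\<^sub>R f t + s *\<^sub>R g t"
  show "continuous_map (top_of_set ({0..1} \<times> {0..1})) X (\<lambda>z. h (?l z))"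
  proof (rule continuous_map_compose_on[OF assms(2)])
    show "continuous_on ({0..1} \<times> {0..1}) ?l"
      unfolding case_prod_beta
      by (intro continuous_intros continuous_on_compose2[OF assms(3)] continuous_on_compose2[OF assms(5)]) auto
    show "?l \<in> {0..1} \<times> {0..1} \<rightarrow> S"
      using assms(1,4,6) by (fastforce simp: convex_def Pi_iff)
  qed
qed (use assms in \<open>auto simp: algebra_simps simp flip: scaleR_left.add\<close>)

lemma path_homotopic_concat:
  assumes "path_homotopic X \<alpha> \<alpha>'" "path_homotopic X \<beta> \<beta>'" "\<alpha> 1 = \<beta> 0"
  shows "path_homotopic X (path_concat \<alpha> \<beta>) (path_concat \<alpha>' \<beta>')"
proof -
  obtain h :: "real \<times> real \<Rightarrow> 'a" where h: "continuous_map (top_of_set ({0..1} \<times> {0..1})) X h"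
    "\<And>t. h (0, t) = \<alpha> t" "\<And>t. h (1, t) = \<alpha>' t"
    "\<And>s. s \<in> {0..1} \<Longrightarrow> h (s, 0) = \<alpha> 0" "\<And>s. s \<in> {0..1} \<Longrightarrow> h (s, 1) = \<alpha> 1"
    using path_homotopicE[OF assms(1)] by metis
  obtain k :: "real \<times> real \<Rightarrow> 'a" where k: "continuous_map (top_of_set ({0..1} \<times> {0..1})) X k"
    "\<And>t. k (0, t) = \<beta> t" "\<And>t. k (1, t) = \<beta>' t"
    "\<And>s. s \<in> {0..1} \<Longrightarrow> k (s, 0) = \<beta> 0" "\<And>s. s \<in> {0..1} \<Longrightarrow> k (s, 1) = \<beta> 1"
    using path_homotopicE[OF assms(2)] by metis
  show ?thesis
  proof (rule path_homotopicI)
    show "continuous_map (top_of_set ({0..1} \<times> {0..1})) X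
        (\<lambda>z. if snd z \<le> 1/2 then h (fst z, 2 * snd z) else k (fst z, 2 * snd z - 1))"
    proof (rule continuous_map_glue)
      show "continuous_map (top_of_set {z \<in> {0..1} \<times> {0..1}. snd z \<le> 1/2}) X (\<lambda>z. h (fst z, 2 * snd z))"
        by (rule continuous_map_compose_on[OF h(1)]) (auto intro!: continuous_intros)
      show "continuous_map (top_of_set {z \<in> {0..1} \<times> {0..1}. 1/2 \<le> snd z}) X (\<lambda>z. k (fst z, 2 * snd z - 1))"
        by (rule continuous_map_compose_on[OF k(1)]) (auto intro!: continuous_intros)
    next
      fix z :: "real \<times> real" assume z: "z \<in> {0..1} \<times> {0..1}" "snd z = 1/2"
      show "h (fst z, 2 * snd z) = k (fst z, 2 * snd z - 1)"
        unfolding z using z(1) h(5)[of "fst z"] k(4)[of "fst z"] assms(3) by auto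
    qed (auto intro!: continuous_intros)
  qed (use h k assms(3) in \<open>auto simp: path_concat_def\<close>)
qed

lemma path_homotopic_reparam:
  assumes "pathin X \<alpha>" "continuous_on {0..1} f" "f \<in> {0..1} \<rightarrow> {0..1}" "f 0 = 0" "f 1 = 1"
    and "\<And>t. t \<in> {0..1} \<Longrightarrow> \<beta> t = \<alpha> (f t)"
  shows "path_homotopic X \<beta> \<alpha>"
  by (rule path_homotopic_convex[where h=\<alpha> and S="{0..1}" and f=f and g="\<lambda>t. t"])
     (use assms in \<open>auto simp: pathin_def\<close>)

lemma path_homotopic_lid:
  assumes "pathin X \<alpha>" "\<alpha> 0 = a"
  shows "path_homotopic X (path_concat (\<lambda>_. a) \<alpha>) \<alpha>"
\<comment> \<open>The reparametrisation waits at 0 during the first half, while the constant path is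
  run through.\<close>
proof (rule path_homotopic_reparam[where f="\<lambda>t. max 0 (2 * t - 1)"])
  fix t :: real
  show "path_concat (\<lambda>_. a) \<alpha> t = \<alpha> (max 0 (2 * t - 1))"
  proof (cases "t = 1/2")
    case True
    show ?thesis unfolding True using assms(2) by (simp add: path_concat_def)
  qed (use assms(2) in \<open>auto simp: path_concat_def max_def\<close>)
qed (use assms in \<open>auto intro!: continuous_intros\<close>)

lemma path_homotopic_rid:
  assumes "pathin X \<alpha>" "\<alpha> 1 = a"
  shows "path_homotopic X (path_concat \<alpha> (\<lambda>_. a)) \<alpha>"
proof (rule path_homotopic_reparam[where f="\<lambda>t. min 1 (2 * t)"])
  fix t :: real
  show "path_concat \<alpha> (\<lambda>_. a) t = \<alpha> (min 1 (2 * t))"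
    using assms(2) by (cases "2 * t = 1") (auto simp: path_concat_def min_def)
qed (use assms in \<open>auto intro!: continuous_intros\<close>)

lemma path_homotopic_rinv:
  assumes "pathin X \<alpha>" "\<alpha> 0 = a"
  shows "path_homotopic X (path_concat \<alpha> (path_rev \<alpha>)) (\<lambda>_. a)"
\<comment> \<open>The tent function runs from 0 to 1 and back, which is \<alpha> followed by its
  reverse; it is contracted to the constant 0.\<close>
proof (rule path_homotopic_convex[where h=\<alpha> and S="{0..1}" and f="\<lambda>t. min (2 * t) (2 - 2 * t)" and g="\<lambda>t. 0"])
  fix t :: real
  show "path_concat \<alpha> (path_rev \<alpha>) t = \<alpha> (min (2 * t) (2 - 2 * t))"
    by (auto simp: path_concat_def path_rev_def min_def)
  show "continuous_on {0..1} (\<lambda>t::real. min (2 * t) (2 - 2 * t))"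
    by (intro continuous_intros)
  show "(\<lambda>t. min (2 * t) (2 - 2 * t)) \<in> {0..1::real} \<rightarrow> {0..1}"
    by (auto simp: min_def)
qed (use assms in \<open>auto simp: pathin_def\<close>)

lemma path_homotopic_linv:
  assumes "pathin X \<alpha>" "\<alpha> 1 = a"
  shows "path_homotopic X (path_concat (path_rev \<alpha>) \<alpha>) (\<lambda>_. a)"
  using path_homotopic_rinv[of X "path_rev \<alpha>"] assms by auto

lemma path_homotopic_assoc:
  assumes "pathin X \<alpha>" "pathin X \<beta>" "pathin X \<gamma>" "\<alpha> 1 = \<beta> 0" "\<beta> 1 = \<gamma> 0"
  shows "path_homotopic X (path_concat (path_concat \<alpha> \<beta>) \<gamma>) (path_concat \<alpha> (path_concat \<beta> \<gamma>))"
proof (rule path_homotopic_sym, rule path_homotopic_reparam)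
  \<comment> \<open>This is the piecewise linear map that sends the breakpoints 1/2 and 3/4 of the
    right bracketing to the breakpoints 1/4 and 1/2 of the left one. Its slopes 1/2, 1, 2 increase,
    so it is the maximum of its three pieces.\<close>
  let ?f = "\<lambda>t::real. max (t/2) (max (t - 1/4) (2 * t - 1))"
  show "pathin X (path_concat (path_concat \<alpha> \<beta>) \<gamma>)"
    using assms by (intro pathin_concat) auto
  show "continuous_on {0..1} ?f"
    by (intro continuous_intros) auto
  show "?f \<in> {0..1} \<rightarrow> {0..1}" "?f 0 = 0" "?f 1 = 1"
    by (auto simp: max_def)
  fix t :: real
  show "path_concat \<alpha> (path_concat \<beta> \<gamma>) t = path_concat (path_concat \<alpha> \<beta>) \<gamma> (?f t)"
  proof -
    consider "t \<le> 1/2" | "1/2 < t" "t \<le> 3/4" | "3/4 < t" by linarith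
    then show ?thesis
    proof cases
      case 1
      then have "?f t = t/2" by (auto simp: max_def)
      then show ?thesis using 1 by (simp add: path_concat_def)
    next
      case 2
      then have f: "?f t = t - 1/4" by (auto simp: max_def)
      show ?thesis unfolding f using 2 by (simp add: path_concat_def algebra_simps)
    next
      case 3
      then have f: "?f t = 2 * t - 1" by (auto simp: max_def)
      show ?thesis unfolding f using 3 by (simp add: path_concat_def algebra_simps)
    qed
  qed
qed

section \<open>Path classes and the group law\<close>

lemma path_class_eq_iff: "pathin X \<alpha> \<Longrightarrow> path_class X \<alpha> = path_class X \<beta> \<longleftrightarrow> path_homotopic X \<alpha> \<beta>"
  unfolding path_class_def
  using path_homotopic_sym path_homotopic_trans path_homotopic_refl by blast

lemma path_class_eqI: "path_homotopic X \<alpha> \<beta> \<Longrightarrow> path_class X \<alpha> = path_class X \<beta>"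
  using path_class_eq_iff path_homotopic_imp(1) by blast

lemma in_path_class: "\<beta> \<in> path_class X \<alpha> \<longleftrightarrow> path_homotopic X \<alpha> \<beta>"
  by (simp add: path_class_def)

lemma pi1_carrier: "c \<in> carrier (pi1 X x0) \<longleftrightarrow> (\<exists>\<alpha>. pathin X \<alpha> \<and> \<alpha> 0 = x0 \<and> \<alpha> 1 = x0 \<and> c = path_class X \<alpha>)"
  by (auto simp: pi1_def path_between_def)

text \<open>The product does not mention the base point, so \<open>\<alpha>\<close> and \<open>\<beta>\<close> need not be loops.\<close>

lemma pi1_mult:
  assumes "pathin X \<alpha>" "pathin X \<beta>" "\<alpha> 1 = \<beta> 0"
  shows "path_class X \<alpha> \<otimes>\<^bsub>pi1 X x0\<^esub> path_class X \<beta> = path_class X (path_concat \<alpha> \<beta>)"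
proof -
  have "path_class X (path_concat \<alpha>' \<beta>') = path_class X (path_concat \<alpha> \<beta>)"
    if "path_homotopic X \<alpha> \<alpha>'" "path_homotopic X \<beta> \<beta>'" for \<alpha>' \<beta>'
    using that assms(3) path_homotopic_concat path_class_eqI by metis
  then have "(\<Union>\<alpha>'\<in>path_class X \<alpha>. \<Union>\<beta>'\<in>path_class X \<beta>. path_class X (path_concat \<alpha>' \<beta>')) =
      (\<Union>\<alpha>'\<in>path_class X \<alpha>. \<Union>\<beta>'\<in>path_class X \<beta>. path_class X (path_concat \<alpha> \<beta>))"
    by (intro SUP_cong refl) (simp add: in_path_class)
  moreover have "path_class X \<alpha> \<noteq> {}" "path_class X \<beta> \<noteq> {}"
    using assms path_homotopic_refl unfolding path_class_def by blast+
  ultimately show ?thesis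
    by (simp add: pi1_def)
qed

lemma pi1_one: "\<one>\<^bsub>pi1 X x0\<^esub> = path_class X (\<lambda>_. x0)"
  by (simp add: pi1_def)

lemma group_pi1:
  assumes "x0 \<in> topspace X"
  shows "group (pi1 X x0)"
proof (rule groupI)
  fix a b assume "a \<in> carrier (pi1 X x0)" "b \<in> carrier (pi1 X x0)"
  then show "a \<otimes>\<^bsub>pi1 X x0\<^esub> b \<in> carrier (pi1 X x0)"
    unfolding pi1_carrier by (metis pi1_mult path_concat_ends pathin_concat)
next
  show "\<one>\<^bsub>pi1 X x0\<^esub> \<in> carrier (pi1 X x0)"
    unfolding pi1_carrier pi1_one using assms by (intro exI[of _ "\<lambda>_. x0"]) simp
next
  fix a b c assume "a \<in> carrier (pi1 X x0)" "b \<in> carrier (pi1 X x0)" "c \<in> carrier (pi1 X x0)"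
  then obtain \<alpha> \<beta> \<gamma> where *: "pathin X \<alpha>" "\<alpha> 0 = x0" "\<alpha> 1 = x0" "a = path_class X \<alpha>"
      "pathin X \<beta>" "\<beta> 0 = x0" "\<beta> 1 = x0" "b = path_class X \<beta>"
      "pathin X \<gamma>" "\<gamma> 0 = x0" "\<gamma> 1 = x0" "c = path_class X \<gamma>"
    unfolding pi1_carrier by blast
  then show "a \<otimes>\<^bsub>pi1 X x0\<^esub> b \<otimes>\<^bsub>pi1 X x0\<^esub> c = a \<otimes>\<^bsub>pi1 X x0\<^esub> (b \<otimes>\<^bsub>pi1 X x0\<^esub> c)"
    by (simp add: pi1_mult pathin_concat path_class_eqI path_homotopic_assoc)
next
  fix a assume "a \<in> carrier (pi1 X x0)"
  then obtain \<alpha> where *: "pathin X \<alpha>" "\<alpha> 0 = x0" "\<alpha> 1 = x0" "a = path_class X \<alpha>"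
    unfolding pi1_carrier by blast
  show "\<one>\<^bsub>pi1 X x0\<^esub> \<otimes>\<^bsub>pi1 X x0\<^esub> a = a"
    unfolding pi1_one \<open>a = _\<close> using * assms by (subst pi1_mult) (auto intro!: path_class_eqI path_homotopic_lid)
  have "path_class X (path_rev \<alpha>) \<otimes>\<^bsub>pi1 X x0\<^esub> a = \<one>\<^bsub>pi1 X x0\<^esub>"
    unfolding pi1_one \<open>a = _\<close> using * by (subst pi1_mult) (auto intro!: path_class_eqI path_homotopic_linv)
  moreover have "path_class X (path_rev \<alpha>) \<in> carrier (pi1 X x0)"
    unfolding pi1_carrier using * by (metis pathin_rev path_rev_ends)
  ultimately show "\<exists>b\<in>carrier (pi1 X x0). b \<otimes>\<^bsub>pi1 X x0\<^esub> a = \<one>\<^bsub>pi1 X x0\<^esub>" by blast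
qed

lemma path_homotopic_cancel_left:
  assumes "pathin X \<alpha>" "pathin X \<beta>" "\<alpha> 1 = \<beta> 0"
  shows "path_homotopic X (path_concat (path_rev \<alpha>) (path_concat \<alpha> \<beta>)) \<beta>"
proof -
  have r: "pathin X (path_rev \<alpha>)" using assms by blast
  have "path_homotopic X (path_concat (path_rev \<alpha>) (path_concat \<alpha> \<beta>)) (path_concat (path_concat (path_rev \<alpha>) \<alpha>) \<beta>)"
    by (rule path_homotopic_sym, rule path_homotopic_assoc) (use assms r in simp_all)
  also have "path_homotopic X \<dots> (path_concat (\<lambda>_. \<alpha> 1) \<beta>)"
    by (intro path_homotopic_concat path_homotopic_linv) (use assms in simp_all)
  also have "path_homotopic X \<dots> \<beta>"
    by (rule path_homotopic_lid) (use assms in simp_all)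
  finally show ?thesis .
qed

lemma path_homotopic_cancel_right:
  assumes "pathin X \<alpha>" "pathin X \<beta>" "\<alpha> 1 = \<beta> 1"
  shows "path_homotopic X (path_concat (path_concat \<alpha> (path_rev \<beta>)) \<beta>) \<alpha>"
proof -
  have r: "pathin X (path_rev \<beta>)" using assms by blast
  have "path_homotopic X (path_concat (path_concat \<alpha> (path_rev \<beta>)) \<beta>) (path_concat \<alpha> (path_concat (path_rev \<beta>) \<beta>))"
    by (rule path_homotopic_assoc) (use assms r in simp_all)
  also have "path_homotopic X \<dots> (path_concat \<alpha> (\<lambda>_. \<beta> 1))"
    by (intro path_homotopic_concat path_homotopic_linv) (use assms in simp_all)
  also have "path_homotopic X \<dots> \<alpha>"
    by (rule path_homotopic_rid) (use assms in simp_all)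
  finally show ?thesis .
qed

section \<open>Lifting of paths\<close>

lemma unique_path_liftingD:
  assumes "unique_path_lifting E p" "pathin E w" "pathin E w'" "w 0 = w' 0"
    and "\<And>t. t \<in> {0..1} \<Longrightarrow> p (w t) = p (w' t)" and "t \<in> {0..1}"
  shows "w t = w' t"
proof -
  have "pathin E w \<and> pathin E w' \<and> w 0 = w' 0 \<and> (\<forall>t\<in>{0..1}. p (w t) = p (w' t))"
    using assms by blast
  then show ?thesis
    using assms(1,6) unfolding unique_path_lifting_def by (elim allE impE) auto
qed

lemma has_homotopy_liftingE:
  assumes "has_homotopy_lifting Y E X p" "continuous_map Y E f"
    and "continuous_map (prod_topology (top_of_set {0..1::real}) Y) X H"
    and "\<And>y. y \<in> topspace Y \<Longrightarrow> H (0, y) = p (f y)"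
  obtains K where "continuous_map (prod_topology (top_of_set {0..1::real}) Y) E K"
    "\<And>y. y \<in> topspace Y \<Longrightarrow> K (0, y) = f y"
    "\<And>t y. t \<in> {0..1} \<Longrightarrow> y \<in> topspace Y \<Longrightarrow> p (K (t, y)) = H (t, y)"
proof -
  have "\<exists>K. continuous_map (prod_topology (top_of_set {0..1::real}) Y) E K \<and>
      (\<forall>y\<in>topspace Y. K (0, y) = f y) \<and>
      (\<forall>t\<in>{0..1}. \<forall>y\<in>topspace Y. p (K (t, y)) = H (t, y))"
    by (rule assms(1)[unfolded has_homotopy_lifting_def, THEN spec, THEN spec, THEN mp]) (use assms in auto)
  then show ?thesis using that by (elim exE conjE) auto
qed

text \<open>Common interface for lifting projections, coverings and the inverse limit. Homotopy
  invariance of the end of a lift is an assumption since it is obtained differently in the three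
  cases: from homotopy lifting, from the sheets, and coordinatewise.\<close>

locale path_lifting =
  fixes E :: "'b topology" and X :: "'a topology" and p :: "'b \<Rightarrow> 'a"
  assumes continuous_proj: "continuous_map E X p"
    and lift_exists: "\<And>e \<alpha>. e \<in> topspace E \<Longrightarrow> pathin X \<alpha> \<Longrightarrow> \<alpha> 0 = p e \<Longrightarrow>
        \<exists>w. pathin E w \<and> w 0 = e \<and> (\<forall>t\<in>{0..1}. p (w t) = \<alpha> t)"
    and lift_unique: "unique_path_lifting E p"
    and lift_homotopic: "\<And>\<alpha> \<beta> w w'. path_homotopic X \<alpha> \<beta> \<Longrightarrow> pathin E w \<Longrightarrow> pathin E w' \<Longrightarrow>
        w 0 = w' 0 \<Longrightarrow> (\<And>t. t \<in> {0..1} \<Longrightarrow> p (w t) = \<alpha> t) \<Longrightarrow>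
        (\<And>t. t \<in> {0..1} \<Longrightarrow> p (w' t) = \<beta> t) \<Longrightarrow> w 1 = w' 1"
begin

lemma lift_end_eq:
  assumes "pathin E w" "w 0 = e" "\<And>t. t \<in> {0..1} \<Longrightarrow> p (w t) = \<alpha> t"
  shows "lift_end E p e \<alpha> = w 1"
  unfolding lift_end_def
proof (rule the_equality)
  show "\<exists>w'. path_between E e (w 1) w' \<and> (\<forall>t\<in>{0..1}. p (w' t) = \<alpha> t)"
    using assms by (auto simp: path_between_def)
next
  fix y assume "\<exists>w'. path_between E e y w' \<and> (\<forall>t\<in>{0..1}. p (w' t) = \<alpha> t)"
  then obtain w' where w: "pathin E w'" "w' 0 = e" "w' 1 = y" "\<forall>t\<in>{0..1}. p (w' t) = \<alpha> t"
    by (auto simp: path_between_def)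
  have "w' 1 = w 1"
    by (rule unique_path_liftingD[OF lift_unique w(1) assms(1)]) (use w assms in auto)
  then show "y = w 1" using w(3) by auto
qed

lemma lift_endE:
  assumes "e \<in> topspace E" "pathin X \<alpha>" "\<alpha> 0 = p e"
  obtains w where "pathin E w" "w 0 = e" "w 1 = lift_end E p e \<alpha>"
    "\<And>t. t \<in> {0..1} \<Longrightarrow> p (w t) = \<alpha> t"
  using lift_exists[OF assms] lift_end_eq by metis

lemma lift_end_in:
  assumes "e \<in> topspace E" "pathin X \<alpha>" "\<alpha> 0 = p e"
  shows "lift_end E p e \<alpha> \<in> topspace E" "p (lift_end E p e \<alpha>) = \<alpha> 1"
  using lift_endE[OF assms] path_finish_in_topspace by (metis, metis atLeastAtMost_iff order_refl zero_le_one)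

lemma lift_end_homotopic:
  assumes "e \<in> topspace E" "path_homotopic X \<alpha> \<beta>" "\<alpha> 0 = p e"
  shows "lift_end E p e \<alpha> = lift_end E p e \<beta>"
proof -
  note h = path_homotopic_imp[OF assms(2)]
  obtain w where 1: "pathin E w" "w 0 = e" "w 1 = lift_end E p e \<alpha>" "\<And>t. t \<in> {0..1} \<Longrightarrow> p (w t) = \<alpha> t"
    using lift_endE[of e \<alpha>] assms h by metis
  obtain w' where 2: "pathin E w'" "w' 0 = e" "w' 1 = lift_end E p e \<beta>" "\<And>t. t \<in> {0..1} \<Longrightarrow> p (w' t) = \<beta> t"
    using lift_endE[of e \<beta>] assms h by metis
  show ?thesis
    using lift_homotopic[OF assms(2) 1(1) 2(1)] 1 2 by simp
qed

lemma lift_end_concat: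
  assumes "e \<in> topspace E" "pathin X \<alpha>" "\<alpha> 0 = p e" "pathin X \<beta>" "\<beta> 0 = \<alpha> 1"
  shows "lift_end E p e (path_concat \<alpha> \<beta>) = lift_end E p (lift_end E p e \<alpha>) \<beta>"
proof -
  obtain w where 1: "pathin E w" "w 0 = e" "w 1 = lift_end E p e \<alpha>" "\<And>t. t \<in> {0..1} \<Longrightarrow> p (w t) = \<alpha> t"
    using lift_endE[of e \<alpha>] assms by metis
  obtain w' where 2: "pathin E w'" "w' 0 = lift_end E p e \<alpha>"
      "w' 1 = lift_end E p (lift_end E p e \<alpha>) \<beta>" "\<And>t. t \<in> {0..1} \<Longrightarrow> p (w' t) = \<beta> t"
    using lift_endE[of "lift_end E p e \<alpha>" \<beta>] lift_end_in[of e \<alpha>] assms by metis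
  have "lift_end E p e (path_concat \<alpha> \<beta>) = path_concat w w' 1"
  proof (rule lift_end_eq)
    show "pathin E (path_concat w w')" using 1 2 by auto
    show "p (path_concat w w' t) = path_concat \<alpha> \<beta> t" if "t \<in> {0..1}" for t
      using that 1(4) 2(4) by (auto simp: path_concat_def)
  qed (use 1 in auto)
  then show ?thesis using 2 by simp
qed

lemma lift_end_const: "e \<in> topspace E \<Longrightarrow> lift_end E p e (\<lambda>_. p e) = e"
  using lift_end_eq[of "\<lambda>_. e"] by simp

lemma lift_end_rev:
  assumes "e \<in> topspace E" "pathin X \<alpha>" "\<alpha> 0 = p e"
  shows "lift_end E p (lift_end E p e \<alpha>) (path_rev \<alpha>) = e"
proof -
  obtain w where 1: "pathin E w" "w 0 = e" "w 1 = lift_end E p e \<alpha>" "\<And>t. t \<in> {0..1} \<Longrightarrow> p (w t) = \<alpha> t"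
    using lift_endE[of e \<alpha>] assms by metis
  have "lift_end E p (w 1) (path_rev \<alpha>) = path_rev w 1"
    by (rule lift_end_eq) (use 1 in \<open>auto simp: path_rev_def intro!: pathin_rev[unfolded path_rev_def]\<close>)
  then show ?thesis using 1 by simp
qed

lemma lift_end_class_path:
  assumes "e \<in> topspace E" "pathin X \<alpha>" "\<alpha> 0 = p e"
  shows "lift_end_class E p e (path_class X \<alpha>) = lift_end E p e \<alpha>"
  unfolding lift_end_class_def
proof (rule the_equality)
  show "\<exists>\<beta>\<in>path_class X \<alpha>. lift_end E p e \<alpha> = lift_end E p e \<beta>"
    using assms by (auto simp: in_path_class intro!: bexI[of _ \<alpha>])
  show "y = lift_end E p e \<alpha>" if "\<exists>\<beta>\<in>path_class X \<alpha>. y = lift_end E p e \<beta>" for y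
    using that lift_end_homotopic assms by (metis in_path_class)
qed

lemma lift_end_in_leaf:
  assumes "e \<in> topspace E" "pathin X \<alpha>" "\<alpha> 0 = p e"
  shows "path_component_of E e (lift_end E p e \<alpha>)"
  using lift_endE[OF assms] unfolding path_component_of_def by metis

text \<open>By uniqueness a path in \<open>E\<close> is the lift of its own projection, so every
  point of a leaf is the end of a lift.\<close>

lemma leafE:
  assumes "path_component_of E e y"
  obtains \<alpha> where "pathin X \<alpha>" "\<alpha> 0 = p e" "\<alpha> 1 = p y" "y = lift_end E p e \<alpha>"
proof -
  obtain w where w: "pathin E w" "w 0 = e" "w 1 = y"
    using assms unfolding path_component_of_def by blast
  have "pathin X (p \<circ> w)" using w(1) continuous_proj by (rule pathin_compose)
  moreover have "lift_end E p e (p \<circ> w) = w 1"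
    by (rule lift_end_eq) (use w in auto)
  ultimately show ?thesis
    by (intro that[of "p \<circ> w"]) (simp_all add: w)
qed

lemma lift_end_deck:
  assumes "\<phi> \<in> deck_transformations E p" "e \<in> topspace E" "pathin X \<alpha>" "\<alpha> 0 = p e"
  shows "lift_end E p (\<phi> e) \<alpha> = \<phi> (lift_end E p e \<alpha>)"
proof -
  obtain w where 1: "pathin E w" "w 0 = e" "w 1 = lift_end E p e \<alpha>" "\<And>t. t \<in> {0..1} \<Longrightarrow> p (w t) = \<alpha> t"
    using lift_endE[of e \<alpha>] assms by metis
  have "lift_end E p (\<phi> e) \<alpha> = (\<phi> \<circ> w) 1"
  proof (rule lift_end_eq)
    show "pathin E (\<phi> \<circ> w)"
      using 1(1) assms(1) by (auto simp: deck_transformations_def intro: pathin_compose homeomorphic_imp_continuous_map)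
    show "p ((\<phi> \<circ> w) t) = \<alpha> t" if "t \<in> {0..1}" for t
      using 1 that assms(1) pathin_in[OF 1(1) that] by (auto simp: deck_transformations_def)
  qed (use 1 in auto)
  then show ?thesis using 1 by simp
qed

end

lemma lifting_projection_path_lifting:
  assumes "lifting_projection E X p"
  shows "path_lifting E X p"
proof
  have hf: "hurewicz_fibration E X p" and upl: "unique_path_lifting E p"
    using assms by (auto simp: lifting_projection_def)
  show cont: "continuous_map E X p" "unique_path_lifting E p"
    using hf upl by (auto simp: hurewicz_fibration_def)
  have lift: "\<exists>w. pathin E w \<and> w 0 = e \<and> (\<forall>t\<in>{0..1}. p (w t) = \<alpha> t)"
    if e: "e \<in> topspace E" and \<alpha>: "pathin X \<alpha>" "\<alpha> 0 = p e" for e \<alpha>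
  proof -
    \<comment> \<open>With a one-point test space, homotopy lifting is path lifting.\<close>
    let ?Y = "discrete_topology {()}"
    have H: "has_homotopy_lifting ?Y E X p" using hurewicz_fibration_all_spaces[OF hf] .
    have "continuous_map (prod_topology (top_of_set {0..1}) ?Y) X (\<alpha> \<circ> fst)"
      using \<alpha>(1) unfolding pathin_def by (metis continuous_map_compose continuous_map_fst)
    moreover have "continuous_map ?Y E (\<lambda>_. e)" using e by simp
    ultimately obtain K where K: "continuous_map (prod_topology (top_of_set {0..1}) ?Y) E K"
        "\<And>y. y \<in> topspace ?Y \<Longrightarrow> K (0, y) = e"
        "\<And>t y. t \<in> {0..1} \<Longrightarrow> y \<in> topspace ?Y \<Longrightarrow> p (K (t, y)) = (\<alpha> \<circ> fst) (t, y)"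
      using has_homotopy_liftingE[OF H, of "\<lambda>_. e" "\<alpha> \<circ> fst"] \<alpha>(2) by auto
    have "pathin E (K \<circ> (\<lambda>t. (t, ())))"
      unfolding pathin_def
      by (rule continuous_map_compose[OF _ K(1)]) (auto simp: continuous_map_pairwise o_def)
    then show ?thesis using K by (intro exI[of _ "K \<circ> (\<lambda>t. (t, ()))"]) auto
  qed
  then show "\<And>e \<alpha>. e \<in> topspace E \<Longrightarrow> pathin X \<alpha> \<Longrightarrow> \<alpha> 0 = p e \<Longrightarrow>
        \<exists>w. pathin E w \<and> w 0 = e \<and> (\<forall>t\<in>{0..1}. p (w t) = \<alpha> t)" .
  fix \<alpha> \<beta> w w'
  assume ab: "path_homotopic X \<alpha> \<beta>" and w: "pathin E w" "pathin E w'" "w 0 = w' 0"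
    "\<And>t. t \<in> {0..1} \<Longrightarrow> p (w t) = \<alpha> t" "\<And>t. t \<in> {0..1} \<Longrightarrow> p (w' t) = \<beta> t"
  obtain h :: "real \<times> real \<Rightarrow> 'b" where h: "continuous_map (top_of_set ({0..1} \<times> {0..1})) X h"
    "\<And>t. h (0, t) = \<alpha> t" "\<And>t. h (1, t) = \<beta> t"
    "\<And>s. s \<in> {0..1} \<Longrightarrow> h (s, 0) = \<alpha> 0" "\<And>s. s \<in> {0..1} \<Longrightarrow> h (s, 1) = \<alpha> 1"
    using path_homotopicE[OF ab] by metis
  have hI: "has_homotopy_lifting (top_of_set {0..1::real}) E X p"
    using hurewicz_fibration_all_spaces[OF hf] .
  \<comment> \<open>Here the test space is the unit interval. The homotopy is lifted starting from
    \<open>w\<close>, so \<open>K (1, t)\<close> will be a lift of \<beta>.\<close>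
  obtain K where K: "continuous_map (top_of_set ({0..1} \<times> {0..1})) E K"
      "\<And>t. t \<in> {0..1} \<Longrightarrow> K (0, t) = w t"
      "\<And>s t. s \<in> {0..1} \<Longrightarrow> t \<in> {0..1} \<Longrightarrow> p (K (s, t)) = h (s, t)"
    by (rule has_homotopy_liftingE[OF hI, of w h])
       (use h w in \<open>simp_all add: pathin_def prod_top_of_set\<close>)
  have path: "pathin E (\<lambda>s. K (s, c))" "pathin E (\<lambda>s. K (c, s))" if "c \<in> {0..1}" for c
    unfolding pathin_def
    by (rule continuous_map_compose_on[OF K(1)]; use that in \<open>auto intro!: continuous_intros\<close>)+
  \<comment> \<open>The homotopy is constant on the edges \<open>c = 0\<close> and
    \<open>c = 1\<close>; by unique lifting so is \<open>K\<close>. Hence \<open>K (1, t)\<close>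
    starts where \<open>w'\<close> does and ends where \<open>w\<close> does.\<close>
  have const: "K (s, c) = w c" if "c \<in> {0, 1}" "s \<in> {0..1}" for c s
  proof -
    have c: "c \<in> {0..1}" using that(1) by auto
    have *: "p (K (s, c)) = p (w c)" if "s \<in> {0..1}" for s
      using K(3) h(4,5) w(4) \<open>c \<in> {0, 1}\<close> that by auto
    have "pathin E (\<lambda>_. w c)" using pathin_in[OF w(1) c] by simp
    from unique_path_liftingD[OF upl path(1)[OF c] this _ * that(2)] show ?thesis
      using K(2) c by simp
  qed
  have "K (1, 1) = w' 1"
    by (rule unique_path_liftingD[OF upl path(2)[of 1] w(2)]) (use const[of 0 1] K(3) h(3) w in auto)
  then show "w 1 = w' 1" using const[of 1 1] by simp
qed

section \<open>Local triviality of lifting projections\<close>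

text \<open>Homotopy lifting over the arbitrary test space \<open>Y\<close> yields a lift
  \<open>K\<close> of \<open>H\<close>; by uniqueness \<open>K\<close> restricted to each
  \<open>y\<close> is the lift of that path, so the ends form the continuous map
  \<open>K (1, y)\<close>.\<close>

lemma continuous_map_lift_end:
  assumes lp: "lifting_projection E X p" and f: "continuous_map Y E f"
    and H: "continuous_map (prod_topology (top_of_set {0..1::real}) Y) X H"
    and H0: "\<And>y. y \<in> topspace Y \<Longrightarrow> H (0, y) = p (f y)"
  shows "continuous_map Y E (\<lambda>y. lift_end E p (f y) (\<lambda>t. H (t, y)))"
proof -
  interpret path_lifting E X p by (rule lifting_projection_path_lifting[OF lp])
  have hl: "has_homotopy_lifting Y E X p"
    using lp hurewicz_fibration_all_spaces by (auto simp: lifting_projection_def)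
  obtain K where K: "continuous_map (prod_topology (top_of_set {0..1::real}) Y) E K"
    "\<And>y. y \<in> topspace Y \<Longrightarrow> K (0, y) = f y"
    "\<And>t y. t \<in> {0..1} \<Longrightarrow> y \<in> topspace Y \<Longrightarrow> p (K (t, y)) = H (t, y)"
    using has_homotopy_liftingE[OF hl f H H0] by metis
  have "continuous_map Y E (K \<circ> (\<lambda>y. (1, y)))"
    by (rule continuous_map_compose[OF _ K(1)]) (auto simp: continuous_map_pairwise o_def)
  then show ?thesis
  proof (rule continuous_map_eq)
    fix y assume y: "y \<in> topspace Y"
    have "pathin E (K \<circ> (\<lambda>t. (t, y)))"
      unfolding pathin_def
      by (rule continuous_map_compose[OF _ K(1)]) (use y in \<open>auto simp: continuous_map_pairwise o_def\<close>)
    from lift_end_eq[OF this, of "f y" "\<lambda>t. H (t, y)"]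
    show "(K \<circ> (\<lambda>y. (1, y))) y = lift_end E p (f y) (\<lambda>t. H (t, y))"
      using K(2,3) y by simp
  qed
qed

lemma topspace_fibre [simp]: "topspace (fibre E p x) = {e \<in> topspace E. p e = x}"
  by (auto simp: fibre_def)

lemma continuous_map_fibre_transport:
  assumes "lifting_projection E X p" "pathin X \<alpha>"
  shows "continuous_map (fibre E p (\<alpha> 0)) (fibre E p (\<alpha> 1)) (\<lambda>e. lift_end E p e \<alpha>)"
proof -
  interpret path_lifting E X p by (rule lifting_projection_path_lifting[OF assms(1)])
  have "continuous_map (fibre E p (\<alpha> 0)) E (\<lambda>e. lift_end E p e (\<lambda>t. (\<alpha> \<circ> fst) (t, e)))"
  proof (rule continuous_map_lift_end[OF assms(1)])
    show "continuous_map (fibre E p (\<alpha> 0)) E (\<lambda>e. e)"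
      by (simp add: fibre_def continuous_map_from_subtopology)
    show "continuous_map (prod_topology (top_of_set {0..1}) (fibre E p (\<alpha> 0))) X (\<alpha> \<circ> fst)"
      using assms(2) unfolding pathin_def by (metis continuous_map_compose continuous_map_fst)
  qed auto
  then show ?thesis
    using lift_end_in assms(2) by (auto simp: fibre_def continuous_map_in_subtopology)
qed

text \<open>The contraction of \<open>U\<close> moves points within \<open>X\<close>, not within
  \<open>U\<close>. For fixed \<open>x\<close> it gives a path from \<open>x\<close> to
  \<open>c\<close>.\<close>

definition contraction_path :: "'a topology \<Rightarrow> 'a set \<Rightarrow> (real \<times> 'a \<Rightarrow> 'a) \<Rightarrow> 'a \<Rightarrow> bool" where
  "contraction_path X U H c \<longleftrightarrow>
     continuous_map (prod_topology (top_of_set {0..1}) (subtopology X U)) X H \<and>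
     (\<forall>x. H (0, x) = x) \<and> (\<forall>x. H (1, x) = c)"

lemma categorical_contraction:
  assumes "categorical X U"
  obtains H c where "contraction_path X U H c"
  using assms unfolding categorical_def homotopic_with_def contraction_path_def by blast

lemma pathin_contraction:
  assumes "contraction_path X U H c" "x \<in> topspace X" "x \<in> U"
  shows "pathin X (\<lambda>t. H (t, x))"
proof -
  have "pathin X (H \<circ> (\<lambda>t. (t, x)))"
    unfolding pathin_def
    by (rule continuous_map_compose[of _ "prod_topology (top_of_set {0..1}) (subtopology X U)"])
       (use assms in \<open>auto simp: contraction_path_def continuous_map_pairwise o_def\<close>)
  then show ?thesis by (simp add: o_def)
qed

text \<open>Go around the square \<open>(s, t) \<mapsto> H (t, \<delta> s)\<close>, which is constant on the edge \<open>t = 1\<close>.\<close>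

lemma path_homotopic_contraction:
  assumes H: "contraction_path X U H c" and \<delta>: "path_within X U \<delta>"
  shows "path_homotopic X \<delta> (path_concat (\<lambda>t. H (t, \<delta> 0)) (path_rev (\<lambda>t. H (t, \<delta> 1))))"
proof -
  let ?A = "\<lambda>t. H (t, \<delta> 0)" and ?B = "path_rev (\<lambda>t. H (t, \<delta> 1))"
  have \<delta>in: "\<delta> t \<in> topspace X" "\<delta> t \<in> U" if "t \<in> {0..1}" for t
    using pathin_in[OF \<delta> that] by auto
  have cX: "c \<in> topspace X"
    using path_finish_in_topspace[OF pathin_contraction[OF H \<delta>in[of 0]]] H by (simp add: contraction_path_def)
  have H01: "H (0, x) = x" "H (1, x) = c" for x using H by (auto simp: contraction_path_def)
  let ?S = "{0..1::real} \<times> {0..1::real}"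
  let ?k = "\<lambda>z. H (snd z, \<delta> (fst z))"
  have "continuous_map (top_of_set ?S) (prod_topology (top_of_set {0..1}) (subtopology X U)) (\<lambda>z. (snd z, \<delta> (fst z)))"
    using \<delta> unfolding continuous_map_pairwise o_def pathin_def
    by (auto intro!: continuous_map_compose_on[of "{0..1}"] continuous_intros simp: continuous_map_in_subtopology)
  then have k: "continuous_map (top_of_set ?S) X ?k"
    using H continuous_map_compose unfolding contraction_path_def by (fastforce simp: o_def)
  let ?g = "path_concat (\<lambda>t. (0, t)) (path_concat (\<lambda>t. (t, 1)) (path_rev (\<lambda>t. (1, t))))"
  have "pathin (top_of_set ?S) ?g"
    by (intro pathin_concat pathin_rev) (auto simp: pathin_canon_iff path_def intro!: continuous_intros)
  then have g: "continuous_on {0..1} ?g" "?g \<in> {0..1} \<rightarrow> ?S"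
    by (auto simp: pathin_canon_iff path_def)
  have "path_homotopic X \<delta> (path_concat ?A (path_concat (\<lambda>_. c) ?B))"
  proof (rule path_homotopic_convex[OF _ k _ _ g])
    show "convex ?S" by (intro convex_Times) auto
    show "continuous_on {0..1} (\<lambda>t::real. (t, 0::real))" by (intro continuous_intros)
    show "path_concat ?A (path_concat (\<lambda>_. c) ?B) t = ?k (?g t)" for t
      by (auto simp: path_concat_def path_rev_def H01)
  qed (auto simp: H01)
  also have "path_homotopic X \<dots> (path_concat ?A ?B)"
    using pathin_contraction[OF H \<delta>in[of 0]] pathin_contraction[OF H \<delta>in[of 1]] cX
    by (intro path_homotopic_concat path_homotopic_lid pathin_rev) (auto simp: H01)
  finally show ?thesis .
qed

text \<open>The path that \<open>path_homotopic_contraction\<close> substitutes for a path in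
  \<open>U\<close> depends only on the ends.\<close>

lemma path_homotopic_categorical:
  assumes "categorical X U" "path_within X U \<delta>" "path_within X U \<delta>'"
    and "\<delta> 0 = \<delta>' 0" "\<delta> 1 = \<delta>' 1"
  shows "path_homotopic X \<delta> \<delta>'"
proof -
  obtain H c where H: "contraction_path X U H c" using categorical_contraction[OF assms(1)] .
  show ?thesis
    using path_homotopic_contraction[OF H assms(2)] path_homotopic_contraction[OF H assms(3)] assms(4,5)
    by (metis path_homotopic_sym path_homotopic_trans)
qed

text \<open>Transport along a path in \<open>U\<close> from \<open>p e\<close> to \<open>x\<close>
  equals transport along the contraction path of \<open>p e\<close> followed by the reverse of that
  of \<open>x\<close>. This composite depends continuously on the pair \<open>(x, e)\<close>, which
  gives a trivialisation of \<open>E\<close> over \<open>U\<close>.\<close>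

lemma local_transport:
  fixes E :: "'b topology" and X :: "'a topology"
  assumes lp: "lifting_projection E X p" and U: "categorical X U"
  obtains m where
    "continuous_map (prod_topology (subtopology X U) (subtopology E {e \<in> topspace E. p e \<in> U})) E m"
    "\<And>e \<delta>. path_within X U \<delta> \<Longrightarrow> e \<in> topspace E \<Longrightarrow> \<delta> 0 = p e \<Longrightarrow> m (\<delta> 1, e) = lift_end E p e \<delta>"
proof -
  interpret path_lifting E X p by (rule lifting_projection_path_lifting[OF lp])
  obtain H c where H: "contraction_path X U H c" using categorical_contraction[OF U] .
  have H01: "H (0, x) = x" "H (1, x) = c" for x using H by (auto simp: contraction_path_def)
  let ?Y = "prod_topology (subtopology X U) (subtopology E {e \<in> topspace E. p e \<in> U})"
  let ?I = "top_of_set {0..1::real}"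
  \<comment> \<open>The first half contracts \<open>p e\<close> to \<open>c\<close>, the second half
    returns from \<open>c\<close> to the prescribed end \<open>x\<close>.\<close>
  let ?G = "\<lambda>z. if fst z \<le> 1/2 then H (2 * fst z, p (snd (snd z))) else H (1 - (2 * fst z - 1), fst (snd z))"
  let ?m = "\<lambda>z. lift_end E p (snd z) (\<lambda>t. ?G (t, z))"
  have Hc: "continuous_map (prod_topology ?I (subtopology X U)) X H"
    using H by (simp add: contraction_path_def)
  have fst01: "continuous_map (subtopology (prod_topology ?I ?Y) S) euclideanreal fst" for S
    by (rule continuous_map_from_subtopology, rule continuous_map_into_fulltopology, rule continuous_map_fst)
  have "continuous_map ?Y E ?m"
  proof (rule continuous_map_lift_end[OF lp])
    have s2: "continuous_map ?Y (subtopology E {e \<in> topspace E. p e \<in> U}) snd"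
      by (rule continuous_map_snd)
    then show "continuous_map ?Y E snd"
      by (simp add: continuous_map_in_subtopology)
    have ps: "continuous_map ?Y (subtopology X U) (\<lambda>y. p (snd y))"
      using continuous_map_compose[OF \<open>continuous_map ?Y E snd\<close> continuous_proj]
      by (auto simp: continuous_map_in_subtopology o_def)
    show "continuous_map (prod_topology ?I ?Y) X ?G"
    proof (rule continuous_map_cases_le)
      show "continuous_map (prod_topology ?I ?Y) euclideanreal fst"
        using fst01[of UNIV] by simp
      let ?T = "subtopology (prod_topology ?I ?Y) {z \<in> topspace (prod_topology ?I ?Y). fst z \<le> 1/2}"
      have 1: "continuous_map ?T (prod_topology ?I (subtopology X U)) (\<lambda>z. (2 * fst z, p (snd (snd z))))"
      proof (subst continuous_map_pairwise, intro conjI; unfold o_def fst_conv snd_conv)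
        show "continuous_map ?T ?I (\<lambda>z. 2 * fst z)"
          using fst01 by (auto simp: continuous_map_in_subtopology intro!: continuous_intros)
        show "continuous_map ?T (subtopology X U) (\<lambda>z. p (snd (snd z)))"
          using continuous_map_compose[OF continuous_map_snd ps]
          by (intro continuous_map_from_subtopology) (simp add: o_def)
      qed
      show "continuous_map ?T X (\<lambda>z. H (2 * fst z, p (snd (snd z))))"
        using continuous_map_compose[OF 1 Hc] by (simp add: o_def)
      let ?T = "subtopology (prod_topology ?I ?Y) {z \<in> topspace (prod_topology ?I ?Y). 1/2 \<le> fst z}"
      have 1: "continuous_map ?T (prod_topology ?I (subtopology X U)) (\<lambda>z. (1 - (2 * fst z - 1), fst (snd z)))"
      proof (subst continuous_map_pairwise, intro conjI; unfold o_def fst_conv snd_conv)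
        show "continuous_map ?T ?I (\<lambda>z. 1 - (2 * fst z - 1))"
          using fst01 by (auto simp: continuous_map_in_subtopology intro!: continuous_intros)
        show "continuous_map ?T (subtopology X U) (\<lambda>z. fst (snd z))"
          using continuous_map_compose[OF continuous_map_snd continuous_map_fst]
          by (intro continuous_map_from_subtopology) (simp add: o_def)
      qed
      show "continuous_map ?T X (\<lambda>z. H (1 - (2 * fst z - 1), fst (snd z)))"
        using continuous_map_compose[OF 1 Hc] by (simp add: o_def)
    next
      fix z :: "real \<times> 'a \<times> 'b" assume z: "fst z = 1/2"
      show "H (2 * fst z, p (snd (snd z))) = H (1 - (2 * fst z - 1), fst (snd z))"
        unfolding z by (simp add: H01)
    qed simp
  qed (auto simp: H01)
  moreover have "?m (\<delta> 1, e) = lift_end E p e \<delta>"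
    if "path_within X U \<delta>" "e \<in> topspace E" "\<delta> 0 = p e" for e \<delta>
  proof -
    have "lift_end E p e \<delta> = lift_end E p e (path_concat (\<lambda>t. H (t, \<delta> 0)) (path_rev (\<lambda>t. H (t, \<delta> 1))))"
      using that by (intro lift_end_homotopic path_homotopic_contraction[OF H]) auto
    also have "path_concat (\<lambda>t. H (t, \<delta> 0)) (path_rev (\<lambda>t. H (t, \<delta> 1))) = (\<lambda>t. ?G (t, \<delta> 1, e))"
      using that(3) by (auto simp: path_concat_def path_rev_def)
    finally show ?thesis by simp
  qed
  ultimately show ?thesis using that by blast
qed

lemma categorical_subset: "categorical X U \<Longrightarrow> V \<subseteq> U \<Longrightarrow> categorical X V"
  unfolding categorical_def
  by (metis homotopic_from_subtopology inf.absorb_iff2 subtopology_subtopology)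

lemma locally_categoricalE:
  assumes "locally_path_connected_space X" "locally_categorical X" "openin X V" "x \<in> V"
  obtains U where "openin X U" "x \<in> U" "U \<subseteq> V" "path_connectedin X U" "categorical X U"
proof -
  have "x \<in> topspace X" using openin_subset[OF assms(3)] assms(4) by blast
  then obtain U0 where U0: "openin X U0" "x \<in> U0" "categorical X U0"
    using assms(2) unfolding locally_categorical_def by blast
  have "openin X (V \<inter> U0) \<and> x \<in> V \<inter> U0" using assms(3,4) U0 by blast
  then have "\<exists>U. openin X U \<and> path_connectedin X U \<and> x \<in> U \<and> U \<subseteq> V \<inter> U0"
    using assms(1)[unfolded locally_path_connected_space, rule_format, of "V \<inter> U0" x] by simp
  then obtain U where "openin X U" "path_connectedin X U" "x \<in> U" "U \<subseteq> V \<inter> U0" by blast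
  then show ?thesis using that[of U] categorical_subset[OF U0(3), of U] by simp
qed

lemma path_connectedinE:
  assumes "path_connectedin X U" "x \<in> U" "y \<in> U"
  obtains \<delta> where "path_within X U \<delta>" "\<delta> 0 = x" "\<delta> 1 = y"
proof -
  have "\<exists>g. pathin X g \<and> g \<in> {0..1} \<rightarrow> U \<and> g 0 = x \<and> g 1 = y"
    using assms unfolding path_connectedin by blast
  then show ?thesis using that by (auto simp: pathin_subtopology Pi_iff)
qed

text \<open>This is continuity of the map \<open>m\<close> of \<open>local_transport\<close> at
  \<open>(p e, e)\<close>, where its value is \<open>e\<close> by the constant path. It controls a
  short path and a varying start simultaneously.\<close>

lemma transport_small:
  assumes lp: "lifting_projection E X p"
    and X: "locally_path_connected_space X" "locally_categorical X"
    and W: "openin E W" "e \<in> W"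
  obtains V A where "openin X V" "p e \<in> V" "openin (fibre E p (p e)) A" "e \<in> A"
    "\<And>a \<delta>. a \<in> A \<Longrightarrow> path_within X V \<delta> \<Longrightarrow> \<delta> 0 = p e \<Longrightarrow> lift_end E p a \<delta> \<in> W"
proof -
  interpret path_lifting E X p by (rule lifting_projection_path_lifting[OF lp])
  have e: "e \<in> topspace E" using W openin_subset by blast
  then have "p e \<in> topspace X" using continuous_proj by (simp add: continuous_map_def Pi_iff)
  then obtain U where U: "openin X U" "p e \<in> U" "categorical X U"
    using X(2) unfolding locally_categorical_def by blast
  let ?Y = "prod_topology (subtopology X U) (subtopology E {e \<in> topspace E. p e \<in> U})"
  obtain m where m: "continuous_map ?Y E m"
    "\<And>e \<delta>. path_within X U \<delta> \<Longrightarrow> e \<in> topspace E \<Longrightarrow> \<delta> 0 = p e \<Longrightarrow> m (\<delta> 1, e) = lift_end E p e \<delta>"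
    using local_transport[OF lp U(3)] by blast
  have "openin ?Y {z \<in> topspace ?Y. m z \<in> W}"
    using m(1) W(1) by (rule openin_continuous_map_preimage)
  moreover have "m (p e, e) = e"
    using m(2)[of "\<lambda>_. p e" e] lift_end_const e \<open>p e \<in> topspace X\<close> U(2) by simp
  then have "(p e, e) \<in> {z \<in> topspace ?Y. m z \<in> W}"
    using e U(2) \<open>p e \<in> topspace X\<close> W(2) by simp
  ultimately obtain V B where VB: "openin (subtopology X U) V" "openin (subtopology E {e \<in> topspace E. p e \<in> U}) B"
      "p e \<in> V" "e \<in> B" "V \<times> B \<subseteq> {z \<in> topspace ?Y. m z \<in> W}"
    unfolding openin_prod_topology_alt by meson
  have V: "openin X V" "V \<subseteq> U"
    using VB(1) U(1) openin_open_subtopology by blast+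
  obtain B' where B': "openin E B'" "B = B' \<inter> {e \<in> topspace E. p e \<in> U}"
    using VB(2) unfolding openin_subtopology by blast
  show ?thesis
  proof (rule that[of V "B' \<inter> {a. p a = p e}"])
    show "openin (fibre E p (p e)) (B' \<inter> {a. p a = p e})"
      using B'(1) unfolding fibre_def openin_subtopology by blast
    fix a \<delta> assume a: "a \<in> B' \<inter> {a. p a = p e}" and \<delta>: "path_within X V \<delta>" "\<delta> 0 = p e"
    have "a \<in> B" "a \<in> topspace E" using a B' U(2) openin_subset by auto
    moreover have "\<delta> 1 \<in> V" using path_finish_in_topspace[OF \<delta>(1)] by simp
    ultimately have "m (\<delta> 1, a) \<in> W" using VB(5) by blast
    moreover have "path_within X U \<delta>" using \<delta>(1) V(2) by (auto simp: pathin_subtopology)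
    ultimately show "lift_end E p a \<delta> \<in> W"
      using m(2)[of \<delta> a] \<open>a \<in> topspace E\<close> a \<delta>(2) by simp
  qed (use V VB B' in auto)
qed

text \<open>Transport back to the fibre over \<open>x\<close> is a continuous map on the part of
  \<open>E\<close> over \<open>U\<close>, and the set in question is the preimage of
  \<open>A\<close> under it. Path-connectedness of \<open>U\<close> ensures that every point over
  \<open>U\<close> can be transported back.\<close>

lemma openin_transport:
  assumes lp: "lifting_projection E X p"
    and U: "openin X U" "categorical X U" "path_connectedin X U" "x \<in> U"
    and A: "openin (fibre E p x) A"
  shows "openin E {lift_end E p a \<delta> |a \<delta>. a \<in> A \<and> path_within X U \<delta> \<and> \<delta> 0 = x}"
    (is "openin E ?S")
proof -
  interpret path_lifting E X p by (rule lifting_projection_path_lifting[OF lp])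
  have x: "x \<in> topspace X" using U openin_subset by blast
  let ?Z = "subtopology E {e \<in> topspace E. p e \<in> U}"
  let ?Y = "prod_topology (subtopology X U) ?Z"
  obtain m where m: "continuous_map ?Y E m"
    "\<And>e \<delta>. path_within X U \<delta> \<Longrightarrow> e \<in> topspace E \<Longrightarrow> \<delta> 0 = p e \<Longrightarrow> m (\<delta> 1, e) = lift_end E p e \<delta>"
    using local_transport[OF lp U(2)] by blast
  have Asub: "a \<in> topspace E" "p a = x" if "a \<in> A" for a
    using openin_subset[OF A] that by auto
  have cm: "continuous_map ?Z (fibre E p x) (\<lambda>e. m (x, e))"
  proof -
    have "continuous_map ?Z E (m \<circ> (\<lambda>e. (x, e)))"
      by (rule continuous_map_compose[OF _ m(1)]) (use U(4) x in \<open>auto simp: continuous_map_pairwise o_def\<close>)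
    moreover have "p (m (x, e)) = x" if "e \<in> topspace ?Z" for e
    proof -
      have "p e \<in> U" using that by simp
      then obtain \<delta> where \<delta>: "path_within X U \<delta>" "\<delta> 0 = p e" "\<delta> 1 = x"
        using path_connectedinE[OF U(3) _ U(4)] by blast
      show ?thesis
        using m(2)[OF \<delta>(1), of e] lift_end_in(2)[of e \<delta>] \<delta> that by (simp add: pathin_subtopology)
    qed
    ultimately show ?thesis
      unfolding fibre_def by (auto simp: continuous_map_in_subtopology o_def)
  qed
  have "?S = {e \<in> topspace ?Z. m (x, e) \<in> A}"
  proof (rule equalityI; rule subsetI)
    fix e assume "e \<in> ?S"
    then obtain a \<delta> where a: "a \<in> A" "path_within X U \<delta>" "\<delta> 0 = x" "e = lift_end E p a \<delta>" by blast
    then have \<delta>: "pathin X \<delta>" "\<delta> 1 \<in> U" by (simp_all add: pathin_subtopology)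
    have e: "e \<in> topspace E" "p e = \<delta> 1"
      using lift_end_in[of a \<delta>] Asub[OF a(1)] a \<delta> by auto
    have "m (x, e) = lift_end E p e (path_rev \<delta>)"
      using m(2)[of "path_rev \<delta>" e] a e pathin_rev by auto
    also have "\<dots> = a" unfolding a(4) using lift_end_rev[of a \<delta>] Asub[OF a(1)] a(3) \<delta> by simp
    finally show "e \<in> {e \<in> topspace ?Z. m (x, e) \<in> A}" using e \<delta> a(1) by simp
  next
    fix e assume "e \<in> {e \<in> topspace ?Z. m (x, e) \<in> A}"
    then have e: "e \<in> topspace E" "p e \<in> U" "m (x, e) \<in> A" by auto
    obtain \<delta> where \<delta>: "path_within X U \<delta>" "\<delta> 0 = p e" "\<delta> 1 = x"
      using path_connectedinE[OF U(3) e(2) U(4)] .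
    then have "m (x, e) = lift_end E p e \<delta>" using m(2)[of \<delta> e] e by simp
    moreover have "lift_end E p (lift_end E p e \<delta>) (path_rev \<delta>) = e"
      using lift_end_rev[of e \<delta>] e \<delta> by (simp add: pathin_subtopology)
    ultimately have "e = lift_end E p (m (x, e)) (path_rev \<delta>)" by simp
    then show "e \<in> ?S"
      using e(3) \<delta> pathin_rev[OF \<delta>(1)]
      by (intro CollectI exI[of _ "m (x, e)"] exI[of _ "path_rev \<delta>"] conjI) simp_all
  qed
  then have "openin ?Z ?S"
    using openin_continuous_map_preimage[OF cm A] by (simp only:)
  moreover have "openin E {e \<in> topspace E. p e \<in> U}"
    using openin_continuous_map_preimage[OF continuous_proj U(1)] .
  ultimately show ?thesis
    by (simp only: openin_open_subtopology)
qed

section \<open>Path lifting in coverings\<close>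

definition sheets :: "'b topology \<Rightarrow> 'a topology \<Rightarrow> ('b \<Rightarrow> 'a) \<Rightarrow> 'a set \<Rightarrow> 'b set set \<Rightarrow> bool" where
  "sheets C X q U \<V> \<longleftrightarrow> \<Union>\<V> = {c \<in> topspace C. q c \<in> U} \<and> (\<forall>V\<in>\<V>. openin C V) \<and> pairwise disjnt \<V> \<and>
     (\<forall>V\<in>\<V>. homeomorphic_map (subtopology C V) (subtopology X U) q)"

lemma sheetsD:
  assumes "sheets C X q U \<V>"
  shows "\<Union>\<V> = {c \<in> topspace C. q c \<in> U}" "pairwise disjnt \<V>"
    "\<And>S. S \<in> \<V> \<Longrightarrow> openin C S" "\<And>S. S \<in> \<V> \<Longrightarrow> homeomorphic_map (subtopology C S) (subtopology X U) q"
  using assms by (simp_all add: sheets_def)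

lemma covering_sheets:
  assumes "covering_map C X q" "x \<in> topspace X"
  obtains U \<V> where "openin X U" "x \<in> U" "sheets C X q U \<V>"
proof -
  have "\<exists>U. openin X U \<and> x \<in> U \<and> (\<exists>\<V>. sheets C X q U \<V>)"
    using assms unfolding covering_map_def sheets_def by (elim conjE) (rule bspec)
  then show ?thesis using that by blast
qed

lemma sheet_section:
  assumes "homeomorphic_map (subtopology C S) (subtopology X U) q" "openin C S" "openin X U"
  obtains s where "continuous_map (subtopology X U) C s" "\<And>x. x \<in> U \<Longrightarrow> s x \<in> S" "\<And>x. x \<in> U \<Longrightarrow> q (s x) = x"
    "\<And>c. c \<in> S \<Longrightarrow> s (q c) = c" "\<And>c. c \<in> S \<Longrightarrow> q c \<in> U"
proof -
  have top: "topspace (subtopology C S) = S" "topspace (subtopology X U) = U"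
    using openin_subset[OF assms(2)] openin_subset[OF assms(3)] by auto
  obtain s where s: "homeomorphic_maps (subtopology C S) (subtopology X U) q s"
    using assms(1) by (auto simp: homeomorphic_map_maps)
  show ?thesis
  proof
    show "continuous_map (subtopology X U) C s"
      using s by (auto simp: homeomorphic_maps_def continuous_map_in_subtopology)
    show "s x \<in> S" if "x \<in> U" for x
      using s that unfolding homeomorphic_maps_def continuous_map_def top by (auto simp: Pi_iff)
    show "q c \<in> U" if "c \<in> S" for c
      using s that unfolding homeomorphic_maps_def continuous_map_def top by (auto simp: Pi_iff)
  qed (use s in \<open>simp_all add: homeomorphic_maps_def top del: topspace_subtopology\<close>)
qed

lemma sheet_inj:
  assumes "homeomorphic_map (subtopology C S) (subtopology X U) q" "openin C S" "openin X U"
    and "c \<in> S" "c' \<in> S" "q c = q c'"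
  shows "c = c'"
proof -
  obtain s where "\<And>c. c \<in> S \<Longrightarrow> s (q c) = c" using sheet_section[OF assms(1-3)] by metis
  then show ?thesis using assms(4-6) by metis
qed

lemma covering_map_in: "covering_map C X q \<Longrightarrow> c \<in> topspace C \<Longrightarrow> q c \<in> topspace X"
  by (auto simp: covering_map_def continuous_map_def Pi_iff)

lemma covering_section:
  assumes cov: "covering_map C X q" and c: "c \<in> topspace C"
  obtains U S \<sigma> where "openin X U" "openin C S" "c \<in> S" "continuous_map (subtopology X U) C \<sigma>"
    "\<And>x. x \<in> U \<Longrightarrow> \<sigma> x \<in> S" "\<And>x. x \<in> U \<Longrightarrow> q (\<sigma> x) = x" "\<And>c. c \<in> S \<Longrightarrow> \<sigma> (q c) = c" "\<And>c. c \<in> S \<Longrightarrow> q c \<in> U"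
proof -
  obtain U \<V> where U0: "openin X U" "q c \<in> U" "sheets C X q U \<V>"
    using covering_sheets[OF cov covering_map_in[OF cov c]] .
  note U = U0(1,2) sheetsD[OF U0(3)]
  have "c \<in> \<Union>\<V>" unfolding U(3) using c U(2) by simp
  then obtain S where S: "S \<in> \<V>" "c \<in> S" by blast
  show ?thesis
    by (rule sheet_section[OF U(6)[OF S(1)] U(5)[OF S(1)] U(1)], rule that[OF U(1) U(5)[OF S(1)] S(2)])
qed

text \<open>The set of agreement is open and closed: near any \<open>t\<close> each lift stays in
  one sheet, and two sheets either coincide, where \<open>q\<close> is injective, or are disjoint.
  General intervals are allowed because \<open>covering_lift_locally_constant\<close> compares lifts
  on subintervals.\<close>

lemma covering_unique_lift:
  assumes cov: "covering_map C X q"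
    and w: "continuous_map (top_of_set {a..b::real}) C w" "continuous_map (top_of_set {a..b}) C w'"
    and q: "\<And>t. t \<in> {a..b} \<Longrightarrow> q (w t) = q (w' t)"
    and t0: "t0 \<in> {a..b}" "w t0 = w' t0"
    and t: "t \<in> {a..b}"
  shows "w t = w' t"
proof -
  let ?I = "top_of_set {a..b}"
  let ?T = "{t \<in> {a..b}. w t = w' t}"
  have nbhd: "openin ?I {u \<in> {a..b}. w u \<in> S \<and> w' u \<in> S'}" if "openin C S" "openin C S'" for S S'
  proof -
    have "{u \<in> {a..b}. w u \<in> S \<and> w' u \<in> S'} =
        {u \<in> topspace ?I. w u \<in> S} \<inter> {u \<in> topspace ?I. w' u \<in> S'}" by auto
    then show ?thesis
      using openin_continuous_map_preimage[OF w(1) that(1)] openin_continuous_map_preimage[OF w(2) that(2)]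
      by (simp only: openin_Int)
  qed
  have *: "\<exists>N. openin ?I N \<and> t \<in> N \<and> (\<forall>u\<in>N. (w u = w' u) = (w t = w' t))" if t: "t \<in> {a..b}" for t
  proof -
    have wt: "w t \<in> topspace C" "w' t \<in> topspace C"
      using t continuous_map_image_subset_topspace[OF w(1)] continuous_map_image_subset_topspace[OF w(2)] by auto
    obtain U \<V> where U0: "openin X U" "q (w t) \<in> U" "sheets C X q U \<V>"
      using covering_sheets[OF cov covering_map_in[OF cov wt(1)]] .
    note U = U0(1,2) sheetsD[OF U0(3)]
    have "w t \<in> \<Union>\<V>" "w' t \<in> \<Union>\<V>" unfolding U(3) using wt U(2) q[OF t] by auto
    then obtain S S' where S: "S \<in> \<V>" "w t \<in> S" "S' \<in> \<V>" "w' t \<in> S'" by blast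
    have inj: "c = c'" if "c \<in> S" "c' \<in> S" "q c = q c'" for c c'
      using sheet_inj[OF U(6)[OF S(1)] U(5)[OF S(1)] U(1) that] .
    let ?N = "{u \<in> {a..b}. w u \<in> S \<and> w' u \<in> S'}"
    have "(w u = w' u) = (w t = w' t)" if u: "u \<in> ?N" for u
    proof (cases "S = S'")
      case True
      then show ?thesis using inj[of "w u" "w' u"] inj[of "w t" "w' t"] u S t q by simp
    next
      case False
      then have "S \<inter> S' = {}" using U(4) S by (auto simp: pairwise_def disjnt_def)
      then show ?thesis using u S by auto
    qed
    moreover have "openin ?I ?N" using nbhd U(5) S by simp
    moreover have "t \<in> ?N" using t S by simp
    ultimately show ?thesis by (intro exI[of _ ?N]) blast
  qed
  have "openin ?I ?T"
  proof (subst openin_subopen, rule ballI)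
    fix t assume t: "t \<in> ?T"
    then obtain N where N: "openin ?I N" "t \<in> N" "\<forall>u\<in>N. (w u = w' u) = (w t = w' t)" using * by blast
    have "N \<subseteq> {a..b}" using openin_subset[OF N(1)] by simp
    moreover have "w u = w' u" if "u \<in> N" for u using N(3) that t by simp
    ultimately have "N \<subseteq> ?T" by blast
    with N show "\<exists>N. openin ?I N \<and> t \<in> N \<and> N \<subseteq> ?T" by blast
  qed
  moreover have "openin ?I ({a..b} - ?T)"
  proof (subst openin_subopen, rule ballI)
    fix t assume t: "t \<in> {a..b} - ?T"
    then obtain N where N: "openin ?I N" "t \<in> N" "\<forall>u\<in>N. (w u = w' u) = (w t = w' t)" using * by blast
    have "N \<subseteq> {a..b}" using openin_subset[OF N(1)] by simp
    moreover have "w u \<noteq> w' u" if "u \<in> N" for u using N(3) that t by simp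
    ultimately have "N \<subseteq> {a..b} - ?T" by blast
    with N show "\<exists>N. openin ?I N \<and> t \<in> N \<and> N \<subseteq> {a..b} - ?T" by blast
  qed
  then have "closedin ?I ?T" unfolding closedin_def by auto
  ultimately have "?T = {} \<or> ?T = {a..b}"
    using connected_Icc[of a b] unfolding connected_clopen by blast
  moreover have "t0 \<in> ?T" using t0 by simp
  ultimately have "?T = {a..b}" by blast
  with t have "t \<in> ?T" by simp
  then show ?thesis by simp
qed

lemma continuous_map_metric_nbhd:
  fixes S :: "'c::metric_space set"
  assumes "continuous_map (top_of_set S) X f" "openin X U" "x \<in> S" "f x \<in> U"
  obtains d where "d > 0" "\<And>y. y \<in> S \<Longrightarrow> dist x y < d \<Longrightarrow> f y \<in> U"
proof -
  have "openin (top_of_set S) {y \<in> S. f y \<in> U}"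
    using openin_continuous_map_preimage[OF assms(1,2)] by simp
  then obtain d where d: "d > 0" "ball x d \<inter> S \<subseteq> {y \<in> S. f y \<in> U}"
    using assms(3,4) unfolding openin_contains_ball by blast
  show ?thesis
  proof (rule that[OF d(1)])
    fix y assume "y \<in> S" "dist x y < d"
    then have "y \<in> ball x d \<inter> S" by simp
    then show "f y \<in> U" using d(2) by blast
  qed
qed

lemma covering_lift_exists:
  assumes cov: "covering_map C X q" and \<alpha>: "pathin X \<alpha>" and c: "c \<in> topspace C" "q c = \<alpha> 0"
  obtains w where "pathin C w" "w 0 = c" "\<And>t. t \<in> {0..1} \<Longrightarrow> q (w t) = \<alpha> t"
proof -
  let ?P = "\<lambda>a b. 0 \<le> a \<longrightarrow> a \<le> b \<longrightarrow> b \<le> 1 \<longrightarrow> (\<forall>c\<in>topspace C. q c = \<alpha> a \<longrightarrow>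
      (\<exists>w. continuous_map (top_of_set {a..b}) C w \<and> w a = c \<and> (\<forall>t\<in>{a..b}. q (w t) = \<alpha> t)))"
  have "?P 0 (1::real)"
  proof (rule Bolzano[where P = ?P and a = 0 and b = 1])
    fix a b d :: real
    assume trans: "?P a b" "?P b d" "a \<le> b" "b \<le> d"
    show "?P a d"
    proof (intro impI ballI)
      fix c assume ad: "0 \<le> a" "a \<le> d" "d \<le> 1" and c: "c \<in> topspace C" "q c = \<alpha> a"
      have b01: "0 \<le> b" "b \<le> 1" using ad trans(3,4) by simp_all
      obtain w where w: "continuous_map (top_of_set {a..b}) C w" "w a = c" "\<forall>t\<in>{a..b}. q (w t) = \<alpha> t"
        using trans(1)[rule_format, OF ad(1) trans(3) b01(2) c] by blast
      have "w b \<in> topspace C"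
        using continuous_map_image_subset_topspace[OF w(1)] trans(3) by auto
      moreover have "q (w b) = \<alpha> b" using w(3) trans(3) by simp
      ultimately obtain w' where w': "continuous_map (top_of_set {b..d}) C w'" "w' b = w b" "\<forall>t\<in>{b..d}. q (w' t) = \<alpha> t"
        using trans(2)[rule_format, OF b01(1) trans(4) ad(3), of "w b"] by blast
      have sets: "{x \<in> {a..d}. x \<le> b} = {a..b}" "{x \<in> {a..d}. b \<le> x} = {b..d}" using trans(3,4) by auto
      have "continuous_map (top_of_set {a..d}) C (\<lambda>t. if t \<le> b then w t else w' t)"
        by (rule continuous_map_glue) (use w w' sets in auto)
      then show "\<exists>w. continuous_map (top_of_set {a..d}) C w \<and> w a = c \<and> (\<forall>t\<in>{a..d}. q (w t) = \<alpha> t)"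
        using w w' trans(3) by (intro exI[of _ "\<lambda>t. if t \<le> b then w t else w' t"]) auto
    qed
  next
    fix x :: real
    assume "0 \<le> x" "x \<le> 1"
    then have x: "x \<in> {0..1}" by simp
    obtain U \<V> where U0: "openin X U" "\<alpha> x \<in> U" "sheets C X q U \<V>"
      using covering_sheets[OF cov pathin_in[OF \<alpha> x]] .
    note U = U0(1,2) sheetsD[OF U0(3)]
    obtain d where d: "d > 0" "\<And>t. t \<in> {0..1} \<Longrightarrow> dist x t < d \<Longrightarrow> \<alpha> t \<in> U"
      using continuous_map_metric_nbhd[OF \<alpha>[unfolded pathin_def] U(1) x U(2)] by metis
    have "?P a b" if ab: "a \<le> x" "x \<le> b" "b - a < d" for a b
    proof (intro impI ballI)
      fix c assume 01: "0 \<le> a" "a \<le> b" "b \<le> 1" and c: "c \<in> topspace C" "q c = \<alpha> a"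
      have inU: "\<alpha> t \<in> U" if "t \<in> {a..b}" for t
        using that ab 01 by (intro d(2)) (auto simp: dist_real_def)
      have "c \<in> \<Union>\<V>" unfolding U(3) using c inU[of a] 01 by simp
      then obtain S where S: "S \<in> \<V>" "c \<in> S" by blast
      obtain s where s: "continuous_map (subtopology X U) C s" "\<And>x. x \<in> U \<Longrightarrow> s x \<in> S" "\<And>x. x \<in> U \<Longrightarrow> q (s x) = x"
        "\<And>c. c \<in> S \<Longrightarrow> s (q c) = c" "\<And>c. c \<in> S \<Longrightarrow> q c \<in> U"
        using sheet_section[OF U(6)[OF S(1)] U(5)[OF S(1)] U(1)] by metis
      have "continuous_map (top_of_set {a..b}) X \<alpha>"
        using continuous_map_compose_on[OF \<alpha>[unfolded pathin_def], of "{a..b}" "\<lambda>t. t"] 01 by auto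
      then have "continuous_map (top_of_set {a..b}) (subtopology X U) \<alpha>"
        using inU by (auto simp: continuous_map_in_subtopology)
      from continuous_map_compose[OF this s(1)]
      show "\<exists>w. continuous_map (top_of_set {a..b}) C w \<and> w a = c \<and> (\<forall>t\<in>{a..b}. q (w t) = \<alpha> t)"
        using s(3) s(4)[OF S(2)] c(2) inU by (intro exI[of _ "s \<circ> \<alpha>"]) simp
    qed
    then show "\<exists>d>0. \<forall>a b. a \<le> x \<and> x \<le> b \<and> b - a < d \<longrightarrow> ?P a b" using d(1) by blast
  qed simp
  then show ?thesis using c that by (auto simp: pathin_def)
qed

text \<open>The induction over subintervals (\<open>Bolzano\<close>) propagates a neighbourhood \<open>W'\<close> of the left end of the
  lift which forces all neighbouring lifts into a given neighbourhood \<open>W\<close> of its right end.\<close>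

lemma covering_lift_locally_constant:
  assumes cov: "covering_map C X q"
    and h: "continuous_map (top_of_set ({0..1::real} \<times> {0..1::real})) X h"
    and s0: "s0 \<in> {0..1}" and w0: "pathin C w0" "\<And>t. t \<in> {0..1} \<Longrightarrow> q (w0 t) = h (s0, t)"
    and W: "openin C W" "w0 1 \<in> W"
  obtains \<epsilon> where "\<epsilon> > 0"
    "\<And>s \<eta>. s \<in> {0..1} \<Longrightarrow> dist s0 s < \<epsilon> \<Longrightarrow> pathin C \<eta> \<Longrightarrow> \<eta> 0 = w0 0 \<Longrightarrow>
        (\<And>t. t \<in> {0..1} \<Longrightarrow> q (\<eta> t) = h (s, t)) \<Longrightarrow> \<eta> 1 \<in> W"
proof -
  define R where "R = (\<lambda>a b W W' \<epsilon>. \<forall>s\<in>{0..1}. dist s0 s < \<epsilon> \<longrightarrow> (\<forall>\<eta>. continuous_map (top_of_set {a..b}) C \<eta> \<longrightarrow>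
      (\<forall>t\<in>{a..b}. q (\<eta> t) = h (s, t)) \<longrightarrow> \<eta> a \<in> W' \<longrightarrow> \<eta> b \<in> W))"
  have RD: "\<eta> b \<in> W" if "R a b W W' \<epsilon>" "s \<in> {0..1}" "dist s0 s < \<epsilon>" "continuous_map (top_of_set {a..b}) C \<eta>"
      "\<And>t. t \<in> {a..b} \<Longrightarrow> q (\<eta> t) = h (s, t)" "\<eta> a \<in> W'" for a b W W' \<epsilon> s \<eta>
    using that unfolding R_def by blast
  let ?P = "\<lambda>a b. 0 \<le> a \<longrightarrow> a \<le> b \<longrightarrow> b \<le> 1 \<longrightarrow> (\<forall>W. openin C W \<longrightarrow> w0 b \<in> W \<longrightarrow>
      (\<exists>W' \<epsilon>. openin C W' \<and> w0 a \<in> W' \<and> 0 < \<epsilon> \<and> R a b W W' \<epsilon>))"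
  have "?P 0 (1::real)"
  proof (rule Bolzano[where P = ?P and a = 0 and b = 1])
    fix a b d :: real
    assume trans: "?P a b" "?P b d" "a \<le> b" "b \<le> d"
    show "?P a d"
    proof (intro impI allI)
      fix W assume ad: "0 \<le> a" "a \<le> d" "d \<le> 1" and W: "openin C W" "w0 d \<in> W"
      have b01: "0 \<le> b" "b \<le> 1" using ad trans(3,4) by simp_all
      obtain W1 \<epsilon>1 where 1: "openin C W1" "w0 b \<in> W1" "0 < \<epsilon>1" "R b d W W1 \<epsilon>1"
        using trans(2)[rule_format, OF b01(1) trans(4) ad(3) W] by blast
      obtain W2 \<epsilon>2 where 2: "openin C W2" "w0 a \<in> W2" "0 < \<epsilon>2" "R a b W1 W2 \<epsilon>2"
        using trans(1)[rule_format, OF ad(1) trans(3) b01(2) 1(1,2)] by blast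
      have "R a d W W2 (min \<epsilon>1 \<epsilon>2)"
        unfolding R_def
      proof (intro ballI impI allI)
        fix s \<eta> assume s: "s \<in> {0..1}" "dist s0 s < min \<epsilon>1 \<epsilon>2" and \<eta>: "continuous_map (top_of_set {a..d}) C \<eta>"
          "\<forall>t\<in>{a..d}. q (\<eta> t) = h (s, t)" "\<eta> a \<in> W2"
        have sub: "continuous_map (top_of_set {a'..b'}) C \<eta>" if "a \<le> a'" "b' \<le> d" for a' b'
          using continuous_map_compose_on[OF \<eta>(1), of "{a'..b'}" "\<lambda>t. t"] that by auto
        have "\<eta> b \<in> W1"
          by (rule RD[OF 2(4) s(1)]) (use s sub[of a b] \<eta> trans in auto)
        then show "\<eta> d \<in> W"
          by (intro RD[OF 1(4) s(1)]) (use s sub[of b d] \<eta> trans in auto)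
      qed
      moreover have "0 < min \<epsilon>1 \<epsilon>2" using 1(3) 2(3) by simp
      ultimately show "\<exists>W' \<epsilon>. openin C W' \<and> w0 a \<in> W' \<and> 0 < \<epsilon> \<and> R a d W W' \<epsilon>"
        using 2(1,2) by blast
    qed
  next
    fix x :: real
    assume "0 \<le> x" "x \<le> 1"
    then have x: "x \<in> {0..1}" by simp
    obtain U S \<sigma> where U: "openin X U" and S: "openin C S" "w0 x \<in> S" and \<sigma>: "continuous_map (subtopology X U) C \<sigma>"
      "\<And>x. x \<in> U \<Longrightarrow> \<sigma> x \<in> S" "\<And>x. x \<in> U \<Longrightarrow> q (\<sigma> x) = x" "\<And>c. c \<in> S \<Longrightarrow> \<sigma> (q c) = c" "\<And>c. c \<in> S \<Longrightarrow> q c \<in> U"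
      by (rule covering_section[OF cov pathin_in[OF w0(1) x]]) (rule that)
    have hx: "h (s0, x) \<in> U" using \<sigma>(5)[OF S(2)] w0(2)[OF x] by simp
    obtain d1 where d1: "d1 > 0" "\<And>z. z \<in> {0..1} \<times> {0..1} \<Longrightarrow> dist (s0, x) z < d1 \<Longrightarrow> h z \<in> U"
      using continuous_map_metric_nbhd[OF h U SigmaI[OF s0 x] hx] by metis
    obtain d2 where d2: "d2 > 0" "\<And>t. t \<in> {0..1} \<Longrightarrow> dist x t < d2 \<Longrightarrow> w0 t \<in> S"
      using continuous_map_metric_nbhd[OF w0(1)[unfolded pathin_def] S(1) x S(2)] by metis
    \<comment> \<open>Each coordinate receives half of \<open>d1\<close>, as the distance in the
      square is at most the sum of the coordinate distances.\<close>
    have hU: "h (s, t) \<in> U" if "s \<in> {0..1}" "t \<in> {0..1}" "dist s0 s < d1/2" "dist x t < d1/2" for s t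
    proof (rule d1(2))
      have "dist (s0, x) (s, t) \<le> dist s0 s + dist x t"
        unfolding dist_Pair_Pair by (rule sqrt_sum_squares_le_sum) auto
      then show "dist (s0, x) (s, t) < d1" using that by simp
    qed (use that in auto)
    have "?P a b" if ab: "a \<le> x" "x \<le> b" "b - a < min (d1/2) d2" for a b
    proof (intro impI allI)
      fix W assume 01: "0 \<le> a" "a \<le> b" "b \<le> 1" and W: "openin C W" "w0 b \<in> W"
      have near: "t \<in> {0..1}" "dist x t < d1/2" "dist x t < d2" if "t \<in> {a..b}" for t
      proof -
        have "dist x t \<le> b - a" using that ab by (auto simp: dist_real_def)
        moreover have "b - a < d1/2" "b - a < d2" using ab(3) by simp_all
        ultimately show "dist x t < d1/2" "dist x t < d2" by linarith+
      qed (use that 01 in auto)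
      have b: "b \<in> {a..b}" and a: "a \<in> {a..b}" using 01 by auto
      have "openin (subtopology X U) {x \<in> topspace (subtopology X U). \<sigma> x \<in> W}"
        using openin_continuous_map_preimage[OF \<sigma>(1) W(1)] .
      then have G: "openin X {x \<in> topspace (subtopology X U). \<sigma> x \<in> W}" (is "openin X ?G")
        using U by (simp only: openin_open_subtopology)
      have wS: "w0 b \<in> S" "w0 a \<in> S" using d2(2) near[OF b] near[OF a] by auto
      have "h (s0, b) \<in> U" using hU[of s0 b] s0 near[OF b] d1(1) by simp
      moreover have "\<sigma> (h (s0, b)) = w0 b" using \<sigma>(4)[OF wS(1)] w0(2)[OF near(1)[OF b]] by simp
      ultimately have hG: "h (s0, b) \<in> ?G"
        using W(2) openin_subset[OF U] by auto
      have hb: "continuous_map (top_of_set {0..1}) X (\<lambda>s. h (s, b))"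
        by (rule continuous_map_compose_on[OF h]) (use near(1)[OF b] in \<open>auto intro!: continuous_intros\<close>)
      obtain e where e: "e > 0" "\<And>s. s \<in> {0..1} \<Longrightarrow> dist s0 s < e \<Longrightarrow> h (s, b) \<in> ?G"
        using continuous_map_metric_nbhd[OF hb G s0 hG] by metis
      \<comment> \<open>On a short interval the sheet \<open>S\<close> itself serves as
        \<open>W'\<close>: a nearby lift that starts in \<open>S\<close> must be the section
        \<sigma> applied to \<open>h (s, t)\<close>, and at \<open>b\<close> this lies in
        \<open>W\<close> by the choice of \<open>e\<close>.\<close>
      have "R a b W S (min e (d1/2))"
        unfolding R_def
      proof (intro ballI impI allI)
        fix s \<eta> assume s: "s \<in> {0..1}" "dist s0 s < min e (d1/2)" and \<eta>: "continuous_map (top_of_set {a..b}) C \<eta>"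
          "\<forall>t\<in>{a..b}. q (\<eta> t) = h (s, t)" "\<eta> a \<in> S"
        have hs: "h (s, t) \<in> U" if "t \<in> {a..b}" for t
          using hU[of s t] s near[OF that] by simp
        have "continuous_map (top_of_set {a..b}) X (\<lambda>t. h (s, t))"
          by (rule continuous_map_compose_on[OF h]) (use near(1) s(1) in \<open>auto intro!: continuous_intros\<close>)
        then have "continuous_map (top_of_set {a..b}) (subtopology X U) (\<lambda>t. h (s, t))"
          using hs by (auto simp: continuous_map_in_subtopology)
        from continuous_map_compose[OF this \<sigma>(1)]
        have c: "continuous_map (top_of_set {a..b}) C (\<lambda>t. \<sigma> (h (s, t)))" by (simp add: o_def)
        have "\<eta> b = \<sigma> (h (s, b))"
        proof (rule covering_unique_lift[OF cov \<eta>(1) c _ a _ b])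
          show "q (\<eta> t) = q (\<sigma> (h (s, t)))" if "t \<in> {a..b}" for t
            using \<eta>(2) \<sigma>(3)[OF hs[OF that]] that by simp
          show "\<eta> a = \<sigma> (h (s, a))" using \<sigma>(4)[OF \<eta>(3)] \<eta>(2) a by simp
        qed
        then show "\<eta> b \<in> W" using e(2) s by simp
      qed
      moreover have "0 < min e (d1/2)" using e(1) d1(1) by simp
      ultimately show "\<exists>W' \<epsilon>. openin C W' \<and> w0 a \<in> W' \<and> 0 < \<epsilon> \<and> R a b W W' \<epsilon>"
        using S(1) wS(2) by blast
    qed
    moreover have "0 < min (d1/2) d2" using d1(1) d2(1) by simp
    ultimately show "\<exists>d>0. \<forall>a b. a \<le> x \<and> x \<le> b \<and> b - a < d \<longrightarrow> ?P a b" by blast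
  qed simp
  then obtain W' \<epsilon> where R: "openin C W'" "w0 0 \<in> W'" "0 < \<epsilon>" "R 0 1 W W' \<epsilon>"
    using W by auto
  show ?thesis
    by (rule that[OF R(3)], rule RD[OF R(4)]) (use R(2) in \<open>simp_all add: pathin_def\<close>)
qed

text \<open>The end of the lift of the path \<open>h (s, t)\<close> in \<open>t\<close> is locally
  constant in \<open>s\<close>: it stays in one sheet and over the fixed point
  \<open>\<alpha> 1\<close>. Subdividing the interval of \<open>s\<close> makes it constant.\<close>

lemma covering_lift_homotopic:
  assumes cov: "covering_map C X q" and ab: "path_homotopic X \<alpha> \<beta>"
    and w: "pathin C w" "pathin C w'" "w 0 = w' 0"
    "\<And>t. t \<in> {0..1} \<Longrightarrow> q (w t) = \<alpha> t" "\<And>t. t \<in> {0..1} \<Longrightarrow> q (w' t) = \<beta> t"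
  shows "w 1 = w' 1"
proof -
  obtain h :: "real \<times> real \<Rightarrow> 'b" where h: "continuous_map (top_of_set ({0..1} \<times> {0..1})) X h"
    "\<And>t. h (0, t) = \<alpha> t" "\<And>t. h (1, t) = \<beta> t"
    "\<And>s. s \<in> {0..1} \<Longrightarrow> h (s, 0) = \<alpha> 0" "\<And>s. s \<in> {0..1} \<Longrightarrow> h (s, 1) = \<alpha> 1"
    using path_homotopicE[OF ab] by metis
  define lft where "lft = (\<lambda>s y. \<exists>\<eta>. pathin C \<eta> \<and> \<eta> 0 = w 0 \<and> (\<forall>t\<in>{0..1}. q (\<eta> t) = h (s, t)) \<and> y = \<eta> 1)"
  have ex: "\<exists>y. lft s y" if s: "s \<in> {0..1}" for s
  proof -
    have hs: "pathin X (\<lambda>t. h (s, t))"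
      unfolding pathin_def
      by (rule continuous_map_compose_on[OF h(1)]) (use s in \<open>auto intro!: continuous_intros\<close>)
    have h0: "q (w 0) = h (s, 0)" using w(4)[of 0] h(4)[OF s] by simp
    obtain \<eta> where "pathin C \<eta>" "\<eta> 0 = w 0" "\<And>t. t \<in> {0..1} \<Longrightarrow> q (\<eta> t) = h (s, t)"
      using covering_lift_exists[OF cov hs path_start_in_topspace[OF w(1)] h0] by metis
    then show ?thesis unfolding lft_def by blast
  qed
  \<comment> \<open>The nearby ends lie in the sheet \<open>S\<close> and have the same projection,
    so the section \<sigma> identifies them. The case \<open>s = s0\<close> also shows that
    \<open>lft s0\<close> has only one value.\<close>
  have loc: "\<exists>\<epsilon>>0. \<forall>s\<in>{0..1}. dist s0 s < \<epsilon> \<longrightarrow> (\<forall>y y0. lft s y \<longrightarrow> lft s0 y0 \<longrightarrow> y = y0)" if s0: "s0 \<in> {0..1}" for s0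
  proof -
    obtain y0 where "lft s0 y0" using ex[OF s0] by blast
    then obtain \<eta>0 where \<eta>0: "pathin C \<eta>0" "\<eta>0 0 = w 0" "\<And>t. t \<in> {0..1} \<Longrightarrow> q (\<eta>0 t) = h (s0, t)"
      unfolding lft_def by blast
    note cin = path_finish_in_topspace[OF \<eta>0(1)]
    obtain U S \<sigma> where U: "openin X U" and S: "openin C S" "\<eta>0 1 \<in> S" and \<sigma>: "continuous_map (subtopology X U) C \<sigma>"
      "\<And>x. x \<in> U \<Longrightarrow> \<sigma> x \<in> S" "\<And>x. x \<in> U \<Longrightarrow> q (\<sigma> x) = x" "\<And>c. c \<in> S \<Longrightarrow> \<sigma> (q c) = c" "\<And>c. c \<in> S \<Longrightarrow> q c \<in> U"
      by (rule covering_section[OF cov cin]) (rule that)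
    obtain \<epsilon> where \<epsilon>: "\<epsilon> > 0"
      "\<And>s \<eta>. s \<in> {0..1} \<Longrightarrow> dist s0 s < \<epsilon> \<Longrightarrow> pathin C \<eta> \<Longrightarrow> \<eta> 0 = \<eta>0 0 \<Longrightarrow>
        (\<And>t. t \<in> {0..1} \<Longrightarrow> q (\<eta> t) = h (s, t)) \<Longrightarrow> \<eta> 1 \<in> S"
      using covering_lift_locally_constant[OF cov h(1) s0 \<eta>0(1,3) S] by metis
    have y: "y = \<eta>0 1" if s: "s \<in> {0..1}" "dist s0 s < \<epsilon>" "lft s y" for s y
    proof -
      obtain \<eta> where \<eta>: "pathin C \<eta>" "\<eta> 0 = w 0" "\<And>t. t \<in> {0..1} \<Longrightarrow> q (\<eta> t) = h (s, t)" "y = \<eta> 1"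
        using s(3) unfolding lft_def by blast
      have inS: "\<eta> 1 \<in> S" using \<epsilon>(2)[OF s(1,2) \<eta>(1)] \<eta> \<eta>0(2) by simp
      have "q (\<eta> 1) = q (\<eta>0 1)" using \<eta>(3)[of 1] \<eta>0(3)[of 1] h(5) s(1) s0 by simp
      then have "\<sigma> (q (\<eta> 1)) = \<sigma> (q (\<eta>0 1))" by (rule arg_cong)
      then show ?thesis
        unfolding \<eta>(4) \<sigma>(4)[OF inS] \<sigma>(4)[OF S(2)] .
    qed
    have "y = y0" if "s \<in> {0..1}" "dist s0 s < \<epsilon>" "lft s y" "lft s0 y0" for s y y0
      using y[OF that(1-3)] y[OF s0 _ that(4)] \<epsilon>(1) by simp
    then show ?thesis using \<epsilon>(1) by (intro exI[of _ \<epsilon>] conjI ballI impI allI)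
  qed
  let ?P = "\<lambda>a b. 0 \<le> a \<longrightarrow> a \<le> b \<longrightarrow> b \<le> 1 \<longrightarrow> (\<forall>y y'. lft a y \<longrightarrow> lft b y' \<longrightarrow> y = y')"
  have "?P 0 (1::real)"
  proof (rule Bolzano[where P = ?P and a = 0 and b = 1])
    fix a b d :: real
    assume trans: "?P a b" "?P b d" "a \<le> b" "b \<le> d"
    show "?P a d"
    proof (intro impI allI)
      fix y y' assume *: "0 \<le> a" "a \<le> d" "d \<le> 1" "lft a y" "lft d y'"
      obtain z where "lft b z" using ex[of b] * trans(3,4) by auto
      then have "y = z" "z = y'" using * trans by auto
      then show "y = y'" by simp
    qed
  next
    fix x :: real
    assume "0 \<le> x" "x \<le> 1"
    then have x: "x \<in> {0..1}" by simp
    obtain \<epsilon> where \<epsilon>: "\<epsilon> > 0" "\<forall>s\<in>{0..1}. dist x s < \<epsilon> \<longrightarrow> (\<forall>y y0. lft s y \<longrightarrow> lft x y0 \<longrightarrow> y = y0)"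
      using loc[OF x] by (elim exE conjE) (rule that)
    obtain y0 where y0: "lft x y0" using ex[OF x] by blast
    have "?P a b" if ab: "a \<le> x" "x \<le> b" "b - a < \<epsilon>" for a b
    proof (intro impI allI)
      fix y y' assume *: "0 \<le> a" "a \<le> b" "b \<le> 1" "lft a y" "lft b y'"
      have "dist x a < \<epsilon>" "dist x b < \<epsilon>" "a \<in> {0..1}" "b \<in> {0..1}" using ab * by (auto simp: dist_real_def)
      then have "y = y0" "y' = y0"
        using \<epsilon>(2)[rule_format, OF _ _ *(4) y0] \<epsilon>(2)[rule_format, OF _ _ *(5) y0] by simp_all
      then show "y = y'" by simp
    qed
    then show "\<exists>d>0. \<forall>a b. a \<le> x \<and> x \<le> b \<and> b - a < d \<longrightarrow> ?P a b" using \<epsilon>(1) by blast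
  qed simp
  moreover have "lft 0 (w 1)" unfolding lft_def using w(1,4) h(2) by (intro exI[of _ w]) simp
  moreover have "lft 1 (w' 1)" unfolding lft_def using w(2,3,5) h(3) by (intro exI[of _ w']) simp
  ultimately show ?thesis by simp
qed

lemma covering_path_lifting:
  assumes cov: "covering_map C X q"
  shows "path_lifting C X q"
proof
  show "continuous_map C X q" using cov by (simp add: covering_map_def)
  show "\<exists>w. pathin C w \<and> w 0 = e \<and> (\<forall>t\<in>{0..1}. q (w t) = \<alpha> t)"
    if "e \<in> topspace C" "pathin X \<alpha>" "\<alpha> 0 = q e" for e \<alpha>
    using covering_lift_exists[OF cov that(2,1) that(3)[symmetric]] by metis
  show "unique_path_lifting C q"
    unfolding unique_path_lifting_def
  proof (intro allI impI ballI, elim conjE)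
    fix w w' t
    assume *: "pathin C w" "pathin C w'" "w 0 = w' 0" "\<forall>t\<in>{0..1}. q (w t) = q (w' t)" "t \<in> {0..1::real}"
    show "w t = w' t"
      by (rule covering_unique_lift[OF cov, of 0 1 w w' 0]) (use * in \<open>auto simp: pathin_def\<close>)
  qed
qed (rule covering_lift_homotopic[OF cov])

text \<open>The image \<open>V\<close> is a parameter, so that the base of the sheet can be
  prescribed, for instance as a path-connected set. The last clause confines the lifts of paths in
  \<open>V\<close> that start at \<open>c\<close>.\<close>

definition small_sheet :: "'b topology \<Rightarrow> 'a topology \<Rightarrow> ('b \<Rightarrow> 'a) \<Rightarrow> 'b \<Rightarrow> 'b set \<Rightarrow> 'a set \<Rightarrow> bool" where
  "small_sheet C X q c W V \<longleftrightarrow> (\<exists>S. openin C S \<and> c \<in> S \<and> S \<subseteq> W \<and> inj_on q S \<and> q ` S = V \<and>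
        (\<forall>\<delta>. path_within X V \<delta> \<and> \<delta> 0 = q c \<longrightarrow> lift_end C q c \<delta> \<in> S))"

text \<open>A sheet through \<open>c\<close> is cut down to the points over \<open>V\<close>, where
  the section over \<open>V0\<close> stays in \<open>W\<close>. All smaller \<open>V\<close> are
  offered, since later \<open>V\<close> must also lie in another open set and be
  path-connected.\<close>

lemma covering_small_sheets:
  assumes cov: "covering_map C X q" and W: "openin C W" "c \<in> W"
  obtains V0 where "openin X V0" "q c \<in> V0"
    "\<And>V. openin X V \<Longrightarrow> V \<subseteq> V0 \<Longrightarrow> q c \<in> V \<Longrightarrow> small_sheet C X q c W V"
proof -
  interpret path_lifting C X q by (rule covering_path_lifting[OF cov])
  have c: "c \<in> topspace C" using openin_subset[OF W(1)] W(2) by blast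
  obtain U S \<sigma> where U: "openin X U" and S: "openin C S" "c \<in> S" and \<sigma>: "continuous_map (subtopology X U) C \<sigma>"
    "\<And>x. x \<in> U \<Longrightarrow> \<sigma> x \<in> S" "\<And>x. x \<in> U \<Longrightarrow> q (\<sigma> x) = x" "\<And>c. c \<in> S \<Longrightarrow> \<sigma> (q c) = c" "\<And>c. c \<in> S \<Longrightarrow> q c \<in> U"
    by (rule covering_section[OF cov c]) (rule that)
  have "openin (subtopology X U) {x \<in> topspace (subtopology X U). \<sigma> x \<in> W}"
    using openin_continuous_map_preimage[OF \<sigma>(1) W(1)] .
  then have G: "openin X {x \<in> topspace (subtopology X U). \<sigma> x \<in> W}" (is "openin X ?G")
    using U by (simp only: openin_open_subtopology)
  show ?thesis
  proof (rule that[OF G])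
    show "q c \<in> ?G" using \<sigma>(4,5)[OF S(2)] W(2) openin_subset[OF U] by auto
    fix V assume V: "openin X V" "V \<subseteq> ?G" "q c \<in> V"
    let ?S = "S \<inter> {c \<in> topspace C. q c \<in> V}"
    have "openin C ?S"
      using openin_continuous_map_preimage[OF continuous_proj V(1)] S(1) by (simp only: openin_Int)
    moreover have "c \<in> ?S" using S(2) c V(3) by simp
    moreover have "?S \<subseteq> W"
    proof
      fix c' assume "c' \<in> ?S"
      then have "c' \<in> S" "q c' \<in> ?G" using V(2) by auto
      then show "c' \<in> W" using \<sigma>(4)[of c'] by simp
    qed
    moreover have "inj_on q ?S"
      by (rule inj_on_inverseI[of _ \<sigma>]) (use \<sigma>(4) in simp)
    moreover have "q ` ?S = V"
    proof
      show "V \<subseteq> q ` ?S"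
      proof
        fix v assume v: "v \<in> V"
        then have "v \<in> U" using V(2) by auto
        then have "\<sigma> v \<in> ?S" "q (\<sigma> v) = v"
          using \<sigma>(2,3) v openin_subset[OF S(1)] by auto
        then show "v \<in> q ` ?S" by (intro image_eqI[of v q "\<sigma> v"]) simp_all
      qed
    qed auto
    moreover have "lift_end C q c \<delta> \<in> ?S" if \<delta>: "path_within X V \<delta>" "\<delta> 0 = q c" for \<delta>
    proof -
      have in_U: "\<delta> t \<in> U" if "t \<in> {0..1}" for t
        using pathin_in[OF \<delta>(1) that] V(2) by auto
      then have "path_within X U \<delta>" using \<delta>(1) by (auto simp: pathin_subtopology)
      then have p: "pathin C (\<sigma> \<circ> \<delta>)" using \<sigma>(1) by (rule pathin_compose)
      have "lift_end C q c \<delta> = (\<sigma> \<circ> \<delta>) 1"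
        by (rule lift_end_eq[OF p]) (use \<delta>(2) \<sigma>(4)[OF S(2)] \<sigma>(3)[OF in_U] in auto)
      moreover have "\<sigma> (\<delta> 1) \<in> S" "q (\<sigma> (\<delta> 1)) = \<delta> 1" using \<sigma>(2,3)[OF in_U] by auto
      moreover have "\<delta> 1 \<in> V" using path_finish_in_topspace[OF \<delta>(1)] by simp
      ultimately show ?thesis using openin_subset[OF S(1)] by auto
    qed
    ultimately show "small_sheet C X q c W V"
      unfolding small_sheet_def
      by (intro exI[of _ ?S] conjI allI impI) simp_all
  qed
qed

section \<open>The covering belonging to a normal subgroup of finite index\<close>

text \<open>The character \<open>k\<close> is a homomorphism from the fundamental groupoid to the finite group \<open>Q\<close>. The
  associated covering has the points \<open>(x, lbl g)\<close>, and a set of them is open if it is stable under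
  the transport \<open>tr\<close> along short paths; thus \<open>Q\<close> acts by left multiplication.\<close>

locale path_character = group Q for Q :: "('q, 'm) monoid_scheme" (structure) +
  fixes X :: "'a topology" and x0 :: 'a and k :: "(real \<Rightarrow> 'a) \<Rightarrow> 'q"
  assumes fin: "finite (carrier Q)"
    and k_closed: "\<And>\<delta>. pathin X \<delta> \<Longrightarrow> k \<delta> \<in> carrier Q"
    and k_concat: "\<And>\<delta> \<delta>'. pathin X \<delta> \<Longrightarrow> pathin X \<delta>' \<Longrightarrow> \<delta> 1 = \<delta>' 0 \<Longrightarrow> k (path_concat \<delta> \<delta>') = k \<delta> \<otimes> k \<delta>'"
    and k_homotopic: "\<And>\<delta> \<delta>'. path_homotopic X \<delta> \<delta>' \<Longrightarrow> k \<delta> = k \<delta>'"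
    and k_onto: "\<And>g. g \<in> carrier Q \<Longrightarrow> \<exists>\<gamma>. pathin X \<gamma> \<and> \<gamma> 0 = x0 \<and> \<gamma> 1 = x0 \<and> k \<gamma> = g"
    and X: "path_connected_space X" "locally_path_connected_space X" "locally_categorical X" "x0 \<in> topspace X"
begin

text \<open>The elements of the finite group are numbered because the coverings indexing the inverse
  limit live on \<open>'a \<times> nat\<close>; \<open>unl\<close> undoes the numbering.\<close>

definition lbl :: "'q \<Rightarrow> nat" where "lbl = to_nat_on (carrier Q)"
definition unl :: "nat \<Rightarrow> 'q" where "unl = from_nat_into (carrier Q)"

lemma unl_lbl [simp]: "g \<in> carrier Q \<Longrightarrow> unl (lbl g) = g"
  unfolding unl_def lbl_def using fin by (simp add: countable_finite)

lemma lbl_inject: "g \<in> carrier Q \<Longrightarrow> h \<in> carrier Q \<Longrightarrow> lbl g = lbl h \<Longrightarrow> g = h"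
  by (metis unl_lbl)

definition points :: "('a \<times> nat) set" where "points = topspace X \<times> lbl ` carrier Q"

definition tr :: "(real \<Rightarrow> 'a) \<Rightarrow> 'a \<times> nat \<Rightarrow> 'a \<times> nat" where
  "tr \<delta> z = (\<delta> 1, lbl (unl (snd z) \<otimes> k \<delta>))"

lemma tr_lbl: "g \<in> carrier Q \<Longrightarrow> tr \<delta> (x, lbl g) = (\<delta> 1, lbl (g \<otimes> k \<delta>))"
  by (simp add: tr_def)

lemma pointsE:
  assumes "z \<in> points"
  obtains x g where "z = (x, lbl g)" "x \<in> topspace X" "g \<in> carrier Q"
  using assms unfolding points_def by blast

lemma in_points: "(x, lbl g) \<in> points" if "x \<in> topspace X" "g \<in> carrier Q"
  using that by (simp add: points_def)

text \<open>The neighbourhoods are those of the usual construction of coverings from path classes,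
  stated through transport so that a topology results at once: the condition is monotone in the set
  and passes to intersections.\<close>

definition stable_at :: "('a \<times> nat) set \<Rightarrow> 'a \<times> nat \<Rightarrow> bool" where
  "stable_at T z \<longleftrightarrow> (\<exists>V. openin X V \<and> fst z \<in> V \<and>
      (\<forall>\<delta>. path_within X V \<delta> \<longrightarrow> \<delta> 0 = fst z \<longrightarrow> tr \<delta> z \<in> T))"

lemma stable_at_mono: "stable_at S z \<Longrightarrow> S \<subseteq> T \<Longrightarrow> stable_at T z"
  unfolding stable_at_def by blast

lemma stable_at_Int:
  assumes "stable_at S z" "stable_at T z"
  shows "stable_at (S \<inter> T) z"
proof -
  obtain V W where V: "openin X V" "fst z \<in> V" "\<forall>\<delta>. path_within X V \<delta> \<longrightarrow> \<delta> 0 = fst z \<longrightarrow> tr \<delta> z \<in> S"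
    and W: "openin X W" "fst z \<in> W" "\<forall>\<delta>. path_within X W \<delta> \<longrightarrow> \<delta> 0 = fst z \<longrightarrow> tr \<delta> z \<in> T"
    using assms unfolding stable_at_def by blast
  then show ?thesis
    unfolding stable_at_def by (intro exI[of _ "V \<inter> W"]) (auto simp: pathin_subtopology)
qed

definition cover :: "('a \<times> nat) topology" where
  "cover = topology (\<lambda>T. T \<subseteq> points \<and> (\<forall>z\<in>T. stable_at T z))"

lemma openin_cover: "openin cover T \<longleftrightarrow> T \<subseteq> points \<and> (\<forall>z\<in>T. stable_at T z)"
proof -
  have "istopology (\<lambda>T. T \<subseteq> points \<and> (\<forall>z\<in>T. stable_at T z))"
    unfolding istopology_def by (blast intro: stable_at_Int stable_at_mono)
  then show ?thesis
    unfolding cover_def by simp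
qed

lemma openin_coverD:
  assumes "openin cover T" "z \<in> T"
  obtains V where "openin X V" "fst z \<in> V" "\<And>\<delta>. path_within X V \<delta> \<Longrightarrow> \<delta> 0 = fst z \<Longrightarrow> tr \<delta> z \<in> T"
  using assms that unfolding openin_cover stable_at_def by blast

lemma openin_coverI:
  assumes "T \<subseteq> points"
    and "\<And>x g. x \<in> topspace X \<Longrightarrow> g \<in> carrier Q \<Longrightarrow> (x, lbl g) \<in> T \<Longrightarrow>
      \<exists>V. openin X V \<and> x \<in> V \<and> (\<forall>\<delta>. path_within X V \<delta> \<longrightarrow> \<delta> 0 = x \<longrightarrow> (\<delta> 1, lbl (g \<otimes> k \<delta>)) \<in> T)"
  shows "openin cover T"
  unfolding openin_cover
proof (intro conjI ballI)
  fix z assume z: "z \<in> T"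
  then obtain x g where zx: "z = (x, lbl g)" "x \<in> topspace X" "g \<in> carrier Q"
    using assms(1) pointsE by blast
  show "stable_at T z"
    using assms(2)[OF zx(2,3)] z unfolding stable_at_def zx(1) fst_conv tr_lbl[OF zx(3)] .
qed (rule assms(1))

lemma topspace_cover: "topspace cover = points"
proof
  show "topspace cover \<subseteq> points" using openin_cover[of "topspace cover"] by simp
  have "openin cover points"
  proof (rule openin_coverI)
    fix x g assume x: "x \<in> topspace X" "g \<in> carrier Q"
    have "(\<delta> 1, lbl (g \<otimes> k \<delta>)) \<in> points" if "path_within X (topspace X) \<delta>" for \<delta>
      using that x k_closed[of \<delta>] path_finish_in_topspace[of X \<delta>] by (intro in_points) simp_all
    then show "\<exists>V. openin X V \<and> x \<in> V \<and> (\<forall>\<delta>. path_within X V \<delta> \<longrightarrow> \<delta> 0 = x \<longrightarrow> (\<delta> 1, lbl (g \<otimes> k \<delta>)) \<in> points)"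
      using x by (intro exI[of _ "topspace X"]) simp
  qed simp
  then show "points \<subseteq> topspace cover" by (rule openin_subset)
qed

lemma segment_in_unit_interval:
  "t \<in> {0..1} \<Longrightarrow> t' \<in> {0..1} \<Longrightarrow> s \<in> {0..1} \<Longrightarrow> t + s * (t' - t) \<in> {0..1::real}"
  using convexD_alt[of "{0..1::real}" t t' s] by (simp add: algebra_simps)

text \<open>The initial segment up to \<open>t'\<close> is the one up to \<open>t\<close> followed
  by the segment from \<open>t\<close> to \<open>t'\<close>, which runs backwards if
  \<open>t' < t\<close>. Both are images under \<alpha> of paths in the unit interval with the same
  ends.\<close>

lemma k_subpath:
  assumes "pathin X \<alpha>" "t \<in> {0..1}" "t' \<in> {0..1}"
  shows "k (\<lambda>s. \<alpha> (t' * s)) = k (\<lambda>s. \<alpha> (t * s)) \<otimes> k (\<lambda>s. \<alpha> (t + s * (t' - t)))"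
proof -
  have in01: "t * s \<in> {0..1}" "t' * s \<in> {0..1}" "t + s * (t' - t) \<in> {0..1}" if "s \<in> {0..1}" for s
    using that assms segment_in_unit_interval[OF assms(2,3) that] by (auto simp: mult_le_one)
  note \<alpha> = assms(1)[unfolded pathin_def]
  have p: "pathin X (\<lambda>s. \<alpha> (t * s))" "pathin X (\<lambda>s. \<alpha> (t' * s))" "pathin X (\<lambda>s. \<alpha> (t + s * (t' - t)))"
    unfolding pathin_def
    by (rule continuous_map_compose_on[OF \<alpha>]; use in01 in \<open>auto intro!: continuous_intros\<close>)+
  let ?f = "path_concat (\<lambda>s. t * s) (\<lambda>s. t + s * (t' - t))"
  have "pathin (top_of_set {0..1}) ?f"
    by (rule pathin_concat) (use in01 in \<open>auto simp: pathin_canon_iff path_def intro!: continuous_intros\<close>)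
  then have f: "continuous_on {0..1} ?f" "?f \<in> {0..1} \<rightarrow> {0..1}" by (auto simp: pathin_canon_iff path_def)
  have "path_homotopic X (path_concat (\<lambda>s. \<alpha> (t * s)) (\<lambda>s. \<alpha> (t + s * (t' - t)))) (\<lambda>s. \<alpha> (t' * s))"
  proof (rule path_homotopic_convex[OF _ \<alpha> f])
    show "continuous_on {0..1} (\<lambda>s. t' * s)" by (intro continuous_intros)
    show "(\<lambda>s. t' * s) \<in> {0..1} \<rightarrow> {0..1}" using in01 by blast
    show "path_concat (\<lambda>s. \<alpha> (t * s)) (\<lambda>s. \<alpha> (t + s * (t' - t))) s = \<alpha> (?f s)" for s
      by (simp add: path_concat_def)
  qed simp_all
  then show ?thesis using k_homotopic k_concat[OF p(1,3)] by simp
qed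

text \<open>A constant path is its own concatenation, so its value is an idempotent of the
  group.\<close>

lemma k_const: "x \<in> topspace X \<Longrightarrow> k (\<lambda>_. x) = \<one>"
proof -
  assume x: "x \<in> topspace X"
  then have "k (\<lambda>_. x) \<otimes> k (\<lambda>_. x) = k (\<lambda>_. x)"
    using k_concat[of "\<lambda>_. x" "\<lambda>_. x"] by (simp add: path_concat_def)
  then show ?thesis using k_closed[of "\<lambda>_. x"] x by simp
qed

text \<open>The label at time \<open>t\<close> is multiplied by the character of the path traversed
  so far. By \<open>k_subpath\<close> a small change of \<open>t\<close> acts as \<open>tr\<close>
  along a short segment, which is what open sets of the covering tolerate.\<close>

lemma pathin_cover_lift:
  assumes \<alpha>: "pathin X \<alpha>" and g: "g \<in> carrier Q"
  shows "pathin cover (\<lambda>t. (\<alpha> t, lbl (g \<otimes> k (\<lambda>s. \<alpha> (t * s)))))" (is "pathin _ ?w")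
proof -
  have k_in: "k (\<lambda>s. \<alpha> (t * s)) \<in> carrier Q" if "t \<in> {0..1}" for t
  proof (rule k_closed)
    show "pathin X (\<lambda>s. \<alpha> (t * s))"
      unfolding pathin_def
      by (rule continuous_map_compose_on[OF \<alpha>[unfolded pathin_def]])
         (use that in \<open>auto intro!: continuous_intros simp: mult_le_one\<close>)
  qed
  have top: "?w t \<in> points" if "t \<in> {0..1}" for t
    using pathin_in[OF \<alpha> that] k_in[OF that] g by (intro in_points) simp_all
  have "openin (top_of_set {0..1}) {t \<in> {0..1}. ?w t \<in> T}" if T: "openin cover T" for T
  proof (subst openin_subopen, rule ballI)
    fix t assume "t \<in> {t \<in> {0..1}. ?w t \<in> T}"
    then have t: "t \<in> {0..1}" "?w t \<in> T" by simp_all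
    obtain V where V: "openin X V" "fst (?w t) \<in> V" "\<And>\<delta>. path_within X V \<delta> \<Longrightarrow> \<delta> 0 = fst (?w t) \<Longrightarrow> tr \<delta> (?w t) \<in> T"
      using openin_coverD[OF T t(2)] by metis
    have "\<alpha> t \<in> V" using V(2) by simp
    obtain d where d: "d > 0" "\<And>y. y \<in> {0..1} \<Longrightarrow> dist t y < d \<Longrightarrow> \<alpha> y \<in> V"
      using continuous_map_metric_nbhd[OF \<alpha>[unfolded pathin_def] V(1) t(1) \<open>\<alpha> t \<in> V\<close>] by metis
    have "?w t' \<in> T" if t': "t' \<in> {0..1}" "dist t t' < d" for t'
    proof -
      let ?\<delta> = "\<lambda>s. \<alpha> (t + s * (t' - t))"
      have in01: "t + s * (t' - t) \<in> {0..1}" "dist t (t + s * (t' - t)) < d" if s: "s \<in> {0..1}" for s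
      proof -
        show "t + s * (t' - t) \<in> {0..1}" by (rule segment_in_unit_interval[OF t(1) t'(1) s])
        have "dist t (t + s * (t' - t)) = \<bar>s\<bar> * \<bar>t' - t\<bar>" by (simp add: dist_real_def abs_mult)
        also have "\<dots> \<le> \<bar>t' - t\<bar>" using s by (intro mult_left_le_one_le) auto
        finally show "dist t (t + s * (t' - t)) < d" using t'(2) by (simp add: dist_real_def)
      qed
      have "pathin X ?\<delta>"
        unfolding pathin_def
        by (rule continuous_map_compose_on[OF \<alpha>[unfolded pathin_def]])
           (use in01 in \<open>auto intro!: continuous_intros\<close>)
      then have "path_within X V ?\<delta>"
        unfolding pathin_subtopology using d(2) in01 by simp
      then have "tr ?\<delta> (?w t) \<in> T" by (rule V(3)) simp
      moreover have "tr ?\<delta> (?w t) = ?w t'"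
        using k_in[OF t(1)] g k_closed[OF \<open>pathin X ?\<delta>\<close>] k_subpath[OF \<alpha> t(1) t'(1)]
        by (simp add: tr_lbl m_assoc)
      ultimately show ?thesis by simp
    qed
    then have "{0..1} \<inter> ball t d \<subseteq> {t \<in> {0..1}. ?w t \<in> T}" by auto
    then show "\<exists>N. openin (top_of_set {0..1}) N \<and> t \<in> N \<and> N \<subseteq> {t \<in> {0..1}. ?w t \<in> T}"
      using t(1) d(1) by (intro exI[of _ "{0..1} \<inter> ball t d"]) (simp add: openin_open_Int)
  qed
  then show ?thesis
    unfolding pathin_def continuous_map_def topspace_cover using top by (simp add: Pi_iff)
qed

lemma deck_continuous:
  assumes a: "a \<in> carrier Q"
  shows "continuous_map cover cover (\<lambda>z. (fst z, lbl (a \<otimes> unl (snd z))))" (is "continuous_map _ _ ?f")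
  unfolding continuous_map_def topspace_cover
proof (intro conjI allI impI)
  show "?f \<in> points \<rightarrow> points"
  proof
    fix z assume "z \<in> points"
    then obtain x g where zx: "z = (x, lbl g)" "x \<in> topspace X" "g \<in> carrier Q" by (rule pointsE)
    show "?f z \<in> points" unfolding zx(1) using zx(2,3) a by (simp add: in_points)
  qed
  fix T assume T: "openin cover T"
  show "openin cover {z \<in> points. ?f z \<in> T}"
  proof (rule openin_coverI)
    fix x g assume x: "x \<in> topspace X" "g \<in> carrier Q" and "(x, lbl g) \<in> {z \<in> points. ?f z \<in> T}"
    then have "(x, lbl (a \<otimes> g)) \<in> T" by simp
    from openin_coverD[OF T this] obtain V where V: "openin X V" "x \<in> V"
      "\<And>\<delta>. path_within X V \<delta> \<Longrightarrow> \<delta> 0 = x \<Longrightarrow> tr \<delta> (x, lbl (a \<otimes> g)) \<in> T"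
      by (metis fst_conv)
    have "(\<delta> 1, lbl (g \<otimes> k \<delta>)) \<in> {z \<in> points. ?f z \<in> T}" if \<delta>: "path_within X V \<delta>" "\<delta> 0 = x" for \<delta>
    proof -
      have p: "pathin X \<delta>" using \<delta>(1) by (simp add: pathin_subtopology)
      show ?thesis
        using V(3)[OF \<delta>] x a k_closed[OF p] path_finish_in_topspace[OF p] by (simp add: tr_lbl in_points m_assoc)
    qed
    then show "\<exists>V. openin X V \<and> x \<in> V \<and> (\<forall>\<delta>. path_within X V \<delta> \<longrightarrow> \<delta> 0 = x \<longrightarrow>
        (\<delta> 1, lbl (g \<otimes> k \<delta>)) \<in> {z \<in> points. ?f z \<in> T})"
      using V(1,2) by blast
  qed simp
qed

lemma deck_transformation:
  assumes a: "a \<in> carrier Q"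
  shows "(\<lambda>z. (fst z, lbl (a \<otimes> unl (snd z)))) \<in> deck_transformations cover fst"
proof -
  have inv: "(fst z, lbl (b \<otimes> unl (lbl (inv b \<otimes> unl (snd z))))) = z" if "z \<in> points" "b \<in> carrier Q" for z b
  proof -
    obtain x g where zx: "z = (x, lbl g)" "x \<in> topspace X" "g \<in> carrier Q" by (rule pointsE[OF \<open>z \<in> points\<close>])
    show ?thesis unfolding zx(1) using zx(3) that(2) by (simp flip: m_assoc)
  qed
  have "homeomorphic_maps cover cover (\<lambda>z. (fst z, lbl (a \<otimes> unl (snd z)))) (\<lambda>z. (fst z, lbl (inv a \<otimes> unl (snd z))))"
    unfolding homeomorphic_maps_def topspace_cover
    using deck_continuous[OF a] deck_continuous[of "inv a"] a inv[of _ a] inv[of _ "inv a"] by simp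
  then show ?thesis
    unfolding deck_transformations_def homeomorphic_map_maps by auto
qed

lemma regular_cover: "regular_projection cover fst"
  unfolding regular_projection_def topspace_cover
proof (intro ballI impI)
  fix e e' assume e: "e \<in> points" "e' \<in> points" "fst e = fst e'"
  obtain x g where ex: "e = (x, lbl g)" "x \<in> topspace X" "g \<in> carrier Q" using e(1) by (rule pointsE)
  obtain x' g' where ex': "e' = (x', lbl g')" "x' \<in> topspace X" "g' \<in> carrier Q" using e(2) by (rule pointsE)
  let ?a = "g' \<otimes> inv g"
  have "?a \<in> carrier Q" using ex ex' by simp
  moreover have "(fst e, lbl (?a \<otimes> unl (snd e))) = e'"
    using ex ex' e(3) by (simp add: m_assoc)
  ultimately show "\<exists>\<phi>\<in>deck_transformations cover fst. \<phi> e = e'"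
    by (intro bexI[OF _ deck_transformation[of ?a]])
qed

lemma continuous_cover: "continuous_map cover X fst"
  unfolding continuous_map_def topspace_cover
proof (intro conjI allI impI)
  show "fst \<in> points \<rightarrow> topspace X" by (auto simp: points_def)
  fix W assume W: "openin X W"
  show "openin cover {z \<in> points. fst z \<in> W}"
  proof (rule openin_coverI)
    fix x g assume x: "x \<in> topspace X" "g \<in> carrier Q" "(x, lbl g) \<in> {z \<in> points. fst z \<in> W}"
    have "(\<delta> 1, lbl (g \<otimes> k \<delta>)) \<in> {z \<in> points. fst z \<in> W}" if "path_within X W \<delta>" for \<delta>
    proof -
      have p: "pathin X \<delta>" using that by (simp add: pathin_subtopology)
      then show ?thesis
        using path_finish_in_topspace[OF that] x k_closed[OF p] by (simp add: in_points)
    qed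
    then show "\<exists>V. openin X V \<and> x \<in> V \<and> (\<forall>\<delta>. path_within X V \<delta> \<longrightarrow> \<delta> 0 = x \<longrightarrow>
        (\<delta> 1, lbl (g \<otimes> k \<delta>)) \<in> {z \<in> points. fst z \<in> W})"
      using x(3) W by (intro exI[of _ W]) simp
  qed simp
qed

text \<open>Loops in a categorical set are null-homotopic in \<open>X\<close>, so over a
  path-connected \<open>U\<close> of this kind the character of a path is determined by its ends.
  Twisting by the function \<open>?k\<close> turns the labels into constants, and each element of
  the group gives one sheet.\<close>

lemma covering_cover: "covering_map cover X fst"
  unfolding covering_map_def
proof (intro conjI ballI continuous_cover)
  show "fst ` topspace cover = topspace X"
    unfolding topspace_cover points_def by (metis carrier_not_empty fst_image_times image_is_empty)
  fix x1 assume x1: "x1 \<in> topspace X"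
  obtain U where U: "openin X U" "x1 \<in> U" "U \<subseteq> topspace X" "path_connectedin X U" "categorical X U"
    using locally_categoricalE[OF X(2,3) openin_topspace x1] by metis
  have "\<exists>\<delta>. path_within X U \<delta> \<and> \<delta> 0 = x1 \<and> \<delta> 1 = x" if "x \<in> U" for x
    using path_connectedinE[OF U(4,2) that] by metis
  then obtain \<rho> where \<rho>: "\<And>x. x \<in> U \<Longrightarrow> path_within X U (\<rho> x)" "\<And>x. x \<in> U \<Longrightarrow> \<rho> x 0 = x1" "\<And>x. x \<in> U \<Longrightarrow> \<rho> x 1 = x"
    by metis
  have \<rho>X: "pathin X (\<rho> x)" if "x \<in> U" for x using \<rho>(1)[OF that] by (simp add: pathin_subtopology)
  let ?k = "\<lambda>x. k (\<rho> x)"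
  have kin: "?k x \<in> carrier Q" if "x \<in> U" for x using k_closed \<rho>X that by blast
  \<comment> \<open>The two paths from \<open>x1\<close> to \<open>\<delta> 1\<close>, directly and
    through \<open>\<delta> 0\<close>, both run in \<open>U\<close> and so are homotopic in
    \<open>X\<close>.\<close>
  have kk: "?k (\<delta> 0) \<otimes> k \<delta> = ?k (\<delta> 1)" if \<delta>: "path_within X U \<delta>" for \<delta>
  proof -
    have "\<delta> 0 \<in> U" "\<delta> 1 \<in> U" using pathin_in[OF \<delta>, of 0] pathin_in[OF \<delta>, of 1] by auto
    moreover have "pathin X \<delta>" using \<delta> by (simp add: pathin_subtopology)
    moreover have "path_homotopic X (path_concat (\<rho> (\<delta> 0)) \<delta>) (\<rho> (\<delta> 1))"
      by (rule path_homotopic_categorical[OF U(5)]) (use \<rho> \<delta> calculation in auto)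
    ultimately show ?thesis using k_concat[of "\<rho> (\<delta> 0)" \<delta>] k_homotopic \<rho>X \<rho>(3) by simp
  qed
  let ?\<sigma> = "\<lambda>g x. (x, lbl (g \<otimes> ?k x))"
  let ?S = "\<lambda>g. ?\<sigma> g ` U"
  have UX: "x \<in> topspace X" if "x \<in> U" for x using that U(3) by blast
  have Sp: "?S g \<subseteq> points" if "g \<in> carrier Q" for g
    using that kin UX by (auto intro!: in_points)
  have open_S: "openin cover (?S g)" if g: "g \<in> carrier Q" for g
  proof (rule openin_coverI[OF Sp[OF g]])
    fix x h assume x: "x \<in> topspace X" "h \<in> carrier Q" "(x, lbl h) \<in> ?S g"
    then have xU: "x \<in> U" "lbl h = lbl (g \<otimes> ?k x)" by auto
    then have h: "h = g \<otimes> ?k x" using lbl_inject[of h "g \<otimes> ?k x"] x g kin by simp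
    have "(\<delta> 1, lbl (h \<otimes> k \<delta>)) \<in> ?S g" if \<delta>: "path_within X U \<delta>" "\<delta> 0 = x" for \<delta>
    proof -
      have "pathin X \<delta>" using \<delta> by (simp add: pathin_subtopology)
      then have "h \<otimes> k \<delta> = g \<otimes> ?k (\<delta> 1)"
        unfolding h using kk[OF \<delta>(1)] \<delta>(2) g kin[OF xU(1)] k_closed by (simp add: m_assoc)
      moreover have "\<delta> 1 \<in> U" using path_finish_in_topspace[OF \<delta>(1)] by simp
      ultimately show ?thesis by simp
    qed
    then show "\<exists>V. openin X V \<and> x \<in> V \<and> (\<forall>\<delta>. path_within X V \<delta> \<longrightarrow> \<delta> 0 = x \<longrightarrow> (\<delta> 1, lbl (h \<otimes> k \<delta>)) \<in> ?S g)"
      using U(1) xU(1) by blast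
  qed
  have homeo: "homeomorphic_map (subtopology cover (?S g)) (subtopology X U) fst" if g: "g \<in> carrier Q" for g
  proof -
    have \<sigma>: "continuous_map (subtopology X U) cover (?\<sigma> g)"
      unfolding continuous_map_def topspace_cover
    proof (intro conjI allI impI)
      show "?\<sigma> g \<in> topspace (subtopology X U) \<rightarrow> points" using Sp[OF g] by auto
      fix T assume T: "openin cover T"
      have "openin X {x \<in> U. ?\<sigma> g x \<in> T}"
      proof (subst openin_subopen, rule ballI)
        fix x assume "x \<in> {x \<in> U. ?\<sigma> g x \<in> T}"
        then have x: "x \<in> U" "?\<sigma> g x \<in> T" by simp_all
        obtain V where V: "openin X V" "fst (?\<sigma> g x) \<in> V"
            "\<And>\<delta>. path_within X V \<delta> \<Longrightarrow> \<delta> 0 = fst (?\<sigma> g x) \<Longrightarrow> tr \<delta> (?\<sigma> g x) \<in> T"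
          using openin_coverD[OF T x(2)] by metis
        \<comment> \<open>Open sets of the covering are tested only by paths, so continuity of the
          section requires a path-connected neighbourhood of \<open>x\<close> inside
          \<open>V \<inter> U\<close>.\<close>
        have "openin X (V \<inter> U)" "x \<in> V \<inter> U" using V U(1) x(1) by auto
        then obtain W where W: "openin X W" "x \<in> W" "W \<subseteq> V \<inter> U" "path_connectedin X W"
          using locally_categoricalE[OF X(2,3)] by metis
        have "W \<subseteq> {x \<in> U. ?\<sigma> g x \<in> T}"
        proof
          fix x' assume x': "x' \<in> W"
          obtain \<delta> where \<delta>: "path_within X W \<delta>" "\<delta> 0 = x" "\<delta> 1 = x'"
            using path_connectedinE[OF W(4,2) x'] by metis
          have \<delta>V: "path_within X V \<delta>" "path_within X U \<delta>" "pathin X \<delta>"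
            using \<delta>(1) W(3) by (auto simp: pathin_subtopology)
          have "tr \<delta> (?\<sigma> g x) \<in> T" by (rule V(3)[OF \<delta>V(1)]) (simp add: \<delta>)
          moreover have "tr \<delta> (?\<sigma> g x) = ?\<sigma> g x'"
            using kk[OF \<delta>V(2)] \<delta> g kin[OF x(1)] k_closed[OF \<delta>V(3)] by (simp add: tr_lbl m_assoc)
          ultimately show "x' \<in> {x \<in> U. ?\<sigma> g x \<in> T}" using x' W(3) by auto
        qed
        then show "\<exists>W. openin X W \<and> x \<in> W \<and> W \<subseteq> {x \<in> U. ?\<sigma> g x \<in> T}" using W by blast
      qed
      moreover have "{x \<in> topspace (subtopology X U). ?\<sigma> g x \<in> T} = {x \<in> U. ?\<sigma> g x \<in> T}" using UX by auto
      ultimately show "openin (subtopology X U) {x \<in> topspace (subtopology X U). ?\<sigma> g x \<in> T}"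
        using openin_open_subtopology[OF U(1)] by auto
    qed
    have "homeomorphic_maps (subtopology cover (?S g)) (subtopology X U) fst (?\<sigma> g)"
      unfolding homeomorphic_maps_def
    proof (intro conjI ballI)
      show "continuous_map (subtopology cover (?S g)) (subtopology X U) fst"
        using continuous_cover by (auto simp: continuous_map_in_subtopology intro: continuous_map_from_subtopology)
      show "continuous_map (subtopology X U) (subtopology cover (?S g)) (?\<sigma> g)"
        using \<sigma> by (auto simp: continuous_map_in_subtopology)
    qed auto
    then show ?thesis unfolding homeomorphic_map_maps by blast
  qed
  have union: "\<Union>(?S ` carrier Q) = {c \<in> topspace cover. fst c \<in> U}"
  proof
    show "\<Union>(?S ` carrier Q) \<subseteq> {c \<in> topspace cover. fst c \<in> U}"
      unfolding topspace_cover using Sp by fastforce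
    show "{c \<in> topspace cover. fst c \<in> U} \<subseteq> \<Union>(?S ` carrier Q)"
    proof
      fix c assume "c \<in> {c \<in> topspace cover. fst c \<in> U}"
      then have "c \<in> points" "fst c \<in> U" by (simp_all add: topspace_cover)
      then obtain x g where c: "c = (x, lbl g)" "g \<in> carrier Q" "x \<in> U" by (metis pointsE fst_conv)
      then have "c = ?\<sigma> (g \<otimes> inv ?k x) x" using kin[OF c(3)] by (simp add: m_assoc)
      moreover have "g \<otimes> inv ?k x \<in> carrier Q" using c kin by simp
      ultimately show "c \<in> \<Union>(?S ` carrier Q)" using c(3) by blast
    qed
  qed
  have "pairwise disjnt (?S ` carrier Q)"
  proof (rule pairwiseI)
    fix S S' assume "S \<in> ?S ` carrier Q" "S' \<in> ?S ` carrier Q" and ne: "S \<noteq> S'"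
    then obtain g g' where g: "g \<in> carrier Q" "S = ?S g" "g' \<in> carrier Q" "S' = ?S g'" by blast
    show "disjnt S S'"
    proof (rule ccontr)
      assume "\<not> disjnt S S'"
      then obtain x where x: "x \<in> U" "lbl (g \<otimes> ?k x) = lbl (g' \<otimes> ?k x)"
        unfolding g disjnt_def by blast
      then have "g \<otimes> ?k x = g' \<otimes> ?k x" using g kin by (intro lbl_inject) simp_all
      then have "g = g'" using g kin[OF x(1)] by simp
      then show False using ne g by simp
    qed
  qed
  then show "\<exists>U. openin X U \<and> x1 \<in> U \<and> (\<exists>\<V>. \<Union>\<V> = {c \<in> topspace cover. fst c \<in> U} \<and>
        (\<forall>V\<in>\<V>. openin cover V) \<and> pairwise disjnt \<V> \<and>
        (\<forall>V\<in>\<V>. homeomorphic_map (subtopology cover V) (subtopology X U) fst))"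
    using U(1,2) union open_S homeo
    by (intro exI[of _ U] exI[of _ "?S ` carrier Q"] conjI) simp_all
qed

lemma path_connected_cover: "path_connected_space cover"
proof -
  let ?c = "(x0, lbl \<one>)"
  have *: "path_component_of cover ?c z" if "z \<in> points" for z
  proof -
    obtain x g where z: "z = (x, lbl g)" "x \<in> topspace X" "g \<in> carrier Q" by (rule pointsE[OF \<open>z \<in> points\<close>])
    obtain \<tau> where \<tau>: "pathin X \<tau>" "\<tau> 0 = x0" "\<tau> 1 = x" using X(1,4) z(2) unfolding path_connected_space_def by blast
    have k\<tau>: "k \<tau> \<in> carrier Q" using k_closed \<tau>(1) by simp
    \<comment> \<open>A path to \<open>x\<close> ends at the label \<open>k \<tau>\<close>; running
      first through a loop with this value corrects the label to \<open>g\<close>.\<close>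
    then obtain \<gamma> where \<gamma>: "pathin X \<gamma>" "\<gamma> 0 = x0" "\<gamma> 1 = x0" "k \<gamma> = g \<otimes> inv k \<tau>"
      using k_onto[of "g \<otimes> inv k \<tau>"] z(3) by auto
    let ?\<alpha> = "path_concat \<gamma> \<tau>"
    have \<alpha>: "pathin X ?\<alpha>" using \<gamma> \<tau> by auto
    have "k ?\<alpha> = g" using k_concat[of \<gamma> \<tau>] \<gamma> \<tau> z(3) k\<tau> by (simp add: m_assoc)
    then show ?thesis
      unfolding path_component_of_def
      using pathin_cover_lift[OF \<alpha> one_closed] \<gamma> \<tau> z X(4) k_const[OF X(4)]
      by (intro exI[of _ "\<lambda>t. (?\<alpha> t, lbl (\<one> \<otimes> k (\<lambda>s. ?\<alpha> (t * s))))"]) simp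
  qed
  show ?thesis
    unfolding path_connected_space_iff_path_component topspace_cover
    by (intro ballI path_component_of_trans[OF path_component_of_sym[OF *] *])
qed

lemma cover_in_finite_regular_covers: "(cover, fst, (x0, lbl \<one>)) \<in> finite_regular_covers X x0"
proof -
  have "finite {y \<in> topspace cover. fst y = x}" for x
  proof (rule finite_subset)
    show "{y \<in> topspace cover. fst y = x} \<subseteq> {x} \<times> lbl ` carrier Q"
      unfolding topspace_cover points_def by auto
  qed (use fin in simp)
  then show ?thesis
    unfolding finite_regular_covers_def
    using covering_cover path_connected_cover regular_cover X(4) in_points[of x0 "\<one>"]
    by (simp add: topspace_cover)
qed

text \<open>Along \<gamma> the label \<open>g\<close> becomes \<open>g \<otimes> k \<gamma>\<close>,
  so the conclusion is cancellation. Any point \<open>c\<close> of the fibre is allowed: the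
  coordinates of \<open>xhat0\<close> need not be the base points of the coverings.\<close>

lemma closed_lift_cover:
  assumes \<gamma>: "pathin X \<gamma>" "\<gamma> 0 = x0" "\<gamma> 1 = x0" and c: "c \<in> topspace cover" "fst c = x0"
    and closed: "lift_end cover fst c \<gamma> = c"
  shows "k \<gamma> = \<one>"
proof -
  interpret L: path_lifting cover X fst by (rule covering_path_lifting[OF covering_cover])
  obtain x g where cx: "c = (x, lbl g)" "g \<in> carrier Q" using c(1) pointsE unfolding topspace_cover by metis
  then have x: "x = x0" using c(2) by simp
  have "lift_end cover fst c \<gamma> = (\<gamma> 1, lbl (g \<otimes> k (\<lambda>s. \<gamma> (1 * s))))"
    by (rule L.lift_end_eq[OF pathin_cover_lift[OF \<gamma>(1) cx(2)]]) (use \<gamma> cx x X(4) k_const in simp_all)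
  then have "lbl (g \<otimes> k \<gamma>) = lbl g" using closed cx by simp
  then have "g \<otimes> k \<gamma> = g" using lbl_inject cx(2) k_closed[OF \<gamma>(1)] by simp
  then show ?thesis using cx(2) k_closed[OF \<gamma>(1)] by simp
qed

end

section \<open>Realising a normal subgroup of finite index by a covering\<close>

abbreviation tot :: "'a pointed_cover \<Rightarrow> ('a \<times> nat) topology" where "tot i \<equiv> fst i"
abbreviation prj :: "'a pointed_cover \<Rightarrow> 'a \<times> nat \<Rightarrow> 'a" where "prj i \<equiv> fst (snd i)"
abbreviation clift :: "'a pointed_cover \<Rightarrow> 'a \<times> nat \<Rightarrow> (real \<Rightarrow> 'a) \<Rightarrow> 'a \<times> nat" where
  "clift i \<equiv> lift_end (tot i) (prj i)"

text \<open>Chosen paths \<tau> from the base point to every point close up each path to a loop, and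
  the coset of this loop modulo \<open>N\<close> is a character of the fundamental groupoid. The
  covering of this character detects \<open>N\<close>.\<close>

lemma finite_index_normal_cover:
  assumes X: "path_connected_space X" "locally_path_connected_space X" "locally_categorical X" "x0 \<in> topspace X"
    and N: "finite_index_normal (pi1 X x0) N"
  obtains i where "i \<in> finite_regular_covers X x0"
    "\<And>c \<gamma>. c \<in> topspace (tot i) \<Longrightarrow> prj i c = x0 \<Longrightarrow> pathin X \<gamma> \<Longrightarrow> \<gamma> 0 = x0 \<Longrightarrow> \<gamma> 1 = x0 \<Longrightarrow>
      clift i c \<gamma> = c \<Longrightarrow> path_class X \<gamma> \<in> N"
proof -
  let ?G = "pi1 X x0"
  interpret N: normal N ?G using N by (simp add: finite_index_normal_def)
  \<comment> \<open>The path chosen for \<open>x0\<close> is constant, so that closing up a loop at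
    \<open>x0\<close> does not alter its class.\<close>
  have "\<exists>\<tau>. pathin X \<tau> \<and> \<tau> 0 = x0 \<and> \<tau> 1 = x \<and> (x = x0 \<longrightarrow> \<tau> = (\<lambda>_. x0))" if "x \<in> topspace X" for x
  proof (cases "x = x0")
    case True
    then show ?thesis using X(4) by (intro exI[of _ "\<lambda>_. x0"]) simp
  next
    case False
    then show ?thesis using X(1,4) that unfolding path_connected_space_def by blast
  qed
  then obtain \<tau> where \<tau>: "\<And>x. x \<in> topspace X \<Longrightarrow> pathin X (\<tau> x)" "\<And>x. x \<in> topspace X \<Longrightarrow> \<tau> x 0 = x0"
      "\<And>x. x \<in> topspace X \<Longrightarrow> \<tau> x 1 = x" and \<tau>0: "\<tau> x0 = (\<lambda>_. x0)"
    using X(4) by metis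
  define hol where "hol = (\<lambda>\<delta>. path_concat (path_concat (\<tau> (\<delta> 0)) \<delta>) (path_rev (\<tau> (\<delta> 1))))"
  have hol: "pathin X (hol \<delta>)" "hol \<delta> 0 = x0" "hol \<delta> 1 = x0" if "pathin X \<delta>" for \<delta>
    using that \<tau> path_start_in_topspace[OF that] path_finish_in_topspace[OF that]
    by (auto simp: hol_def intro!: pathin_concat)
  have hol_G: "path_class X (hol \<delta>) \<in> carrier ?G" if "pathin X \<delta>" for \<delta>
    using hol[OF that] unfolding pi1_carrier by blast
  \<comment> \<open>Between the two paths \<tau> is run through to \<open>x0\<close> and back, and
    this detour cancels.\<close>
  have hol_concat: "path_homotopic X (path_concat (hol \<delta>) (hol \<delta>')) (hol (path_concat \<delta> \<delta>'))"
    if \<delta>: "pathin X \<delta>" "pathin X \<delta>'" "\<delta> 1 = \<delta>' 0" for \<delta> \<delta>'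
  proof -
    note top = path_start_in_topspace[OF \<delta>(1)] path_finish_in_topspace[OF \<delta>(1)] path_finish_in_topspace[OF \<delta>(2)]
    let ?a = "\<tau> (\<delta> 0)" and ?b = "\<tau> (\<delta>' 0)" and ?c = "path_rev (\<tau> (\<delta>' 1))"
    have p: "pathin X ?a" "pathin X ?b" "pathin X ?c" "pathin X (path_rev ?b)"
      and e: "?a 1 = \<delta> 0" "?b 0 = x0" "?b 1 = \<delta>' 0" "?c 0 = \<delta>' 1"
      using top \<tau> \<delta>(3) by auto
    have q: "pathin X (path_concat ?a \<delta>)" "pathin X (path_concat ?b \<delta>')" "pathin X (path_concat (path_concat ?b \<delta>') ?c)"
      "pathin X (path_concat \<delta> \<delta>')"
      using p e \<delta> by (auto intro!: pathin_concat)
    have "path_homotopic X (path_concat (hol \<delta>) (hol \<delta>'))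
        (path_concat (path_concat ?a \<delta>) (path_concat (path_rev ?b) (path_concat (path_concat ?b \<delta>') ?c)))"
      unfolding hol_def \<delta>(3) by (rule path_homotopic_assoc) (use p q e \<delta> in simp_all)
    also have "path_homotopic X \<dots> (path_concat (path_concat ?a \<delta>) (path_concat (path_concat (path_rev ?b) (path_concat ?b \<delta>')) ?c))"
      by (intro path_homotopic_concat path_homotopic_sym[OF path_homotopic_assoc]) (use p q e \<delta> in simp_all)
    also have "path_homotopic X \<dots> (path_concat (path_concat ?a \<delta>) (path_concat \<delta>' ?c))"
      by (intro path_homotopic_concat path_homotopic_cancel_left) (use p q e \<delta> in simp_all)
    also have "path_homotopic X \<dots> (path_concat (path_concat (path_concat ?a \<delta>) \<delta>') ?c)"
      by (rule path_homotopic_sym[OF path_homotopic_assoc]) (use p q e \<delta> in simp_all)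
    also have "path_homotopic X \<dots> (hol (path_concat \<delta> \<delta>'))"
      unfolding hol_def path_concat_ends
      by (intro path_homotopic_concat path_homotopic_assoc) (use p q e \<delta> in simp_all)
    finally show ?thesis .
  qed
  have hol_loop: "path_class X (hol \<gamma>) = path_class X \<gamma>" if "pathin X \<gamma>" "\<gamma> 0 = x0" "\<gamma> 1 = x0" for \<gamma>
  proof (rule path_class_eqI)
    have "path_homotopic X (hol \<gamma>) (path_concat (path_concat (\<lambda>_. x0) \<gamma>) (\<lambda>_. x0))"
      using that X(4) by (simp add: hol_def \<tau>0 path_rev_def pathin_concat)
    also have "path_homotopic X \<dots> (path_concat (\<lambda>_. x0) \<gamma>)"
      by (rule path_homotopic_rid) (use that X(4) in \<open>auto intro!: pathin_concat\<close>)
    also have "path_homotopic X \<dots> \<gamma>"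
      by (rule path_homotopic_lid) (use that in simp_all)
    finally show "path_homotopic X (hol \<gamma>) \<gamma>" .
  qed
  define k where "k = (\<lambda>\<delta>. N #>\<^bsub>?G\<^esub> path_class X (hol \<delta>))"
  interpret C: path_character "?G Mod N" X x0 k
  proof (unfold path_character_def path_character_axioms_def, intro conjI allI impI X)
    show "group (?G Mod N)" by (rule N.factorgroup_is_group)
    show "finite (carrier (?G Mod N))"
      using N by (simp add: finite_index_normal_def FactGroup_def)
    fix \<delta> assume \<delta>: "pathin X \<delta>"
    show "k \<delta> \<in> carrier (?G Mod N)"
      using hol_G[OF \<delta>] N.subset by (simp add: k_def FactGroup_def N.rcosetsI)
  next
    fix \<delta> \<delta>' assume \<delta>: "pathin X \<delta>" "pathin X \<delta>'" "\<delta> 1 = \<delta>' 0"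
    have "path_class X (hol (path_concat \<delta> \<delta>')) = path_class X (path_concat (hol \<delta>) (hol \<delta>'))"
      using path_class_eqI[OF hol_concat[OF \<delta>]] by simp
    also have "\<dots> = path_class X (hol \<delta>) \<otimes>\<^bsub>?G\<^esub> path_class X (hol \<delta>')"
      using pi1_mult[of X "hol \<delta>" "hol \<delta>'"] hol \<delta> by simp
    finally show "k (path_concat \<delta> \<delta>') = k \<delta> \<otimes>\<^bsub>?G Mod N\<^esub> k \<delta>'"
      using N.rcos_sum[OF hol_G hol_G] \<delta> by (simp add: k_def FactGroup_def)
  next
    fix \<delta> \<delta>' assume h: "path_homotopic X \<delta> \<delta>'"
    note i = path_homotopic_imp[OF h]
    have "path_homotopic X (hol \<delta>) (hol \<delta>')"
      unfolding hol_def i(3,4)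
      using \<tau> path_start_in_topspace[OF i(1)] path_finish_in_topspace[OF i(1)] h i
      by (intro path_homotopic_concat) auto
    then show "k \<delta> = k \<delta>'" unfolding k_def using path_class_eqI by metis
  next
    fix g assume "g \<in> carrier (?G Mod N)"
    then obtain c where c: "c \<in> carrier ?G" "g = N #>\<^bsub>?G\<^esub> c" by (auto simp: FactGroup_def RCOSETS_def)
    then obtain \<gamma> where \<gamma>: "pathin X \<gamma>" "\<gamma> 0 = x0" "\<gamma> 1 = x0" "c = path_class X \<gamma>" unfolding pi1_carrier by blast
    then show "\<exists>\<gamma>. pathin X \<gamma> \<and> \<gamma> 0 = x0 \<and> \<gamma> 1 = x0 \<and> k \<gamma> = g"
      using c(2) hol_loop by (intro exI[of _ \<gamma>]) (simp add: k_def)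
  qed
  show ?thesis
  proof (rule that[OF C.cover_in_finite_regular_covers], unfold fst_conv snd_conv)
    fix c \<gamma> assume *: "c \<in> topspace C.cover" "fst c = x0" "pathin X \<gamma>" "\<gamma> 0 = x0" "\<gamma> 1 = x0" "lift_end C.cover fst c \<gamma> = c"
    have "k \<gamma> = \<one>\<^bsub>?G Mod N\<^esub>" by (rule C.closed_lift_cover) (use * in simp_all)
    then have "N #>\<^bsub>?G\<^esub> path_class X \<gamma> = N" using hol_loop * by (simp add: k_def FactGroup_def)
    moreover have "path_class X \<gamma> \<in> carrier ?G" unfolding pi1_carrier using * by blast
    ultimately show "path_class X \<gamma> \<in> N"
      using N.rcos_self[OF _ N.subgroup_axioms] by metis
  qed
qed

section \<open>The inverse limit of the finite coverings\<close>

lemma finite_regular_coversD: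
  assumes "i \<in> finite_regular_covers X x0"
  shows "covering_map (tot i) X (prj i)" "prj i (snd (snd i)) = x0"
  using assms by (auto simp: finite_regular_covers_def)

definition one_sheeted :: "'a topology \<Rightarrow> 'a \<Rightarrow> 'a pointed_cover" where
  "one_sheeted X x0 = (prod_topology X (discrete_topology {0}), fst, (x0, 0))"

lemma one_sheeted_cover:
  assumes "path_connected_space X" "x0 \<in> topspace X"
  shows "one_sheeted X x0 \<in> finite_regular_covers X x0"
proof -
  let ?C = "prod_topology X (discrete_topology {0::nat})"
  have "homeomorphic_maps ?C X fst (\<lambda>x. (x, 0))"
    unfolding homeomorphic_maps_def by (auto simp: continuous_map_fst continuous_map_pairwise o_def)
  then have homeo: "homeomorphic_map ?C X fst" unfolding homeomorphic_map_maps by blast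
  have "covering_map ?C X fst"
    unfolding covering_map_def
  proof (intro conjI ballI)
    show "continuous_map ?C X fst" "fst ` topspace ?C = topspace X"
      using homeo homeomorphic_imp_continuous_map homeomorphic_imp_surjective_map by blast+
    fix x assume x: "x \<in> topspace X"
    have "\<Union>{topspace ?C} = {c \<in> topspace ?C. fst c \<in> topspace X}" by auto
    then show "\<exists>U. openin X U \<and> x \<in> U \<and> (\<exists>\<V>. \<Union>\<V> = {c \<in> topspace ?C. fst c \<in> U} \<and>
             (\<forall>V\<in>\<V>. openin ?C V) \<and> pairwise disjnt \<V> \<and>
             (\<forall>V\<in>\<V>. homeomorphic_map (subtopology ?C V) (subtopology X U) fst))"
      using x homeo by (intro exI[of _ "topspace X"] exI[of _ "{topspace ?C}"] conjI) (simp_all add: pairwise_def del: topspace_prod_topology)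
  qed
  moreover have "path_connected_space ?C"
    using homeomorphic_path_connected_space[OF homeomorphic_map_imp_homeomorphic_space[OF homeo]] assms(1)
    by simp
  moreover have "regular_projection ?C fst"
    unfolding regular_projection_def
  proof (intro ballI impI)
    fix e e' assume "e \<in> topspace ?C" "e' \<in> topspace ?C" "fst e = fst e'"
    then have "e = e'" by auto
    then show "\<exists>\<phi>\<in>deck_transformations ?C fst. \<phi> e = e'"
      using homeomorphic_map_id[of ?C ?C]
      by (intro bexI[of _ id]) (simp_all add: deck_transformations_def)
  qed
  moreover have "finite {y \<in> topspace ?C. fst y = x}" for x
    by (rule finite_subset[of _ "{(x, 0)}"]) auto
  ultimately show ?thesis
    using assms(2) by (simp add: one_sheeted_def finite_regular_covers_def)
qed

locale universal_limit =
  fixes X :: "'a topology" and x0 :: 'a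
  assumes connected_X: "path_connected_space X" and base_X: "x0 \<in> topspace X"
begin

abbreviation "I \<equiv> finite_regular_covers X x0"
abbreviation "XH \<equiv> Xhat X x0"
abbreviation "ph \<equiv> phat X x0"

lemma one_in: "one_sheeted X x0 \<in> I"
  using one_sheeted_cover[OF connected_X base_X] .

lemma topspace_Xhat:
  "topspace XH = {y \<in> \<Pi>\<^sub>E i\<in>I. topspace (tot i). \<forall>i\<in>I. \<forall>j\<in>I. \<forall>f. cover_morphism i j f \<longrightarrow> f (y i) = y j}"
  unfolding Xhat_def by auto

lemma Xhat_coord: "y \<in> topspace XH \<Longrightarrow> i \<in> I \<Longrightarrow> y i \<in> topspace (tot i)"
  unfolding topspace_Xhat by blast

lemma phat_coord:
  assumes y: "y \<in> topspace XH" and i: "i \<in> I"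
  shows "ph y = prj i (y i)"
proof -
  have coord: "prj j (y j) = fst (y (one_sheeted X x0))" if j: "j \<in> I" for j
  proof -
    obtain C q c where jc: "j = (C, q, c)" by (cases j) auto
    have "continuous_map C X q" "q c = x0"
      using finite_regular_coversD[OF j] by (simp_all add: jc covering_map_def)
    \<comment> \<open>The projection of the covering \<open>j\<close> is itself a bonding map, with
      the one-sheeted covering as target.\<close>
    then have "cover_morphism j (one_sheeted X x0) (\<lambda>z. (q z, 0))"
      by (simp add: jc one_sheeted_def continuous_map_pairwise o_def)
    then have "(q (y j), 0) = y (one_sheeted X x0)"
      using y j one_in unfolding topspace_Xhat by blast
    then have "fst (q (y j), 0::nat) = fst (y (one_sheeted X x0))" by simp
    then show ?thesis by (simp add: jc)
  qed
  have "ph y = fst (y (one_sheeted X x0))"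
    unfolding phat_def
  proof (rule the_equality)
    show "\<forall>(C, q, c)\<in>I. q (y (C, q, c)) = fst (y (one_sheeted X x0))"
      using coord by fastforce
    show "x = fst (y (one_sheeted X x0))" if "\<forall>(C, q, c)\<in>I. q (y (C, q, c)) = x" for x
      using bspec[OF that one_in] by (simp add: one_sheeted_def)
  qed
  then show ?thesis using coord[OF i] by simp
qed

lemma continuous_Xhat_coord: "i \<in> I \<Longrightarrow> continuous_map XH (tot i) (\<lambda>y. y i)"
  unfolding Xhat_def by (intro continuous_map_from_subtopology continuous_map_product_projection)

lemma Xhat_ext:
  assumes "y \<in> topspace XH" "z \<in> topspace XH" "\<And>i. i \<in> I \<Longrightarrow> y i = z i"
  shows "y = z"
proof (rule extensionalityI[of _ I])
  show "y \<in> extensional I" "z \<in> extensional I"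
    using assms(1,2) unfolding topspace_Xhat by (auto simp: PiE_def)
qed (use assms(3) in simp)

lemma coord_path_lifting: "i \<in> I \<Longrightarrow> path_lifting (tot i) X (prj i)"
  by (rule covering_path_lifting, rule finite_regular_coversD(1))

lemma pathin_Xhat_coord: "pathin XH w \<Longrightarrow> i \<in> I \<Longrightarrow> pathin (tot i) (\<lambda>t. w t i)"
  using pathin_compose[OF _ continuous_Xhat_coord] by (fastforce simp: o_def)

text \<open>Lift in every coordinate. A bonding map takes the lift in one covering to a lift of the
  same path in the other, so unique lifting makes the coordinates compatible.\<close>

lemma Xhat_lift_exists:
  assumes y: "y \<in> topspace XH" and \<alpha>: "pathin X \<alpha>" "\<alpha> 0 = ph y"
  shows "\<exists>w. pathin XH w \<and> w 0 = y \<and> (\<forall>t\<in>{0..1}. ph (w t) = \<alpha> t)"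
proof -
  have "\<exists>\<eta>. pathin (tot i) \<eta> \<and> \<eta> 0 = y i \<and> (\<forall>t\<in>{0..1}. prj i (\<eta> t) = \<alpha> t)" if i: "i \<in> I" for i
    using path_lifting.lift_exists[OF coord_path_lifting[OF i] Xhat_coord[OF y i] \<alpha>(1)] \<alpha>(2) phat_coord[OF y i] by simp
  then obtain \<eta> where \<eta>: "\<And>i. i \<in> I \<Longrightarrow> pathin (tot i) (\<eta> i)" "\<And>i. i \<in> I \<Longrightarrow> \<eta> i 0 = y i"
      "\<And>i t. i \<in> I \<Longrightarrow> t \<in> {0..1} \<Longrightarrow> prj i (\<eta> i t) = \<alpha> t"
    by metis
  let ?w = "\<lambda>t. \<lambda>i\<in>I. \<eta> i t"
  have w0: "?w 0 = y"
    using \<eta>(2) y unfolding topspace_Xhat by (intro extensionalityI[of _ I]) (auto simp: PiE_def)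
  have prodw: "pathin (product_topology fst I) ?w"
    unfolding pathin_def continuous_map_componentwise
    using \<eta>(1) by (auto simp: pathin_def intro!: continuous_map_eq)
  have mor: "f (\<eta> i t) = \<eta> j t" if ij: "i \<in> I" "j \<in> I" and f: "cover_morphism i j f" and t: "t \<in> {0..1}" for i j f t
  proof -
    have fc: "continuous_map (tot i) (tot j) f" "\<And>z. z \<in> topspace (tot i) \<Longrightarrow> prj j (f z) = prj i z"
      using f by (cases i; cases j; simp)+
    have "f (y i) = y j" using y ij f unfolding topspace_Xhat by blast
    then have "(f \<circ> \<eta> i) 0 = \<eta> j 0" using \<eta>(2) ij by simp
    have "(f \<circ> \<eta> i) t = \<eta> j t"
    proof (rule unique_path_liftingD[OF path_lifting.lift_unique[OF coord_path_lifting[OF ij(2)]] pathin_compose[OF \<eta>(1)[OF ij(1)] fc(1)] \<eta>(1)[OF ij(2)]])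
      show "prj j ((f \<circ> \<eta> i) s) = prj j (\<eta> j s)" if s: "s \<in> {0..1}" for s
        using fc(2)[OF pathin_in[OF \<eta>(1)[OF ij(1)] s]] \<eta>(3)[OF ij(1) s] \<eta>(3)[OF ij(2) s] by simp
    qed fact+
    then show ?thesis by simp
  qed
  have w: "pathin XH ?w"
    unfolding Xhat_def pathin_subtopology using prodw mor by simp
  moreover have "ph (?w t) = \<alpha> t" if t: "t \<in> {0..1}" for t
    using phat_coord[OF pathin_in[OF w t] one_in] \<eta>(3)[OF one_in t] one_in by simp
  ultimately show ?thesis using w0 by (intro exI[of _ ?w]) simp
qed

lemma Xhat_path_lifting: "path_lifting XH X ph"
proof
  show "continuous_map XH X ph"
  proof (rule continuous_map_eq)
    show "continuous_map XH X (prj (one_sheeted X x0) \<circ> (\<lambda>y. y (one_sheeted X x0)))"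
      using continuous_Xhat_coord[OF one_in] path_lifting.continuous_proj[OF coord_path_lifting[OF one_in]]
      by (rule continuous_map_compose)
  qed (use phat_coord[OF _ one_in] in simp)
  show "unique_path_lifting XH ph"
    unfolding unique_path_lifting_def
  proof (intro allI impI ballI, elim conjE)
    fix w w' t
    assume *: "pathin XH w" "pathin XH w'" "w 0 = w' 0" "\<forall>t\<in>{0..1}. ph (w t) = ph (w' t)" "t \<in> {0..1::real}"
    show "w t = w' t"
    proof (rule Xhat_ext[OF pathin_in[OF *(1,5)] pathin_in[OF *(2,5)]])
      fix i assume i: "i \<in> I"
      show "w t i = w' t i"
      proof (rule unique_path_liftingD[OF path_lifting.lift_unique[OF coord_path_lifting[OF i]]
            pathin_Xhat_coord[OF *(1) i] pathin_Xhat_coord[OF *(2) i]])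
        show "prj i (w s i) = prj i (w' s i)" if "s \<in> {0..1}" for s
          using *(4) that phat_coord[OF pathin_in[OF *(1) that] i] phat_coord[OF pathin_in[OF *(2) that] i] by simp
      qed (use * in simp_all)
    qed
  qed
  fix \<alpha> \<beta> w w'
  assume h: "path_homotopic X \<alpha> \<beta>" and w: "pathin XH w" "pathin XH w'" "w 0 = w' 0"
    "\<And>t. t \<in> {0..1} \<Longrightarrow> ph (w t) = \<alpha> t" "\<And>t. t \<in> {0..1} \<Longrightarrow> ph (w' t) = \<beta> t"
  show "w 1 = w' 1"
  proof (rule Xhat_ext[OF path_finish_in_topspace[OF w(1)] path_finish_in_topspace[OF w(2)]])
    fix i assume i: "i \<in> I"
    show "w 1 i = w' 1 i"
    proof (rule path_lifting.lift_homotopic[OF coord_path_lifting[OF i] h pathin_Xhat_coord[OF w(1) i] pathin_Xhat_coord[OF w(2) i]])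
      show "prj i (w s i) = \<alpha> s" if "s \<in> {0..1}" for s
        using w(4)[OF that] phat_coord[OF pathin_in[OF w(1) that] i] by simp
      show "prj i (w' s i) = \<beta> s" if "s \<in> {0..1}" for s
        using w(5)[OF that] phat_coord[OF pathin_in[OF w(2) that] i] by simp
    qed (use w(3) in simp)
  qed
qed (rule Xhat_lift_exists)

sublocale XL: path_lifting XH X ph by (rule Xhat_path_lifting)

lemma lift_end_Xhat_coord:
  assumes y: "y \<in> topspace XH" and \<alpha>: "pathin X \<alpha>" "\<alpha> 0 = ph y" and i: "i \<in> I"
  shows "lift_end XH ph y \<alpha> i = clift i (y i) \<alpha>"
proof -
  obtain w where w: "pathin XH w" "w 0 = y" "w 1 = lift_end XH ph y \<alpha>" "\<And>t. t \<in> {0..1} \<Longrightarrow> ph (w t) = \<alpha> t"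
    using XL.lift_endE[OF y \<alpha>] by metis
  have "clift i (y i) \<alpha> = w 1 i"
    by (rule path_lifting.lift_end_eq[OF coord_path_lifting[OF i] pathin_Xhat_coord[OF w(1) i]])
       (use w(2,4) phat_coord[OF pathin_in[OF w(1)] i] in simp_all)
  then show ?thesis using w(3) by simp
qed

text \<open>A basic open set restricts only finitely many coordinates, and in each of these covering
  sheets keep short lifts inside; the finitely many neighbourhoods are intersected.\<close>

lemma Xhat_transport_small:
  assumes T: "openin XH T" "y \<in> T"
  obtains V where "openin X V" "ph y \<in> V"
    "\<And>\<delta>. path_within X V \<delta> \<Longrightarrow> \<delta> 0 = ph y \<Longrightarrow> lift_end XH ph y \<delta> \<in> T"
proof -
  have y: "y \<in> topspace XH" using openin_subset[OF T(1)] T(2) by blast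
  let ?R = "{y. \<forall>i\<in>I. \<forall>j\<in>I. \<forall>f. cover_morphism i j f \<longrightarrow> f (y i) = y j}"
  obtain T' where T': "openin (product_topology fst I) T'" "T = T' \<inter> ?R"
    using T(1) unfolding Xhat_def openin_subtopology by blast
  then have "y \<in> T'" using T(2) by blast
  then have "\<exists>U. finite {i \<in> I. U i \<noteq> topspace (tot i)} \<and> (\<forall>i\<in>I. openin (tot i) (U i)) \<and>
      y \<in> Pi\<^sub>E I U \<and> Pi\<^sub>E I U \<subseteq> T'"
    using T'(1)[unfolded openin_product_topology_alt] by (rule bspec[rotated])
  then obtain U where U: "finite {i \<in> I. U i \<noteq> topspace (tot i)}" "\<forall>i\<in>I. openin (tot i) (U i)"
      "y \<in> Pi\<^sub>E I U" "Pi\<^sub>E I U \<subseteq> T'"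
    by (elim exE conjE) (rule that)
  let ?J = "{i \<in> I. U i \<noteq> topspace (tot i)}"
  have "\<exists>V. openin X V \<and> ph y \<in> V \<and> (\<forall>V'. openin X V' \<longrightarrow> V' \<subseteq> V \<longrightarrow> ph y \<in> V' \<longrightarrow>
      (\<forall>\<delta>. path_within X V' \<delta> \<longrightarrow> \<delta> 0 = ph y \<longrightarrow> clift i (y i) \<delta> \<in> U i))" if i: "i \<in> I" for i
  proof -
    have yi: "y i \<in> U i" using U(3) i by blast
    show ?thesis
    proof (rule covering_small_sheets[OF finite_regular_coversD(1)[OF i] bspec[OF U(2) i] yi])
      fix V0 assume V0: "openin X V0" "prj i (y i) \<in> V0"
      "\<And>V. openin X V \<Longrightarrow> V \<subseteq> V0 \<Longrightarrow> prj i (y i) \<in> V \<Longrightarrow> small_sheet (tot i) X (prj i) (y i) (U i) V"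
      show ?thesis
        unfolding phat_coord[OF y i]
      proof (intro exI[of _ V0] conjI allI impI V0(1,2))
        fix V' \<delta> assume *: "openin X V'" "V' \<subseteq> V0" "prj i (y i) \<in> V'" "path_within X V' \<delta>" "\<delta> 0 = prj i (y i)"
        obtain S where S: "S \<subseteq> U i"
            "\<forall>\<delta>. path_within X V' \<delta> \<and> \<delta> 0 = prj i (y i) \<longrightarrow> clift i (y i) \<delta> \<in> S"
          using V0(3)[OF *(1-3)] unfolding small_sheet_def by (elim exE conjE) (rule that)
        then show "clift i (y i) \<delta> \<in> U i" using *(4,5) by (intro subsetD[OF S(1)]) simp
      qed
    qed
  qed
  then obtain V where V: "\<And>i. i \<in> I \<Longrightarrow> openin X (V i)" "\<And>i. i \<in> I \<Longrightarrow> ph y \<in> V i"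
    "\<And>i V' \<delta>. i \<in> I \<Longrightarrow> openin X V' \<Longrightarrow> V' \<subseteq> V i \<Longrightarrow> ph y \<in> V' \<Longrightarrow>
      path_within X V' \<delta> \<Longrightarrow> \<delta> 0 = ph y \<Longrightarrow> clift i (y i) \<delta> \<in> U i"
    by metis
  \<comment> \<open>The intersection with \<open>topspace X\<close> covers the case in which no
    coordinate is restricted.\<close>
  let ?V = "(\<Inter>i\<in>?J. V i) \<inter> topspace X"
  have oV: "openin X ?V" using V(1) by (intro openin_INT U(1)) simp
  have phX: "ph y \<in> topspace X"
    using XL.continuous_proj y by (auto simp: continuous_map_def Pi_iff)
  have phV: "ph y \<in> ?V" using V(2) phX by simp
  show ?thesis
  proof (rule that[OF oV phV])
    fix \<delta> assume \<delta>: "path_within X ?V \<delta>" "\<delta> 0 = ph y"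
    have p: "pathin X \<delta>" using \<delta>(1) by (simp add: pathin_subtopology)
    let ?z = "lift_end XH ph y \<delta>"
    have z: "?z \<in> topspace XH" using XL.lift_end_in[OF y p \<delta>(2)] by blast
    have "?z i \<in> U i" if i: "i \<in> I" for i
    proof (cases "U i = topspace (tot i)")
      case True
      then show ?thesis using Xhat_coord[OF z i] by simp
    next
      case False
      then have "?V \<subseteq> V i" using i by blast
      then show ?thesis
        using V(3)[OF i oV _ phV \<delta>] lift_end_Xhat_coord[OF y p \<delta>(2) i] by simp
    qed
    moreover have "?z \<in> extensional I" using z unfolding topspace_Xhat by (auto simp: PiE_def)
    ultimately have "?z \<in> Pi\<^sub>E I U" by (simp add: PiE_def)
    moreover have "?z \<in> ?R" using z unfolding topspace_Xhat by blast
    ultimately show "?z \<in> T" using U(4) T'(2) by blast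
  qed
qed

end

section \<open>Joint continuity of the action on the fibre\<close>

lemma finite_Union_interior_nonempty:
  assumes "finite \<K>" "\<And>K. K \<in> \<K> \<Longrightarrow> closedin F K" "F interior_of (\<Union>\<K>) \<noteq> {}"
  obtains K where "K \<in> \<K>" "F interior_of K \<noteq> {}"
proof -
  have "\<exists>K\<in>\<K>. F interior_of K \<noteq> {}"
    using assms
  proof (induct \<K>)
    case (insert K \<K>)
    have "closedin F K" using insert(4) by simp
    moreover have "closedin F (\<Union>\<K>)" using insert(1,4) by (intro closedin_Union) auto
    ultimately have "F interior_of K \<noteq> {} \<or> F interior_of (\<Union>\<K>) \<noteq> {}"
      using insert(5) interior_of_union_eq_empty[of F K "\<Union>\<K>"] by auto
    then show ?case using insert(3,4) by auto
  qed simp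
  then show ?thesis using that by blast
qed

lemma pi1_inv:
  assumes "x0 \<in> topspace X" "pathin X \<gamma>" "\<gamma> 0 = x0" "\<gamma> 1 = x0"
  shows "inv\<^bsub>pi1 X x0\<^esub> (path_class X \<gamma>) = path_class X (path_rev \<gamma>)"
proof -
  interpret group "pi1 X x0" by (rule group_pi1[OF assms(1)])
  show ?thesis
  proof (rule inv_equality)
    show "path_class X (path_rev \<gamma>) \<otimes>\<^bsub>pi1 X x0\<^esub> path_class X \<gamma> = \<one>\<^bsub>pi1 X x0\<^esub>"
      unfolding pi1_one using assms by (subst pi1_mult) (auto intro!: path_class_eqI path_homotopic_linv)
    show "path_class X \<gamma> \<in> carrier (pi1 X x0)" "path_class X (path_rev \<gamma>) \<in> carrier (pi1 X x0)"
      unfolding pi1_carrier using assms pathin_rev path_rev_ends by metis+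
  qed
qed

lemma finite_index_normal_carrier:
  assumes "group G"
  shows "finite_index_normal G (carrier G)"
proof -
  interpret group G by fact
  have "carrier G \<lhd> G" using normal_inv_iff subgroup_self by simp
  moreover have "rcosets\<^bsub>G\<^esub> (carrier G) \<subseteq> {carrier G}"
    unfolding RCOSETS_def using coset_join2 subgroup_self by auto
  ultimately show ?thesis unfolding finite_index_normal_def using finite_subset by blast
qed

definition loop_at :: "'a topology \<Rightarrow> 'a \<Rightarrow> (real \<Rightarrow> 'a) \<Rightarrow> bool" where
  "loop_at X x0 \<gamma> \<longleftrightarrow> pathin X \<gamma> \<and> \<gamma> 0 = x0 \<and> \<gamma> 1 = x0"

lemma loop_at_class: "loop_at X x0 \<gamma> \<Longrightarrow> path_class X \<gamma> \<in> carrier (pi1 X x0)"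
  unfolding loop_at_def pi1_carrier by blast

lemma loop_at_concat [intro]: "loop_at X x0 \<gamma> \<Longrightarrow> loop_at X x0 \<gamma>' \<Longrightarrow> loop_at X x0 (path_concat \<gamma> \<gamma>')"
  and loop_at_rev [intro]: "loop_at X x0 \<gamma> \<Longrightarrow> loop_at X x0 (path_rev \<gamma>)"
  unfolding loop_at_def by (simp_all add: pathin_concat pathin_rev)

locale profinite_projection =
  fixes E :: "'b topology" and X :: "'a topology" and p :: "'b \<Rightarrow> 'a" and x0 :: 'a
  assumes lp: "lifting_projection E X p"
    and X: "locally_path_connected_space X" "locally_categorical X" "x0 \<in> topspace X"
    and reg: "regular_projection E p"
    and prof: "pi1_profinite E X p x0"
    and F_regular: "regular_space (fibre E p x0)"
    and dense: "dense_leaves E"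
begin

sublocale path_lifting E X p by (rule lifting_projection_path_lifting[OF lp])

sublocale G: group "pi1 X x0" by (rule group_pi1[OF X(3)])

abbreviation "F \<equiv> fibre E p x0"
abbreviation "lift \<equiv> lift_end E p"
abbreviation "G \<equiv> pi1 X x0"

lemma lift_loop: "e \<in> topspace F \<Longrightarrow> loop_at X x0 \<gamma> \<Longrightarrow> lift e \<gamma> \<in> topspace F"
  using lift_end_in[of e \<gamma>] by (simp add: loop_at_def)

lemma continuous_lift_loop: "loop_at X x0 \<gamma> \<Longrightarrow> continuous_map F F (\<lambda>e. lift e \<gamma>)"
  using continuous_map_fibre_transport[OF lp, of \<gamma>] by (simp add: loop_at_def)

text \<open>\<open>pi1_profinite\<close> provides continuity of the orbit map at some base point
  \<open>e0\<close>. A deck transformation takes \<open>e0\<close> to \<open>u\<close> and commutes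
  with lifting.\<close>

lemma loop_class_small:
  assumes u: "u \<in> topspace F" and W: "openin F W" "u \<in> W"
  obtains N where "finite_index_normal G N" "\<And>\<gamma>. loop_at X x0 \<gamma> \<Longrightarrow> path_class X \<gamma> \<in> N \<Longrightarrow> lift u \<gamma> \<in> W"
proof -
  obtain e0 where e0: "e0 \<in> topspace F" and \<theta>: "continuous_map (profinite_topology G) F (lift_end_class E p e0)"
    using prof unfolding pi1_profinite_def by (elim bexE) (rule that)
  obtain \<phi> where \<phi>: "\<phi> \<in> deck_transformations E p" "\<phi> e0 = u"
    using reg u e0 unfolding regular_projection_def by auto
  have "continuous_map F F \<phi>"
    using \<phi>(1) unfolding deck_transformations_def fibre_def
    by (auto simp: continuous_map_in_subtopology intro: continuous_map_from_subtopology homeomorphic_imp_continuous_map)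
  then have "openin F {e \<in> topspace F. \<phi> e \<in> W}" (is "openin F ?W") using W(1) by (rule openin_continuous_map_preimage)
  then have "openin (profinite_topology G) {c \<in> topspace (profinite_topology G). lift_end_class E p e0 c \<in> ?W}"
    using \<theta> by (intro openin_continuous_map_preimage)
  moreover have "\<one>\<^bsub>G\<^esub> \<in> {c \<in> topspace (profinite_topology G). lift_end_class E p e0 c \<in> ?W}"
  proof -
    \<comment> \<open>The topspace is the union of the open sets, so the neutral element gets into
      it by way of the open set \<open>carrier G\<close>.\<close>
    have "openin (profinite_topology G) (carrier G)"
      unfolding openin_profinite_topology
    proof (intro conjI ballI)
      fix g assume "g \<in> carrier G"
      then have "g <#\<^bsub>G\<^esub> carrier G \<subseteq> carrier G" by (auto simp: l_coset_def)
      then show "\<exists>N. finite_index_normal G N \<and> g <#\<^bsub>G\<^esub> N \<subseteq> carrier G"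
        using finite_index_normal_carrier[OF G.group_axioms] by blast
    qed simp
    then have "\<one>\<^bsub>G\<^esub> \<in> topspace (profinite_topology G)" using openin_subset G.one_closed by blast
    moreover have "lift_end_class E p e0 \<one>\<^bsub>G\<^esub> = e0"
    proof -
      have e0': "e0 \<in> topspace E" "p e0 = x0" using e0 by simp_all
      have "lift_end_class E p e0 (path_class X (\<lambda>_. x0)) = lift e0 (\<lambda>_. x0)"
        by (rule lift_end_class_path) (use e0' X(3) in simp_all)
      also have "\<dots> = e0" using lift_end_const[OF e0'(1)] unfolding e0'(2) .
      finally show ?thesis unfolding pi1_one .
    qed
    ultimately show ?thesis using e0 \<phi>(2) W(2) by simp
  qed
  ultimately obtain N where N: "finite_index_normal G N"
      "\<one>\<^bsub>G\<^esub> <#\<^bsub>G\<^esub> N \<subseteq> {c \<in> topspace (profinite_topology G). lift_end_class E p e0 c \<in> ?W}"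
    unfolding openin_profinite_topology by blast
  show ?thesis
  proof (rule that[OF N(1)])
    fix \<gamma> assume \<gamma>: "loop_at X x0 \<gamma>" "path_class X \<gamma> \<in> N"
    have "\<one>\<^bsub>G\<^esub> \<otimes>\<^bsub>G\<^esub> path_class X \<gamma> \<in> \<one>\<^bsub>G\<^esub> <#\<^bsub>G\<^esub> N" using \<gamma>(2) by (auto simp: l_coset_def)
    then have "path_class X \<gamma> \<in> \<one>\<^bsub>G\<^esub> <#\<^bsub>G\<^esub> N" using loop_at_class[OF \<gamma>(1)] by simp
    then have "lift_end_class E p e0 (path_class X \<gamma>) \<in> ?W" using N(2) by blast
    then have "\<phi> (lift e0 \<gamma>) \<in> W"
      using lift_end_class_path[of e0 \<gamma>] e0 \<gamma>(1) by (simp add: loop_at_def)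
    then show "lift u \<gamma> \<in> W"
      using lift_end_deck[OF \<phi>(1), of e0 \<gamma>] e0 \<gamma>(1) \<phi>(2) by (simp add: loop_at_def)
  qed
qed

text \<open>Density of a leaf in \<open>E\<close> becomes density of an orbit in the fibre: short
  transports thicken \<open>A\<close> to an open set of \<open>E\<close>, a point of the leaf lies
  in it, and transporting that point back to the fibre closes its path to a loop.\<close>

lemma orbit_dense:
  assumes u: "u \<in> topspace F" and A: "openin F A" "a \<in> A"
  obtains \<gamma> where "loop_at X x0 \<gamma>" "lift u \<gamma> \<in> A"
proof -
  obtain U where U: "openin X U" "x0 \<in> U" "U \<subseteq> topspace X" "path_connectedin X U" "categorical X U"
    using locally_categoricalE[OF X(1,2) openin_topspace X(3)] by metis
  have a: "a \<in> topspace E" "p a = x0" using openin_subset[OF A(1)] A(2) by auto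
  define T where "T = {lift a \<delta> |a \<delta>. a \<in> A \<and> path_within X U \<delta> \<and> \<delta> 0 = x0}"
  have T: "openin E T" unfolding T_def by (rule openin_transport[OF lp U(1,5,4,2) A(1)])
  have "a = lift a (\<lambda>_. x0)" using lift_end_const[of a] a by simp
  then have "a \<in> T" using A(2) U(2) X(3) unfolding T_def by (intro CollectI exI[of _ a] exI[of _ "\<lambda>_. x0"]) simp
  moreover have "a \<in> E closure_of (path_component_of_set E u)"
    using dense u a unfolding dense_leaves_def by simp
  ultimately obtain y where y: "path_component_of E u y" "y \<in> T"
    using T unfolding in_closure_of by blast
  obtain a' \<delta> where \<delta>: "a' \<in> A" "path_within X U \<delta>" "\<delta> 0 = x0" "y = lift a' \<delta>"
    using y(2) unfolding T_def by blast
  have \<delta>X: "pathin X \<delta>" using \<delta>(2) by (simp add: pathin_subtopology)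
  have a': "a' \<in> topspace E" "p a' = x0" using openin_subset[OF A(1)] \<delta>(1) by auto
  obtain \<alpha> where \<alpha>: "pathin X \<alpha>" "\<alpha> 0 = p u" "\<alpha> 1 = p y" "y = lift u \<alpha>" using leafE[OF y(1)] by metis
  have py: "p y = \<delta> 1" using lift_end_in(2)[OF a'(1) \<delta>X] \<delta>(3,4) a' by simp
  have r: "pathin X (path_rev \<delta>)" using \<delta>X by blast
  have "lift u (path_concat \<alpha> (path_rev \<delta>)) = lift (lift u \<alpha>) (path_rev \<delta>)"
    by (rule lift_end_concat) (use u \<alpha> r py in simp_all)
  also have "\<dots> = lift (lift a' \<delta>) (path_rev \<delta>)" using \<alpha>(4) \<delta>(4) by simp
  also have "\<dots> = a'" by (rule lift_end_rev) (use a' \<delta>X \<delta>(3) in simp_all)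
  finally have "lift u (path_concat \<alpha> (path_rev \<delta>)) \<in> A" using \<delta>(1) by simp
  moreover have "loop_at X x0 (path_concat \<alpha> (path_rev \<delta>))"
    using \<alpha> r py u \<delta>(3) by (simp add: loop_at_def pathin_concat)
  ultimately show ?thesis using that by blast
qed

definition orb :: "'b \<Rightarrow> (real \<Rightarrow> 'a) set set \<Rightarrow> 'b set" where
  "orb u S = {lift u \<gamma> |\<gamma>. loop_at X x0 \<gamma> \<and> path_class X \<gamma> \<in> S}"

text \<open>Lifting along a loop is a continuous self-map of the fibre, so it maps the closure of an
  orbit into the closure of the translated orbit. With \<open>S = S' = N\<close> this says that the
  closure of an \<open>N\<close>-orbit is stable under \<open>N\<close>.\<close>

lemma orb_translate:
  assumes u: "u \<in> topspace F" and \<eta>: "loop_at X x0 \<eta>" and S: "\<And>c. c \<in> S \<Longrightarrow> c \<otimes>\<^bsub>G\<^esub> path_class X \<eta> \<in> S'"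
    and z: "z \<in> F closure_of (orb u S)"
  shows "lift z \<eta> \<in> F closure_of (orb u S')"
proof -
  have "(\<lambda>e. lift e \<eta>) ` orb u S \<subseteq> orb u S'"
  proof
    fix y assume "y \<in> (\<lambda>e. lift e \<eta>) ` orb u S"
    then obtain \<gamma> where \<gamma>: "loop_at X x0 \<gamma>" "path_class X \<gamma> \<in> S" "y = lift (lift u \<gamma>) \<eta>" unfolding orb_def by blast
    have "y = lift u (path_concat \<gamma> \<eta>)"
      unfolding \<gamma>(3) by (rule lift_end_concat[symmetric]) (use u \<gamma>(1) \<eta> in \<open>simp_all add: loop_at_def\<close>)
    moreover have "path_class X (path_concat \<gamma> \<eta>) \<in> S'"
      using S[OF \<gamma>(2)] pi1_mult[of X \<gamma> \<eta>] \<gamma>(1) \<eta> by (simp add: loop_at_def)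
    ultimately show "y \<in> orb u S'"
      unfolding orb_def using \<gamma>(1) \<eta> by blast
  qed
  then have "F closure_of ((\<lambda>e. lift e \<eta>) ` orb u S) \<subseteq> F closure_of (orb u S')" by (rule closure_of_mono)
  moreover have "(\<lambda>e. lift e \<eta>) ` (F closure_of (orb u S)) \<subseteq> F closure_of ((\<lambda>e. lift e \<eta>) ` orb u S)"
    by (rule continuous_map_image_closure_subset[OF continuous_lift_loop[OF \<eta>]])
  ultimately show ?thesis using z by blast
qed

text \<open>Finitely many translates of the closure of the \<open>N\<close>-orbit of \<open>u\<close> cover the fibre, so one of them, and
  hence each of them, has interior points.\<close>

lemma interior_orbit_closure:
  assumes u: "u \<in> topspace F" and N: "finite_index_normal G N"
  shows "u \<in> F interior_of (F closure_of (orb u N))"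
proof -
  interpret N: normal N G using N by (simp add: finite_index_normal_def)
  let ?K = "(\<lambda>C. F closure_of (orb u C)) ` (rcosets\<^bsub>G\<^esub> N)"
  have orb_sub: "orb u C \<subseteq> topspace F" for C
    unfolding orb_def using lift_loop[OF u] by blast
  have fin: "finite ?K" using N by (simp add: finite_index_normal_def)
  \<comment> \<open>The full orbit of \<open>u\<close> is distributed over the cosets and dense, so
    it would meet the open complement of this finite union of closed sets.\<close>
  have "topspace F \<subseteq> \<Union>?K"
  proof
    fix y assume y: "y \<in> topspace F"
    show "y \<in> \<Union>?K"
    proof (rule ccontr)
      assume "y \<notin> \<Union>?K"
      moreover have "closedin F (\<Union>?K)" using fin by (intro closedin_Union) auto
      ultimately have "openin F (topspace F - \<Union>?K)" "y \<in> topspace F - \<Union>?K"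
        using y by (simp_all only: openin_diff openin_topspace) (rule DiffI)
      then obtain \<gamma> where \<gamma>: "loop_at X x0 \<gamma>" "lift u \<gamma> \<in> topspace F - \<Union>?K" using orbit_dense[OF u] by metis
      let ?C = "N #>\<^bsub>G\<^esub> path_class X \<gamma>"
      have "?C \<in> rcosets\<^bsub>G\<^esub> N" using loop_at_class[OF \<gamma>(1)] N.subset by (intro G.rcosetsI)
      moreover have "path_class X \<gamma> \<in> ?C" by (rule G.rcos_self[OF loop_at_class[OF \<gamma>(1)] N.subgroup_axioms])
      then have "lift u \<gamma> \<in> orb u ?C" unfolding orb_def using \<gamma>(1) by blast
      then have "lift u \<gamma> \<in> F closure_of (orb u ?C)" using closure_of_subset[OF orb_sub] by blast
      ultimately show False using \<gamma>(2) by blast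
    qed
  qed
  then have "topspace F \<subseteq> F interior_of (\<Union>?K)"
    by (intro interior_of_maximal openin_topspace)
  then have "F interior_of (\<Union>?K) \<noteq> {}" using u by blast
  then obtain C where C: "C \<in> rcosets\<^bsub>G\<^esub> N" "F interior_of (F closure_of (orb u C)) \<noteq> {}"
    by (rule finite_Union_interior_nonempty[OF fin, rotated]) auto
  define J where "J = F interior_of (F closure_of (orb u C))"
  have J: "openin F J" "J \<subseteq> F closure_of (orb u C)"
    unfolding J_def by (rule openin_interior_of, rule interior_of_subset)
  obtain y where y: "y \<in> J" using C(2) unfolding J_def by blast
  then have "y \<in> F closure_of (orb u C)" using J(2) by blast
  then have "\<forall>T. y \<in> T \<and> openin F T \<longrightarrow> (\<exists>z. z \<in> orb u C \<and> z \<in> T)"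
    unfolding in_closure_of[of y] by (rule conjunct2)
  \<comment> \<open>The interior \<open>J\<close> of the orbit closure contains a genuine orbit
    point \<open>lift u \<gamma>\<close>; moving \<open>J\<close> back along \<gamma> then produces
    a neighbourhood of \<open>u\<close> itself.\<close>
  then have "\<exists>z. z \<in> orb u C \<and> z \<in> J" using y J(1) by blast
  then obtain \<gamma> where \<gamma>: "loop_at X x0 \<gamma>" "path_class X \<gamma> \<in> C" "lift u \<gamma> \<in> J"
    unfolding orb_def by blast
  let ?g = "path_class X \<gamma>" and ?A = "{e \<in> topspace F. lift e \<gamma> \<in> J}"
  have g: "?g \<in> carrier G" by (rule loop_at_class[OF \<gamma>(1)])
  obtain h where h: "h \<in> carrier G" "C = N #>\<^bsub>G\<^esub> h" using C(1) unfolding RCOSETS_def by blast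
  obtain n where n: "n \<in> N" "?g = n \<otimes>\<^bsub>G\<^esub> h" using \<gamma>(2) unfolding h(2) r_coset_def by blast
  \<comment> \<open>The coset \<open>C\<close> contains the class of \<gamma>, so dividing by that
    class on the right maps \<open>C\<close> into \<open>N\<close>.\<close>
  have coset: "c \<otimes>\<^bsub>G\<^esub> path_class X (path_rev \<gamma>) \<in> N" if c: "c \<in> C" for c
  proof -
    obtain m where m: "m \<in> N" "c = m \<otimes>\<^bsub>G\<^esub> h" using c unfolding h(2) r_coset_def by (elim UN_E singletonE)
    have mn: "m \<in> carrier G" "n \<in> carrier G" using m(1) n(1) N.subset by blast+
    have "path_class X (path_rev \<gamma>) = inv\<^bsub>G\<^esub> ?g"
      using pi1_inv[OF X(3), of \<gamma>] \<gamma>(1) by (simp add: loop_at_def)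
    then have "path_class X (path_rev \<gamma>) = inv\<^bsub>G\<^esub> h \<otimes>\<^bsub>G\<^esub> inv\<^bsub>G\<^esub> n"
      unfolding n(2) using mn h(1) by (simp add: G.inv_mult_group)
    moreover have "h \<otimes>\<^bsub>G\<^esub> (inv\<^bsub>G\<^esub> h \<otimes>\<^bsub>G\<^esub> inv\<^bsub>G\<^esub> n) = inv\<^bsub>G\<^esub> n"
      using mn h(1) by (simp flip: G.m_assoc)
    ultimately have "c \<otimes>\<^bsub>G\<^esub> path_class X (path_rev \<gamma>) = m \<otimes>\<^bsub>G\<^esub> inv\<^bsub>G\<^esub> n"
      using m(2) mn h(1) by (simp add: G.m_assoc)
    then show ?thesis using m(1) n(1) by simp
  qed
  have "openin F ?A"
    by (rule openin_continuous_map_preimage[OF continuous_lift_loop[OF \<gamma>(1)] J(1)])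
  moreover have "u \<in> ?A" using u \<gamma>(3) by simp
  moreover have "?A \<subseteq> F closure_of (orb u N)"
  proof
    fix e assume "e \<in> ?A"
    then have e: "e \<in> topspace F" "lift e \<gamma> \<in> J" by blast+
    then have e': "lift e \<gamma> \<in> F closure_of (orb u C)" using J(2) by blast
    have "lift (lift e \<gamma>) (path_rev \<gamma>) \<in> F closure_of (orb u N)"
      by (rule orb_translate[OF u loop_at_rev[OF \<gamma>(1)] coset e'])
    moreover have "lift (lift e \<gamma>) (path_rev \<gamma>) = e"
      by (rule lift_end_rev) (use e(1) \<gamma>(1) in \<open>simp_all add: loop_at_def\<close>)
    ultimately show "e \<in> F closure_of (orb u N)" by simp
  qed
  ultimately show ?thesis by (intro subsetD[OF interior_of_maximal])
qed

text \<open>Continuity at \<open>u\<close> alone puts the \<open>N\<close>-orbit of \<open>u\<close>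
  into a small set, and regularity of the fibre keeps its closure inside \<open>B\<close>. This
  closure is a neighbourhood of \<open>u\<close> and stable under \<open>N\<close>, so its interior
  serves as \<open>A\<close>.\<close>

lemma action_jointly_continuous:
  assumes u: "u \<in> topspace F" and B: "openin F B" "u \<in> B"
  obtains A N where "openin F A" "u \<in> A" "finite_index_normal G N"
    "\<And>a \<gamma>. a \<in> A \<Longrightarrow> loop_at X x0 \<gamma> \<Longrightarrow> path_class X \<gamma> \<in> N \<Longrightarrow> lift a \<gamma> \<in> B"
proof -
  obtain W K where W: "openin F W" "closedin F K" "u \<in> W" "W \<subseteq> K" "K \<subseteq> B"
    using F_regular B unfolding neighbourhood_base_of_closedin[symmetric] neighbourhood_base_of by metis
  obtain N where N: "finite_index_normal G N" "\<And>\<gamma>. loop_at X x0 \<gamma> \<Longrightarrow> path_class X \<gamma> \<in> N \<Longrightarrow> lift u \<gamma> \<in> W"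
    using loop_class_small[OF u W(1,3)] by metis
  interpret N: normal N G using N by (simp add: finite_index_normal_def)
  have "orb u N \<subseteq> K" unfolding orb_def using N(2) W(4) by blast
  then have sub: "F closure_of (orb u N) \<subseteq> B" using W(2,5) closure_of_minimal by blast
  show ?thesis
  proof (rule that[OF _ interior_orbit_closure[OF u N(1)] N(1)])
    fix a \<gamma> assume a: "a \<in> F interior_of (F closure_of (orb u N))" and \<gamma>: "loop_at X x0 \<gamma>" "path_class X \<gamma> \<in> N"
    have "a \<in> F closure_of (orb u N)" by (rule subsetD[OF interior_of_subset a])
    from orb_translate[OF u \<gamma>(1) _ this, of N] \<gamma>(2) show "lift a \<gamma> \<in> B" using sub N.m_closed by blast
  qed simp
qed

end

section \<open>The Borel construction\<close>

locale borel_construction = profinite_projection E X p x0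
  for E :: "'b topology" and X :: "'a topology" and p :: "'b \<Rightarrow> 'a" and x0 :: 'a +
  fixes xhat0 :: "'a pointed_cover \<Rightarrow> 'a \<times> nat"
  assumes path_connected_X: "path_connected_space X"
    and residual: "residually_finite (pi1 X x0)"
    and xhat0: "xhat0 \<in> topspace (Xhat X x0)" "phat X x0 xhat0 = x0"
begin

sublocale universal_limit X x0
  by standard (rule path_connected_X, rule X(3))

abbreviation "liftX \<equiv> lift_end XH ph xhat0"
abbreviation "L \<equiv> leafL X x0 xhat0"
abbreviation "\<Phi> \<equiv> Phi E X p x0 xhat0"

abbreviation "rel \<equiv> borel_rel E X p x0 xhat0"
abbreviation "\<Psi> \<equiv> Phibar E X p x0 xhat0"
abbreviation "act \<equiv> pi1_act_L X x0 xhat0"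

definition from_base :: "(real \<Rightarrow> 'a) \<Rightarrow> bool" where
  "from_base \<alpha> \<longleftrightarrow> pathin X \<alpha> \<and> \<alpha> 0 = x0"

lemma from_base_concat: "from_base \<alpha> \<Longrightarrow> pathin X \<beta> \<Longrightarrow> \<alpha> 1 = \<beta> 0 \<Longrightarrow> from_base (path_concat \<alpha> \<beta>)"
  by (simp add: from_base_def pathin_concat)

lemma loop_from_base: "loop_at X x0 \<gamma> \<Longrightarrow> from_base \<gamma>"
  by (simp add: from_base_def loop_at_def)

lemma liftX_in:
  assumes "from_base \<alpha>"
  shows "liftX \<alpha> \<in> topspace XH" "ph (liftX \<alpha>) = \<alpha> 1" "liftX \<alpha> \<in> topspace L"
proof -
  show *: "liftX \<alpha> \<in> topspace XH" "ph (liftX \<alpha>) = \<alpha> 1"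
    using XL.lift_end_in[of xhat0 \<alpha>] assms xhat0 by (simp_all add: from_base_def)
  have "path_component_of XH xhat0 (liftX \<alpha>)"
    by (rule XL.lift_end_in_leaf) (use assms xhat0 in \<open>simp_all add: from_base_def\<close>)
  then show "liftX \<alpha> \<in> topspace L" using *(1) by (simp add: leafL_def)
qed

lemma leafLE:
  assumes "y \<in> topspace L"
  obtains \<alpha> where "from_base \<alpha>" "liftX \<alpha> = y"
proof -
  have "path_component_of XH xhat0 y" using assms by (simp add: leafL_def)
  then obtain \<alpha> where "pathin X \<alpha>" "\<alpha> 0 = ph xhat0" "y = liftX \<alpha>" by (rule XL.leafE)
  then show ?thesis using that[of \<alpha>] xhat0(2) by (simp add: from_base_def)
qed

lemma liftX_concat:
  assumes "from_base \<alpha>" "pathin X \<beta>" "\<beta> 0 = \<alpha> 1"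
  shows "liftX (path_concat \<alpha> \<beta>) = lift_end XH ph (liftX \<alpha>) \<beta>"
  by (rule XL.lift_end_concat) (use assms xhat0 in \<open>simp_all add: from_base_def\<close>)

lemma liftX_homotopic: "from_base \<alpha> \<Longrightarrow> path_homotopic X \<alpha> \<beta> \<Longrightarrow> liftX \<alpha> = liftX \<beta>"
  by (rule XL.lift_end_homotopic) (use xhat0 in \<open>simp_all add: from_base_def\<close>)

lemma lift_homotopic_base: "u \<in> topspace F \<Longrightarrow> from_base \<alpha> \<Longrightarrow> path_homotopic X \<alpha> \<beta> \<Longrightarrow> lift u \<alpha> = lift u \<beta>"
  by (rule lift_end_homotopic) (simp_all add: from_base_def)

lemma lift_concat_base:
  assumes "u \<in> topspace F" "from_base \<alpha>" "pathin X \<beta>" "\<beta> 0 = \<alpha> 1"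
  shows "lift u (path_concat \<alpha> \<beta>) = lift (lift u \<alpha>) \<beta>"
  by (rule lift_end_concat) (use assms in \<open>simp_all add: from_base_def\<close>)

lemma lift_in_base:
  assumes "u \<in> topspace F" "from_base \<alpha>"
  shows "lift u \<alpha> \<in> topspace E" "p (lift u \<alpha>) = \<alpha> 1"
  using lift_end_in[of u \<alpha>] assms by (simp_all add: from_base_def)

text \<open>Residual finiteness enters only here.\<close>

lemma liftX_eq_imp_homotopic:
  assumes \<alpha>: "from_base \<alpha>" and \<beta>: "from_base \<beta>" and eq: "liftX \<alpha> = liftX \<beta>"
  shows "path_homotopic X \<alpha> \<beta>"
proof -
  have e: "\<alpha> 1 = \<beta> 1" using liftX_in(2)[OF \<alpha>] liftX_in(2)[OF \<beta>] eq by simp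
  have p: "pathin X \<alpha>" "pathin X \<beta>" "pathin X (path_rev \<beta>)" and 0: "\<alpha> 0 = x0" "\<beta> 0 = x0"
    using \<alpha> \<beta> by (auto simp: from_base_def)
  let ?\<gamma> = "path_concat \<alpha> (path_rev \<beta>)"
  have \<gamma>: "loop_at X x0 ?\<gamma>" using p 0 e by (simp add: loop_at_def pathin_concat)
  have "liftX ?\<gamma> = lift_end XH ph (liftX \<beta>) (path_rev \<beta>)"
    using liftX_concat[OF \<alpha> p(3)] e eq by simp
  also have "\<dots> = xhat0" by (rule XL.lift_end_rev) (use xhat0 p 0 in simp_all)
  finally have closed: "liftX ?\<gamma> = xhat0" .
  \<comment> \<open>A loop whose lift to the limit closes also closes in the coordinate of the
    covering that detects \<open>N\<close>.\<close>
  have inN: "path_class X ?\<gamma> \<in> N" if N: "finite_index_normal G N" for N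
  proof -
    obtain i where i: "i \<in> I" "\<And>c \<gamma>. c \<in> topspace (tot i) \<Longrightarrow> prj i c = x0 \<Longrightarrow> pathin X \<gamma> \<Longrightarrow> \<gamma> 0 = x0 \<Longrightarrow> \<gamma> 1 = x0 \<Longrightarrow>
      clift i c \<gamma> = c \<Longrightarrow> path_class X \<gamma> \<in> N"
      by (rule finite_index_normal_cover[OF path_connected_X X N]) (rule that)
    show ?thesis
    proof (rule i(2))
      show "xhat0 i \<in> topspace (tot i)" by (rule Xhat_coord[OF xhat0(1) i(1)])
      show "prj i (xhat0 i) = x0" using phat_coord[OF xhat0(1) i(1)] xhat0(2) by simp
      show "clift i (xhat0 i) ?\<gamma> = xhat0 i"
        using lift_end_Xhat_coord[OF xhat0(1), of ?\<gamma> i] \<gamma> xhat0(2) i(1) closed by (simp add: loop_at_def)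
    qed (use \<gamma> in \<open>simp_all add: loop_at_def\<close>)
  qed
  have "path_class X ?\<gamma> = \<one>\<^bsub>G\<^esub>"
    using residual loop_at_class[OF \<gamma>] inN unfolding residually_finite_def by blast
  then have null: "path_homotopic X ?\<gamma> (\<lambda>_. x0)"
    using path_class_eq_iff[of X ?\<gamma> "\<lambda>_. x0"] \<gamma> by (simp add: pi1_one loop_at_def)
  have "path_homotopic X \<alpha> (path_concat ?\<gamma> \<beta>)"
    by (rule path_homotopic_sym, rule path_homotopic_cancel_right[OF p(1,2) e])
  also have "path_homotopic X \<dots> (path_concat (\<lambda>_. x0) \<beta>)"
    by (intro path_homotopic_concat null) (use p 0 in simp_all)
  also have "path_homotopic X \<dots> \<beta>" by (rule path_homotopic_lid[OF p(2) 0(2)])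
  finally show ?thesis .
qed

text \<open>This is the independence of the path: two paths to the same point of \<open>L\<close>
  are homotopic and hence have lifts with the same end in \<open>E\<close>.\<close>

lemma Phi_eq:
  assumes u: "u \<in> topspace F" and \<alpha>: "from_base \<alpha>"
  shows "\<Phi> (u, liftX \<alpha>) = lift u \<alpha>"
  unfolding Phi_def prod.case
proof (rule the_equality)
  show "\<exists>\<beta>. pathin X \<beta> \<and> \<beta> 0 = x0 \<and> liftX \<beta> = liftX \<alpha> \<and> lift u \<alpha> = lift u \<beta>"
    using \<alpha> unfolding from_base_def by blast
  fix e assume "\<exists>\<beta>. pathin X \<beta> \<and> \<beta> 0 = x0 \<and> liftX \<beta> = liftX \<alpha> \<and> e = lift u \<beta>"
  then obtain \<beta> where \<beta>: "from_base \<beta>" "liftX \<beta> = liftX \<alpha>" "e = lift u \<beta>" unfolding from_base_def by blast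
  show "e = lift u \<alpha>"
    unfolding \<beta>(3) by (rule lift_homotopic_base[OF u \<beta>(1) liftX_eq_imp_homotopic[OF \<beta>(1) \<alpha> \<beta>(2)]])
qed

lemma pi1_act_L_eq:
  assumes \<gamma>: "loop_at X x0 \<gamma>" and \<beta>: "from_base \<beta>"
  shows "act (path_class X \<gamma>) (liftX \<beta>) = liftX (path_concat \<gamma> \<beta>)"
  unfolding pi1_act_L_def
proof (rule the_equality)
  have "\<gamma> \<in> path_class X \<gamma>" using \<gamma> by (simp add: in_path_class loop_at_def)
  then show "\<exists>\<gamma>'\<in>path_class X \<gamma>. \<exists>\<beta>'. pathin X \<beta>' \<and> \<beta>' 0 = x0 \<and> liftX \<beta>' = liftX \<beta> \<and>
      liftX (path_concat \<gamma> \<beta>) = liftX (path_concat \<gamma>' \<beta>')"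
    using \<beta> unfolding from_base_def by blast
  fix z assume "\<exists>\<gamma>'\<in>path_class X \<gamma>. \<exists>\<beta>'. pathin X \<beta>' \<and> \<beta>' 0 = x0 \<and> liftX \<beta>' = liftX \<beta> \<and> z = liftX (path_concat \<gamma>' \<beta>')"
  then obtain \<gamma>' \<beta>' where *: "path_homotopic X \<gamma> \<gamma>'" "from_base \<beta>'" "liftX \<beta>' = liftX \<beta>" "z = liftX (path_concat \<gamma>' \<beta>')"
    unfolding from_base_def in_path_class by (elim bexE exE conjE) (rule that, simp_all add: from_base_def in_path_class)
  have \<gamma>\<beta>: "pathin X \<gamma>" "\<gamma> 1 = \<beta> 0" "pathin X \<beta>" using \<gamma> \<beta> by (simp_all add: loop_at_def from_base_def)
  have "path_homotopic X \<beta> \<beta>'"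
    by (rule liftX_eq_imp_homotopic[OF \<beta> *(2)]) (use *(3) in simp)
  then have "path_homotopic X (path_concat \<gamma> \<beta>) (path_concat \<gamma>' \<beta>')"
    by (intro path_homotopic_concat *(1) \<gamma>\<beta>(2))
  then show "z = liftX (path_concat \<gamma> \<beta>)"
    unfolding *(4) using liftX_homotopic[OF from_base_concat[OF loop_from_base[OF \<gamma>] \<gamma>\<beta>(3,2)]] by simp
qed

text \<open>The generating pairs alone already form an equivalence relation, namely the kernel of
  \<open>\<Phi>\<close>. This is why the classes can be taken as images of singletons in the
  definition of the Borel space.\<close>

lemma borel_rel_iff:
  "(z, z') \<in> rel \<longleftrightarrow>
     z \<in> topspace F \<times> topspace L \<and> z' \<in> topspace F \<times> topspace L \<and> \<Phi> z = \<Phi> z'"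
proof
  assume "(z, z') \<in> rel"
  then obtain v c y where v: "v \<in> topspace F" "c \<in> carrier G" "y \<in> topspace L"
      and z: "z = (lift_end_class E p v c, y)" "z' = (v, act c y)"
    unfolding borel_rel_def by blast
  obtain \<gamma> where \<gamma>: "loop_at X x0 \<gamma>" "c = path_class X \<gamma>" using v(2) unfolding pi1_carrier loop_at_def by blast
  obtain \<beta> where \<beta>: "from_base \<beta>" "liftX \<beta> = y" using leafLE[OF v(3)] .
  have p: "pathin X \<beta>" "\<beta> 0 = \<gamma> 1" using \<beta>(1) \<gamma>(1) by (simp_all add: from_base_def loop_at_def)
  have fb: "from_base (path_concat \<gamma> \<beta>)" by (rule from_base_concat[OF loop_from_base[OF \<gamma>(1)] p(1)]) (use p in simp)
  have vc: "lift_end_class E p v c = lift v \<gamma>"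
    unfolding \<gamma>(2) by (rule lift_end_class_path) (use v(1) \<gamma>(1) in \<open>simp_all add: loop_at_def\<close>)
  have z: "z = (lift v \<gamma>, liftX \<beta>)" "z' = (v, liftX (path_concat \<gamma> \<beta>))"
    unfolding z vc \<beta>(2)[symmetric] unfolding \<gamma>(2) pi1_act_L_eq[OF \<gamma>(1) \<beta>(1)] by simp_all
  have "\<Phi> z = lift (lift v \<gamma>) \<beta>" unfolding z(1) by (rule Phi_eq[OF lift_loop[OF v(1) \<gamma>(1)] \<beta>(1)])
  also have "\<dots> = lift v (path_concat \<gamma> \<beta>)"
    using lift_concat_base[OF v(1) loop_from_base[OF \<gamma>(1)] p] by simp
  also have "\<dots> = \<Phi> z'" unfolding z(2) by (rule Phi_eq[OF v(1) fb, symmetric])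
  finally show "z \<in> topspace F \<times> topspace L \<and> z' \<in> topspace F \<times> topspace L \<and> \<Phi> z = \<Phi> z'"
    unfolding z using v(1) lift_loop[OF v(1) \<gamma>(1)] liftX_in(3)[OF \<beta>(1)] liftX_in(3)[OF fb] by blast
next
  assume zz: "z \<in> topspace F \<times> topspace L \<and> z' \<in> topspace F \<times> topspace L \<and> \<Phi> z = \<Phi> z'"
  then obtain u y u' y' where z: "z = (u, y)" "z' = (u', y')" "u \<in> topspace F" "u' \<in> topspace F"
      "y \<in> topspace L" "y' \<in> topspace L" by blast
  obtain \<alpha> where \<alpha>: "from_base \<alpha>" "liftX \<alpha> = y" using leafLE[OF z(5)] .
  obtain \<alpha>' where \<alpha>': "from_base \<alpha>'" "liftX \<alpha>' = y'" using leafLE[OF z(6)] .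
  have eq: "lift u \<alpha> = lift u' \<alpha>'"
    using zz Phi_eq[OF z(3) \<alpha>(1)] Phi_eq[OF z(4) \<alpha>'(1)] unfolding z(1,2) \<alpha>(2) \<alpha>'(2) by simp
  have e: "\<alpha>' 1 = \<alpha> 1" using lift_in_base(2)[OF z(3) \<alpha>(1)] lift_in_base(2)[OF z(4) \<alpha>'(1)] eq by simp
  have p: "pathin X \<alpha>" "pathin X \<alpha>'" "pathin X (path_rev \<alpha>)" and 0: "\<alpha> 0 = x0" "\<alpha>' 0 = x0"
    using \<alpha> \<alpha>' by (auto simp: from_base_def)
  \<comment> \<open>As both paths lead to the same point of \<open>E\<close>, this loop takes
    \<open>u'\<close> to \<open>u\<close> in the fibre and \<open>y\<close> to \<open>y'\<close> in
    \<open>L\<close>.\<close>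
  let ?\<gamma> = "path_concat \<alpha>' (path_rev \<alpha>)"
  have \<gamma>: "loop_at X x0 ?\<gamma>" using p 0 e by (simp add: loop_at_def pathin_concat)
  have "lift u' ?\<gamma> = lift (lift u \<alpha>) (path_rev \<alpha>)"
    using lift_concat_base[OF z(4) \<alpha>'(1) p(3)] e eq by simp
  also have "\<dots> = u" by (rule lift_end_rev) (use z(3) p 0 in simp_all)
  finally have u: "lift u' ?\<gamma> = u" .
  have 1: "u = lift_end_class E p u' (path_class X ?\<gamma>)"
    unfolding u[symmetric]
    by (rule lift_end_class_path[symmetric]) (use z(4) \<gamma> in \<open>simp_all add: loop_at_def\<close>)
  have "act (path_class X ?\<gamma>) y = liftX (path_concat ?\<gamma> \<alpha>)"
    unfolding \<alpha>(2)[symmetric] by (rule pi1_act_L_eq[OF \<gamma> \<alpha>(1)])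
  also have "\<dots> = liftX \<alpha>'"
    by (rule liftX_homotopic[OF from_base_concat[OF loop_from_base[OF \<gamma>] p(1)] path_homotopic_cancel_right[OF p(2,1) e]])
       (use 0 in simp)
  finally have 2: "y' = act (path_class X ?\<gamma>) y" unfolding \<alpha>'(2) by simp
  show "(z, z') \<in> rel"
    unfolding borel_rel_def z(1,2)
    using 1 2 z(4,5) loop_at_class[OF \<gamma>] by blast
qed

lemma borel_class:
  assumes "z \<in> topspace F \<times> topspace L"
  shows "rel `` {z} = {z' \<in> topspace F \<times> topspace L. \<Phi> z' = \<Phi> z}"
  unfolding Image_singleton borel_rel_iff using assms by auto

lemma Phibar_class:
  assumes "z \<in> topspace F \<times> topspace L"
  shows "\<Psi> (rel `` {z}) = \<Phi> z"
  unfolding Phibar_def borel_class[OF assms]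
  by (rule the_equality) (use assms in auto)

section \<open>The map \<Phi> is a continuous open surjection\<close>

lemma Phi_surj: "\<Phi> ` (topspace F \<times> topspace L) = topspace E"
proof
  show "\<Phi> ` (topspace F \<times> topspace L) \<subseteq> topspace E"
  proof
    fix e assume "e \<in> \<Phi> ` (topspace F \<times> topspace L)"
    then obtain u y where u: "u \<in> topspace F" "y \<in> topspace L" "e = \<Phi> (u, y)" by blast
    obtain \<alpha> where \<alpha>: "from_base \<alpha>" "liftX \<alpha> = y" using leafLE[OF u(2)] .
    show "e \<in> topspace E" unfolding u(3) \<alpha>(2)[symmetric] Phi_eq[OF u(1) \<alpha>(1)] by (rule lift_in_base(1)[OF u(1) \<alpha>(1)])
  qed
  show "topspace E \<subseteq> \<Phi> ` (topspace F \<times> topspace L)"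
  proof
    fix e assume e: "e \<in> topspace E"
    have "p e \<in> topspace X" using continuous_proj e by (auto simp: continuous_map_def Pi_iff)
    then obtain \<alpha> where a: "pathin X \<alpha>" "\<alpha> 0 = x0" "\<alpha> 1 = p e"
      using path_connected_X X(3) unfolding path_connected_space_def by blast
    have \<alpha>: "from_base \<alpha>" using a by (simp add: from_base_def)
    \<comment> \<open>Transporting \<open>e\<close> back along any path from the base point gives
      the first component of a preimage.\<close>
    let ?u = "lift e (path_rev \<alpha>)"
    have r: "pathin X (path_rev \<alpha>)" using a(1) by blast
    have u: "?u \<in> topspace F" using lift_end_in[OF e r] a by simp
    have "lift ?u (path_rev (path_rev \<alpha>)) = e"
      by (rule lift_end_rev) (use e r a in simp_all)
    then have "\<Phi> (?u, liftX \<alpha>) = e" using Phi_eq[OF u \<alpha>] by simp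
    then show "e \<in> \<Phi> ` (topspace F \<times> topspace L)" using u liftX_in(3)[OF \<alpha>] by (intro image_eqI[of _ _ "(?u, liftX \<alpha>)"]) simp_all
  qed
qed

text \<open>A point near \<open>\<Phi> (u, y)\<close> is reached by starting near \<open>u\<close>,
  following \<alpha>, and adding a short path \<delta>. The same \<delta> moves \<open>y\<close>
  only a little in \<open>L\<close>, so the point is a value of \<open>\<Phi>\<close> near
  \<open>(u, y)\<close>.\<close>

lemma Phi_open: "open_map (prod_topology F L) E \<Phi>"
  unfolding open_map_def
proof (intro allI impI)
  fix Z assume Z: "openin (prod_topology F L) Z"
  show "openin E (\<Phi> ` Z)"
  proof (subst openin_subopen, rule ballI)
    fix e assume "e \<in> \<Phi> ` Z"
    then obtain u y where uy: "(u, y) \<in> Z" "e = \<Phi> (u, y)" by auto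
    obtain A T where AT: "openin F A" "openin L T" "u \<in> A" "y \<in> T" "A \<times> T \<subseteq> Z"
      using Z uy(1) unfolding openin_prod_topology_alt by meson
    have u: "u \<in> topspace F" and y: "y \<in> topspace L" using openin_subset[OF AT(1)] openin_subset[OF AT(2)] AT(3,4) by blast+
    obtain \<alpha> where \<alpha>: "from_base \<alpha>" "liftX \<alpha> = y" using leafLE[OF y] .
    have a: "pathin X \<alpha>" "\<alpha> 0 = x0" using \<alpha>(1) by (simp_all add: from_base_def)
    obtain T' where T': "openin XH T'" "T = T' \<inter> path_component_of_set XH xhat0"
      using AT(2) unfolding leafL_def openin_subtopology by blast
    have phy: "ph y = \<alpha> 1" using liftX_in(2)[OF \<alpha>(1)] \<alpha>(2) by simp
    have "y \<in> T'" using AT(4) T'(2) by blast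
    then obtain V where V: "openin X V" "\<alpha> 1 \<in> V"
      "\<And>\<delta>. path_within X V \<delta> \<Longrightarrow> \<delta> 0 = \<alpha> 1 \<Longrightarrow> lift_end XH ph y \<delta> \<in> T'"
      using Xhat_transport_small[OF T'(1), of y] unfolding phy by metis
    obtain U where U: "openin X U" "\<alpha> 1 \<in> U" "U \<subseteq> V" "path_connectedin X U" "categorical X U"
      using locally_categoricalE[OF X(1,2) V(1,2)] by metis
    \<comment> \<open>This is \<open>A\<close> carried along \<alpha> to the fibre over
      \<open>\<alpha> 1\<close>, written as a preimage under the reverse transport so that openness
      is immediate.\<close>
    let ?A = "{v \<in> topspace (fibre E p (\<alpha> 1)). lift v (path_rev \<alpha>) \<in> A}"
    have r: "pathin X (path_rev \<alpha>)" using a by blast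
    have "continuous_map (fibre E p (\<alpha> 1)) F (\<lambda>v. lift v (path_rev \<alpha>))"
      using continuous_map_fibre_transport[OF lp r] a by simp
    then have oA: "openin (fibre E p (\<alpha> 1)) ?A" using AT(1) by (rule openin_continuous_map_preimage)
    let ?S = "{lift v \<delta> |v \<delta>. v \<in> ?A \<and> path_within X U \<delta> \<and> \<delta> 0 = \<alpha> 1}"
    have oS: "openin E ?S" by (rule openin_transport[OF lp U(1,5,4,2) oA])
    have e: "e = lift u \<alpha>" unfolding uy(2) \<alpha>(2)[symmetric] by (rule Phi_eq[OF u \<alpha>(1)])
    have ein: "e \<in> topspace E" "p e = \<alpha> 1" unfolding e using lift_in_base[OF u \<alpha>(1)] by simp_all
    have "lift e (path_rev \<alpha>) = u" unfolding e by (rule lift_end_rev) (use u a in simp_all)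
    then have "e \<in> ?A" using ein AT(3) by simp
    moreover have "e = lift e (\<lambda>_. \<alpha> 1)" using lift_end_const[OF ein(1)] unfolding ein(2) by simp
    moreover have "path_within X U (\<lambda>_. \<alpha> 1)" using U(2) path_finish_in_topspace[OF a(1)] by simp
    ultimately have "e \<in> ?S" by blast
    moreover have "?S \<subseteq> \<Phi> ` Z"
    proof
      fix e' assume "e' \<in> ?S"
      then obtain v \<delta> where v: "v \<in> ?A" "path_within X U \<delta>" "\<delta> 0 = \<alpha> 1" "e' = lift v \<delta>" by blast
      have \<delta>: "pathin X \<delta>" "path_within X V \<delta>" using v(2) U(3) by (auto simp: pathin_subtopology)
      let ?w = "lift v (path_rev \<alpha>)"
      have w: "?w \<in> A" "?w \<in> topspace F" using v(1) openin_subset[OF AT(1)] by blast+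
      have "lift ?w (path_rev (path_rev \<alpha>)) = v" by (rule lift_end_rev) (use v(1) r in simp_all)
      then have wv: "lift ?w \<alpha> = v" by simp
      have fb: "from_base (path_concat \<alpha> \<delta>)" by (rule from_base_concat[OF \<alpha>(1) \<delta>(1)]) (use v(3) in simp)
      have y': "liftX (path_concat \<alpha> \<delta>) = lift_end XH ph y \<delta>"
        unfolding \<alpha>(2)[symmetric] by (rule liftX_concat[OF \<alpha>(1) \<delta>(1) v(3)])
      have "liftX (path_concat \<alpha> \<delta>) \<in> T"
        using V(3)[OF \<delta>(2) v(3)] liftX_in(3)[OF fb] unfolding T'(2) y' by (simp add: leafL_def)
      then have "(?w, liftX (path_concat \<alpha> \<delta>)) \<in> Z" using w(1) AT(5) by blast
      moreover have "\<Phi> (?w, liftX (path_concat \<alpha> \<delta>)) = e'"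
        using Phi_eq[OF w(2) fb] lift_concat_base[OF w(2) \<alpha>(1) \<delta>(1) v(3)] wv v(4) by simp
      ultimately show "e' \<in> \<Phi> ` Z" by (intro image_eqI[of e' \<Phi>, OF sym])
    qed
    ultimately show "\<exists>S. openin E S \<and> e \<in> S \<and> S \<subseteq> \<Phi> ` Z" using oS by blast
  qed
qed

text \<open>A path \<beta> to a nearby point \<open>y'\<close> is compared with \<alpha> followed by
  a short \<delta>. The loop between them closes in the covering that detects \<open>N\<close>, so
  its class is in \<open>N\<close>. Thus \<open>\<Phi> (u', y')\<close> comes from \<open>u'\<close>
  by this loop, then \<alpha>, then \<delta>, and each of the three steps is controlled.\<close>

lemma Phi_continuous: "continuous_map (prod_topology F L) E \<Phi>"
  unfolding continuous_map_def
proof (intro conjI allI impI)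
  show "\<Phi> \<in> topspace (prod_topology F L) \<rightarrow> topspace E" using Phi_surj by auto
  fix W assume W: "openin E W"
  show "openin (prod_topology F L) {z \<in> topspace (prod_topology F L). \<Phi> z \<in> W}"
    unfolding openin_prod_topology_alt
  proof (intro allI impI)
    fix u y assume "(u, y) \<in> {z \<in> topspace (prod_topology F L). \<Phi> z \<in> W}"
    then have u: "u \<in> topspace F" and y: "y \<in> topspace L" and inW: "\<Phi> (u, y) \<in> W"
      by (simp_all del: topspace_fibre)
    obtain \<alpha> where \<alpha>: "from_base \<alpha>" "liftX \<alpha> = y" using leafLE[OF y] .
    have a: "pathin X \<alpha>" "\<alpha> 0 = x0" using \<alpha>(1) by (simp_all add: from_base_def)
    have "lift u \<alpha> \<in> W" using inW Phi_eq[OF u \<alpha>(1)] \<alpha>(2) by simp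
    moreover have pe: "p (lift u \<alpha>) = \<alpha> 1" by (rule lift_in_base(2)[OF u \<alpha>(1)])
    \<comment> \<open>The target \<open>W\<close> is pulled back through the three steps in reverse
      order: \<open>V\<close> and \<open>A\<close> handle \<delta>, \<open>?B\<close> handles
      \<alpha>, and \<open>A1\<close> with \<open>N\<close> handles the loop.\<close>
    ultimately obtain V A where VA: "openin X V" "\<alpha> 1 \<in> V" "openin (fibre E p (\<alpha> 1)) A" "lift u \<alpha> \<in> A"
      "\<And>a \<delta>. a \<in> A \<Longrightarrow> path_within X V \<delta> \<Longrightarrow> \<delta> 0 = \<alpha> 1 \<Longrightarrow> lift a \<delta> \<in> W"
      using transport_small[OF lp X(1,2) W, of "lift u \<alpha>"] unfolding pe by metis
    let ?B = "{v \<in> topspace F. lift v \<alpha> \<in> A}"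
    have "continuous_map F (fibre E p (\<alpha> 1)) (\<lambda>v. lift v \<alpha>)"
      using continuous_map_fibre_transport[OF lp a(1)] a(2) by simp
    then have B: "openin F ?B" using VA(3) by (rule openin_continuous_map_preimage)
    have uB: "u \<in> ?B" using VA(4) u by blast
    obtain A1 N where A1: "openin F A1" "u \<in> A1" "finite_index_normal G N"
      "\<And>a \<gamma>. a \<in> A1 \<Longrightarrow> loop_at X x0 \<gamma> \<Longrightarrow> path_class X \<gamma> \<in> N \<Longrightarrow> lift a \<gamma> \<in> ?B"
      by (rule action_jointly_continuous[OF u B uB]) (rule that)
    obtain i where i: "i \<in> I" "\<And>c \<gamma>. c \<in> topspace (tot i) \<Longrightarrow> prj i c = x0 \<Longrightarrow> pathin X \<gamma> \<Longrightarrow> \<gamma> 0 = x0 \<Longrightarrow> \<gamma> 1 = x0 \<Longrightarrow>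
      clift i c \<gamma> = c \<Longrightarrow> path_class X \<gamma> \<in> N"
      by (rule finite_index_normal_cover[OF path_connected_X X A1(3)]) (rule that)
    interpret C: path_lifting "tot i" X "prj i" by (rule coord_path_lifting[OF i(1)])
    have yX: "y \<in> topspace XH" using liftX_in(1)[OF \<alpha>(1)] \<alpha>(2) by simp
    have yi: "y i \<in> topspace (tot i)" by (rule Xhat_coord[OF yX i(1)])
    have pyi: "prj i (y i) = \<alpha> 1" using phat_coord[OF yX i(1)] liftX_in(2)[OF \<alpha>(1)] \<alpha>(2) by simp
    have x0i: "xhat0 i \<in> topspace (tot i)" "prj i (xhat0 i) = x0"
      using Xhat_coord[OF xhat0(1) i(1)] phat_coord[OF xhat0(1) i(1)] xhat0(2) by simp_all
    have coord: "liftX \<beta> i = clift i (xhat0 i) \<beta>" if "from_base \<beta>" for \<beta>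
      using lift_end_Xhat_coord[OF xhat0(1), of \<beta> i] that xhat0(2) i(1) by (simp add: from_base_def)
    \<comment> \<open>The neighbourhood of \<open>y\<close> in \<open>L\<close> is given by a single
      sheet in the coordinate \<open>i\<close>; its image is path-connected to supply \<delta> and
      lies in \<open>V\<close> to keep \<delta> short.\<close>
    have "\<exists>S V'. openin (tot i) S \<and> y i \<in> S \<and> inj_on (prj i) S \<and> prj i ` S = V' \<and> V' \<subseteq> V \<and> path_connectedin X V' \<and> \<alpha> 1 \<in> V' \<and>
        (\<forall>\<delta>. path_within X V' \<delta> \<and> \<delta> 0 = \<alpha> 1 \<longrightarrow> clift i (y i) \<delta> \<in> S)"
    proof (rule covering_small_sheets[OF finite_regular_coversD(1)[OF i(1)] openin_topspace yi])
      fix V0 assume V0: "openin X V0" "prj i (y i) \<in> V0"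
      "\<And>V. openin X V \<Longrightarrow> V \<subseteq> V0 \<Longrightarrow> prj i (y i) \<in> V \<Longrightarrow> small_sheet (tot i) X (prj i) (y i) (topspace (tot i)) V"
      have "openin X (V0 \<inter> V)" "\<alpha> 1 \<in> V0 \<inter> V" using V0(1,2) VA(1,2) pyi by auto
      then obtain V' where V': "openin X V'" "\<alpha> 1 \<in> V'" "V' \<subseteq> V0 \<inter> V" "path_connectedin X V'"
        using locally_categoricalE[OF X(1,2)] by metis
      have "V' \<subseteq> V0" "prj i (y i) \<in> V'" using V'(2,3) pyi by auto
      from V0(3)[OF V'(1) this] V' show ?thesis unfolding small_sheet_def pyi by blast
    qed
    then obtain S V' where S: "openin (tot i) S" "y i \<in> S" "inj_on (prj i) S" "prj i ` S = V'" "V' \<subseteq> V"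
        "path_connectedin X V'" "\<alpha> 1 \<in> V'"
        "\<forall>\<delta>. path_within X V' \<delta> \<and> \<delta> 0 = \<alpha> 1 \<longrightarrow> clift i (y i) \<delta> \<in> S"
      by (elim exE conjE) (rule that)
    let ?T = "{y' \<in> topspace L. y' i \<in> S}"
    have "continuous_map L (tot i) (\<lambda>y. y i)"
      unfolding leafL_def by (rule continuous_map_from_subtopology[OF continuous_Xhat_coord[OF i(1)]])
    then have T: "openin L ?T" using S(1) by (rule openin_continuous_map_preimage)
    have "A1 \<times> ?T \<subseteq> {z \<in> topspace (prod_topology F L). \<Phi> z \<in> W}"
    proof
      fix z assume "z \<in> A1 \<times> ?T"
      then obtain u' y' where z: "z = (u', y')" "u' \<in> A1" "y' \<in> topspace L" "y' i \<in> S" by blast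
      have u': "u' \<in> topspace F" using z(2) openin_subset[OF A1(1)] by blast
      obtain \<beta> where \<beta>: "from_base \<beta>" "liftX \<beta> = y'" using leafLE[OF z(3)] .
      have b: "pathin X \<beta>" "\<beta> 0 = x0" using \<beta>(1) by (simp_all add: from_base_def)
      have y'X: "y' \<in> topspace XH" using liftX_in(1)[OF \<beta>(1)] \<beta>(2) by simp
      have py': "prj i (y' i) = \<beta> 1" using phat_coord[OF y'X i(1)] liftX_in(2)[OF \<beta>(1)] \<beta>(2) by simp
      have bV: "\<beta> 1 \<in> V'" unfolding py'[symmetric] S(4)[symmetric] by (rule imageI[OF z(4)])
      obtain \<delta> where \<delta>: "path_within X V' \<delta>" "\<delta> 0 = \<alpha> 1" "\<delta> 1 = \<beta> 1"
        using path_connectedinE[OF S(6,7) bV] .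
      have d: "pathin X \<delta>" "path_within X V \<delta>" using \<delta>(1) S(5) by (auto simp: pathin_subtopology)
      let ?\<epsilon> = "path_concat \<alpha> \<delta>"
      have fb: "from_base ?\<epsilon>" by (rule from_base_concat[OF \<alpha>(1) d(1)]) (use \<delta>(2) in simp)
      have ep: "pathin X ?\<epsilon>" "?\<epsilon> 0 = x0" "?\<epsilon> 1 = \<beta> 1" using fb \<delta>(3) by (simp_all add: from_base_def)
      have "liftX ?\<epsilon> = lift_end XH ph y \<delta>"
        unfolding \<alpha>(2)[symmetric] by (rule liftX_concat[OF \<alpha>(1) d(1) \<delta>(2)])
      then have "liftX ?\<epsilon> i = clift i (y i) \<delta>"
        using lift_end_Xhat_coord[OF yX d(1) _ i(1)] liftX_in(2)[OF \<alpha>(1)] \<alpha>(2) \<delta>(2) by simp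
      then have 1: "liftX ?\<epsilon> i \<in> S" using S(8) \<delta>(1,2) by simp
      have "prj i (liftX ?\<epsilon> i) = \<beta> 1"
        using phat_coord[OF liftX_in(1)[OF fb] i(1)] liftX_in(2)[OF fb] ep(3) by simp
      \<comment> \<open>The two paths may end at different points of \<open>L\<close>. Agreement in
        the one coordinate \<open>i\<close> follows as both ends lie in the sheet \<open>S\<close>
        over the same point, and it is enough to put the loop into \<open>N\<close>.\<close>
      then have eq: "liftX ?\<epsilon> i = y' i" using inj_onD[OF S(3) _ 1 z(4)] py' by simp
      have r: "pathin X (path_rev ?\<epsilon>)" using ep(1) by blast
      let ?\<gamma> = "path_concat \<beta> (path_rev ?\<epsilon>)"
      have \<gamma>: "loop_at X x0 ?\<gamma>" using b ep r by (simp add: loop_at_def pathin_concat)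
      have "clift i (xhat0 i) ?\<gamma> =
          clift i (clift i (xhat0 i) \<beta>) (path_rev ?\<epsilon>)"
        by (rule C.lift_end_concat) (use x0i b r ep in simp_all)
      also have "\<dots> = clift i (clift i (xhat0 i) ?\<epsilon>) (path_rev ?\<epsilon>)"
        using coord[OF \<beta>(1)] coord[OF fb] eq \<beta>(2) by simp
      also have "\<dots> = xhat0 i"
        by (rule C.lift_end_rev) (use x0i ep in simp_all)
      finally have closed: "clift i (xhat0 i) ?\<gamma> = xhat0 i" .
      have "path_class X ?\<gamma> \<in> N"
        by (rule i(2)[OF x0i _ _ _ closed]) (use \<gamma> in \<open>simp_all add: loop_at_def\<close>)
      then have w: "lift u' ?\<gamma> \<in> ?B" by (rule A1(4)[OF z(2) \<gamma>])
      have "\<Phi> z = lift u' \<beta>" unfolding z(1) \<beta>(2)[symmetric] by (rule Phi_eq[OF u' \<beta>(1)])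
      \<comment> \<open>Up to homotopy \<beta> is the loop followed by \<open>?\<epsilon>\<close>,
        so transport along it splits into the three controlled steps.\<close>
      also have "\<dots> = lift u' (path_concat ?\<gamma> ?\<epsilon>)"
        by (rule lift_homotopic_base[OF u' \<beta>(1) path_homotopic_sym[OF path_homotopic_cancel_right[OF b(1) ep(1)]]])
           (use ep in simp)
      also have "\<dots> = lift (lift u' ?\<gamma>) ?\<epsilon>"
        by (rule lift_concat_base[OF u' loop_from_base[OF \<gamma>] ep(1)]) (use ep in simp)
      also have "\<dots> = lift (lift (lift u' ?\<gamma>) \<alpha>) \<delta>"
        by (rule lift_concat_base[OF lift_loop[OF u' \<gamma>] \<alpha>(1) d(1) \<delta>(2)])
      finally have "\<Phi> z \<in> W"
        using VA(5)[OF _ d(2) \<delta>(2), of "lift (lift u' ?\<gamma>) \<alpha>"] w by simp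
      then show "z \<in> {z \<in> topspace (prod_topology F L). \<Phi> z \<in> W}"
        using u' z(1,3) by simp
    qed
    moreover have "y \<in> ?T" using y S(2) by simp
    ultimately show "\<exists>U T. openin F U \<and> openin L T \<and> u \<in> U \<and> y \<in> T \<and>
        U \<times> T \<subseteq> {z \<in> topspace (prod_topology F L). \<Phi> z \<in> W}"
      using A1(1,2) T by (intro exI[of _ A1] exI[of _ ?T]) simp
  qed
qed

text \<open>A continuous open surjection is a quotient map. As \<open>\<Phi>\<close> factors through
  the projection to the classes, so is \<open>\<Psi>\<close>; it is injective because the classes
  are the fibres of \<open>\<Phi>\<close>.\<close>

lemma homeomorphic_Phibar: "homeomorphic_map (borel_space E X p x0 xhat0) E (\<Psi>)"
proof -
  let ?P = "prod_topology F L" and ?B = "borel_space E X p x0 xhat0"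
  let ?c = "\<lambda>z. rel `` {z}"
  have c: "quotient_map ?P ?B ?c"
    unfolding borel_space_def by (rule quotient_map_quotient_topology)
  have "quotient_map ?P E \<Phi>"
    by (rule continuous_open_imp_quotient_map[OF Phi_continuous Phi_open]) (use Phi_surj in simp)
  then have "quotient_map ?P E (\<Psi> \<circ> ?c)"
    by (rule quotient_map_eq) (use Phibar_class in simp)
  then have q: "quotient_map ?B E \<Psi>"
    by (rule iffD1[OF quotient_map_compose_eq[OF c]])
  have "inj_on \<Psi> (topspace ?B)"
  proof (rule inj_onI)
    fix b b' assume "b \<in> topspace ?B" "b' \<in> topspace ?B" and eq: "\<Psi> b = \<Psi> b'"
    then obtain z z' where z: "z \<in> topspace F \<times> topspace L" "b = ?c z" "z' \<in> topspace F \<times> topspace L" "b' = ?c z'"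
      by (auto simp: borel_space_def)
    have "\<Phi> z = \<Phi> z'" using eq Phibar_class[OF z(1)] Phibar_class[OF z(3)] z(2,4) by simp
    then show "b = b'" unfolding z(2,4) borel_class[OF z(1)] borel_class[OF z(3)] by simp
  qed
  with q show ?thesis by (simp add: homeomorphic_map_def)
qed

end

text \<open>\<open>Phibar\<close> and \<open>Phi\<close> are definite descriptions; the first
  conjunct pins down their value for every admissible path, so that the second speaks of the
  intended map.\<close>

theorem theorem5p1:
  fixes X :: "'a topology" and E :: "'b topology" and p :: "'b \<Rightarrow> 'a" and x0 :: 'a
    and xhat0 :: "'a pointed_cover \<Rightarrow> 'a \<times> nat"
  assumes "path_connected_space X"
    and "locally_path_connected_space X"
    and "locally_categorical X"
    and "x0 \<in> topspace X"
    and "residually_finite (pi1 X x0)"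
    and "lifting_projection E X p"
    and "regular_projection E p"
    and "pi1_profinite E X p x0"
    and "\<And>x. x \<in> topspace X \<Longrightarrow> compact_space (fibre E p x) \<and> metrizable_space (fibre E p x)"
    and "dense_leaves E"
    and "xhat0 \<in> topspace (Xhat X x0)"
    and "phat X x0 xhat0 = x0"
  shows "(\<forall>u \<in> topspace (fibre E p x0). \<forall>y \<in> topspace (leafL X x0 xhat0). \<forall>\<alpha>.
            pathin X \<alpha> \<and> \<alpha> 0 = x0 \<and> lift_end (Xhat X x0) (phat X x0) xhat0 \<alpha> = y \<longrightarrow>
              Phibar E X p x0 xhat0 (borel_rel E X p x0 xhat0 `` {(u, y)}) = lift_end E p u \<alpha>)
       \<and> homeomorphic_map (borel_space E X p x0 xhat0) E (Phibar E X p x0 xhat0)"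
proof -
  \<comment> \<open>Metrizability of the fibre enters as the regularity required for the joint
    continuity of the action.\<close>
  have "regular_space (fibre E p x0)"
    using assms(4) assms(9)[of x0] metrizable_imp_regular_space by blast
  then interpret borel_construction E X p x0 xhat0
    using assms by unfold_locales
  show ?thesis
  proof (intro conjI ballI allI impI homeomorphic_Phibar)
    fix u y \<alpha> assume u: "u \<in> topspace F" and y: "y \<in> topspace L"
      and \<alpha>: "pathin X \<alpha> \<and> \<alpha> 0 = x0 \<and> liftX \<alpha> = y"
    have "Phibar E X p x0 xhat0 (borel_rel E X p x0 xhat0 `` {(u, y)}) = \<Phi> (u, y)"
      by (rule Phibar_class) (intro SigmaI u y)
    also have "\<dots> = lift u \<alpha>"
      using Phi_eq[OF u, of \<alpha>] \<alpha> by (simp add: from_base_def)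
    finally show "Phibar E X p x0 xhat0 (borel_rel E X p x0 xhat0 `` {(u, y)}) = lift u \<alpha>" .
  qed
qed

end
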